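(* Assume that $\mathcal{D}(A)\subset\mathcal{D}(Q^{-1/2})$, $|(-A)^{1/2}Q^{1/2}|_{\mathcal{L}_2(H)}<\infty$ and $|Q^{-1/2}(-A)^{-1}|_{\mathcal{L}(H)}<\infty$. Assume that $F\colon H\to H$ is Fréchet differentiable and that there exist $L_F,L>0$ such that $|F(u)-F(v)|\le L_F|u-v|$ for $u,v\in H$, $|F(u)|_{\dot H^1}\le L(1+|u|_{\dot H^1})$ for $u\in\dot H^1$, and $|F'(u)v|_{\dot H^2}\le L(1+|u|_{\dot H^2}^2)|v|_{\dot H^2}$ for $u,v\in\dot H^2$. Let $T>0$ and $x\in\dot H^2$. Then the spectral Galerkin method weakly asymptotically preserves the large deviations principle of $\{X_x^\varepsilon\}_{\varepsilon>0}$, that is: for any $\kappa>0$ and any $z\in W_{2,Q}^{1,2}(T)$ with $z(0)=x$, there exist $n\in\mathbb{N}^+$ and $z_n\in\mathcal{H}_1^{n,y}(T)$, where $y=P_nx$, such that $$|z-z_n|_{C([0,T];H)}<\kappa,\qquad |I_{0,T}^x(z)-I_{0,T}^{n,y}(z_n)|<\kappa.$$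
   Context: $H:=L^2((0,1);\mathbb{R})$ with inner product $\langle\cdot,\cdot\rangle$ and norm $|\cdot|$; $\mathcal{L}(H)$ and $\mathcal{L}_2(H)$ are the bounded and the Hilbert–Schmidt operators on $H$. $A$ is the Dirichlet Laplacian on $(0,1)$, $\mathcal{D}(A)=H_0^1\cap H^2$; $e_i(\xi)=\sqrt2\sin(i\pi\xi)$ is an orthonormal basis of $H$ with $-Ae_i=\lambda_ie_i$, $\lambda_i=\pi^2i^2$. For $\gamma\in\mathbb{R}$, $\dot H^\gamma:=\mathcal{D}((-A)^{\gamma/2})$ with norm $|u|_{\dot H^\gamma}=|(-A)^{\gamma/2}u|$. $Q$ is a self-adjoint, positive definite bounded linear operator on $H$ with $Qe_i=q_ie_i$, $q_i>0$; $Q^{-1/2}\colon Q^{1/2}(H)\to H$ is the inverse of $Q^{1/2}$ and $\mathcal{D}(Q^{-1/2})=Q^{1/2}(H)$. $X_x^\varepsilon$ denotes the mild solution of $dX=(AX+F(X))dt+\varepsilon Q^{1/2}dW$, $X(0)=x$ ($W$ a cylindrical Wiener process on $H$). Its sample path rate function on $C([0,T];H)$ is $$I_{0,T}^x(z)=\tfrac12\inf\{|\varphi|_{L^2(0,T;H)}^2:\varphi\in L^2(0,T;H),\ z_{0,x}^\varphi=z\}\quad(\inf\emptyset=+\infty),$$ where $z_{0,x}^\varphi$ is the mild solution of the skeleton equation $\frac{dz}{dt}=Az+F(z)+Q^{1/2}\varphi$ on $(0,T]$, $z(0)=x$. $W_2^{1,2}(T)$ is the closure of $C^\infty([0,T]\times[0,1];\mathbb{R})$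 in the norm $\big(\int_0^T\int_0^1|z|^2+|\partial_tz|^2+|\partial_\xi z|^2+|\partial_\xi^2z|^2\,d\xi dt\big)^{1/2}$, and $W_{2,Q}^{1,2}(T)$ is the set of $z\in W_2^{1,2}(T)$ such that $\frac{dz(t)}{dt}-Az(t)-F(z(t))\in Q^{1/2}(H)$ for almost all $t\in[0,T]$ (so implicitly $z(t)\in\mathcal{D}(A)$ for almost all $t$) and $\int_0^T|Q^{-1/2}(\frac{dz(t)}{dt}-Az(t)-F(z(t)))|^2dt<\infty$. For $n\in\mathbb{N}^+$: $H_n:=\mathrm{span}\{e_1,\dots,e_n\}$, $P_n$ is the orthogonal projection of $H$ onto $H_n$, $A_n:=P_nA$ (on $H_n$), $F_n:=P_nF$, $Q_n^{1/2}:=P_nQ^{1/2}$ (a bijection of $H_n$). The spectral Galerkin method is $dX^{\varepsilon,n}_y=(A_nX^{\varepsilon,n}_y+F_n(X^{\varepsilon,n}_y))dt+\varepsilon Q_n^{1/2}d(P_nW)$, $X^{\varepsilon,n}_y(0)=y=P_nx$. Its sample path rate function on $C([0,T];H_n)$ is $I_{0,T}^{n,y}(z)=\tfrac12\inf\{|\psi|_{L^2(0,T;H)}^2:\psi\in L^2(0,T;H_n),\ z_{0,y}^{n,\psi}=z\}$, where $z_{0,y}^{n,\psi}$ is the mild solution of $\frac{dz}{dt}=A_nz+F_n(z)+Q_n^{1/2}\psi$, $z(0)=y$. Its effective domain is $$\mathcal{H}_1^{n,y}(T):=\Big\{z\in C([0,T];H_n): z(\cdot)=y+\int_0^\cdot\upsilon(s)ds,\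 \upsilon\in L^2(0,T;H_n)\Big\}.$$ *)

theory Defs
  imports "HOL-Analysis.Analysis"
begin

definition unit_measure :: "real measure" where
  "unit_measure = restrict_space lborel {0<..<1}"

definition square_integrable :: "(real \<Rightarrow> real) \<Rightarrow> bool" where
  "square_integrable f \<longleftrightarrow>
     f \<in> borel_measurable unit_measure \<and> integrable unit_measure (\<lambda>x. (f x)\<^sup>2)"

lemma finite_unit_measure: "finite_measure unit_measure"
  by (rule finite_measureI) (simp add: unit_measure_def emeasure_restrict_space space_restrict_space)

interpretation unit_measure: finite_measure unit_measure
  by (rule finite_unit_measure)

lemma space_unit_measure [simp]: "space unit_measure = {0<..<1}"
  by (simp add: unit_measure_def space_restrict_space)

lemma measure_unit_space [simp]: "measure unit_measure {0<..<1} = 1"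
  by (simp add: unit_measure_def measure_restrict_space)

lemma square_integrable_mult:
  assumes "square_integrable f" "square_integrable g"
  shows "integrable unit_measure (\<lambda>x. f x * g x)"
proof (rule Bochner_Integration.integrable_bound)
  show "integrable unit_measure (\<lambda>x. (f x)\<^sup>2 + (g x)\<^sup>2)"
    using assms by (auto simp: square_integrable_def)
  show "(\<lambda>x. f x * g x) \<in> borel_measurable unit_measure"
    using assms by (auto simp: square_integrable_def)
  have "\<bar>a * b\<bar> \<le> \<bar>a\<^sup>2 + b\<^sup>2\<bar>" for a b :: real
  proof -
    have "2 * (\<bar>a\<bar> * \<bar>b\<bar>) \<le> a\<^sup>2 + b\<^sup>2"
      using sum_squares_bound[of "\<bar>a\<bar>" "\<bar>b\<bar>"] by simp
    moreover have "0 \<le> \<bar>a\<bar> * \<bar>b\<bar>" by simp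
    ultimately have "\<bar>a\<bar> * \<bar>b\<bar> \<le> a\<^sup>2 + b\<^sup>2" by linarith
    then show ?thesis by (simp add: abs_mult)
  qed
  then show "AE x in unit_measure. norm (f x * g x) \<le> norm ((f x)\<^sup>2 + (g x)\<^sup>2)"
    by auto
qed

lemma square_integrable_add:
  assumes "square_integrable f" "square_integrable g"
  shows "square_integrable (\<lambda>x. f x + g x)"
  using assms square_integrable_mult[OF assms]
  by (auto simp: square_integrable_def power2_sum mult.assoc)

lemma square_integrable_scale:
  assumes "square_integrable f"
  shows "square_integrable (\<lambda>x. c * f x)"
  using assms by (auto simp: square_integrable_def power_mult_distrib)

lemma square_integrable_bounded:
  assumes "f \<in> borel_measurable unit_measure" "\<And>x. \<bar>f x\<bar> \<le> B"
  shows "square_integrable f"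
  unfolding square_integrable_def
proof
  show "integrable unit_measure (\<lambda>x. (f x)\<^sup>2)"
  proof (rule unit_measure.integrable_const_bound[where B="B\<^sup>2"])
    have "(f x)\<^sup>2 \<le> B\<^sup>2" for x
      using power_mono[OF assms(2)[of x], of 2] by simp
    then show "AE x in unit_measure. norm ((f x)\<^sup>2) \<le> B\<^sup>2" by simp
  qed (use assms in auto)
qed fact

text \<open>The real Hilbert space \<open>L\<^sup>2((0,1))\<close>: square-integrable functions modulo equality almost
  everywhere. \<open>abs_L2 f\<close> is the class of \<open>f\<close> and is meaningful only if \<open>f\<close> is square-integrable.\<close>

quotient_type L2 = "real \<Rightarrow> real" / partial:
  "\<lambda>f g. square_integrable f \<and> square_integrable g \<and> (AE x in unit_measure. f x = g x)"
proof (rule part_equivpI)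
  have "square_integrable (\<lambda>x. 0)" by (simp add: square_integrable_def)
  then show "\<exists>f. square_integrable f \<and> square_integrable f \<and> (AE x in unit_measure. f x = f x)"
    by auto
  show "symp (\<lambda>f g. square_integrable f \<and> square_integrable g \<and> (AE x in unit_measure. f x = g x))"
    by (auto simp: symp_def elim: eventually_mono)
  show "transp (\<lambda>f g. square_integrable f \<and> square_integrable g \<and> (AE x in unit_measure. f x = g x))"
    by (auto simp: transp_def elim: eventually_elim2)
qed

instantiation L2 :: real_vector
begin

lift_definition zero_L2 :: L2 is "\<lambda>x. 0"
  by (simp add: square_integrable_def)

lift_definition plus_L2 :: "L2 \<Rightarrow> L2 \<Rightarrow> L2" is "\<lambda>f g x. f x + g x"
  by (auto intro: square_integrable_add elim: eventually_elim2)

lift_definition scaleR_L2 :: "real \<Rightarrow> L2 \<Rightarrow> L2" is "\<lambda>c f x. c * f x"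
  by (auto intro: square_integrable_scale elim: eventually_mono)

definition uminus_L2 :: "L2 \<Rightarrow> L2" where "- f = (-1) *\<^sub>R f" for f :: L2

definition minus_L2 :: "L2 \<Rightarrow> L2 \<Rightarrow> L2" where "f - g = f + - g" for f g :: L2

instance
proof
  fix f g h :: L2 and a b :: real
  show "f + g + h = f + (g + h)"
    by transfer (auto simp: add.assoc intro: square_integrable_add)
  show "f + g = g + f"
    by transfer (auto simp: add.commute intro: square_integrable_add)
  show "0 + f = f"
    by transfer auto
  show "- f + f = 0"
    unfolding uminus_L2_def
    by transfer (auto simp: square_integrable_def)
  show "f - g = f + - g"
    by (rule minus_L2_def)
  show "a *\<^sub>R (f + g) = a *\<^sub>R f + a *\<^sub>R g"
    by transfer (auto simp: distrib_left intro!: square_integrable_add square_integrable_scale)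
  show "(a + b) *\<^sub>R f = a *\<^sub>R f + b *\<^sub>R f"
    by transfer (auto simp: distrib_right intro!: square_integrable_add square_integrable_scale)
  show "a *\<^sub>R b *\<^sub>R f = (a * b) *\<^sub>R f"
    by transfer (auto simp: mult.assoc intro!: square_integrable_scale)
  show "1 *\<^sub>R f = f"
    by transfer auto
qed

end

instantiation L2 :: real_inner
begin

lift_definition inner_L2 :: "L2 \<Rightarrow> L2 \<Rightarrow> real" is "\<lambda>f g. \<integral>x. f x * g x \<partial>unit_measure"
  by (intro integral_cong_AE) (auto simp: square_integrable_def elim: eventually_elim2)

definition norm_L2 :: "L2 \<Rightarrow> real" where "norm f = sqrt (inner f f)" for f :: L2

definition sgn_L2 :: "L2 \<Rightarrow> L2" where "sgn f = f /\<^sub>R norm f" for f :: L2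

definition dist_L2 :: "L2 \<Rightarrow> L2 \<Rightarrow> real" where "dist f g = norm (f - g)" for f g :: L2

definition uniformity_L2 :: "(L2 \<times> L2) filter" where
  "uniformity_L2 = (INF e\<in>{0 <..}. principal {(x, y). dist x y < e})"

definition open_L2 :: "L2 set \<Rightarrow> bool" where
  "open_L2 S = (\<forall>x\<in>S. \<forall>\<^sub>F (x', y) in uniformity. x' = x \<longrightarrow> y \<in> S)"

instance
proof
  fix f g h :: L2 and a :: real
  show "inner f g = inner g f"
    by transfer (auto simp: mult.commute)
  show "inner (f + g) h = inner f h + inner g h"
    by transfer (auto simp: distrib_right square_integrable_mult)
  show "inner (a *\<^sub>R f) g = a * inner f g"
    by transfer (auto simp: mult.assoc)
  show "0 \<le> inner f f"
    by transfer auto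
  show "(inner f f = 0) = (f = 0)"
    by transfer
      (auto simp: square_integrable_def integral_nonneg_eq_0_iff_AE power2_eq_square[symmetric])
qed (rule norm_L2_def sgn_L2_def dist_L2_def uniformity_L2_def open_L2_def)+

end

lemma L2_cases:
  obtains f where "square_integrable f" "u = abs_L2 f"
proof
  show "square_integrable (rep_L2 u)"
    using Quotient_rep_reflp[OF Quotient_L2, of u] by auto
  show "u = abs_L2 (rep_L2 u)"
    using Quotient_abs_rep[OF Quotient_L2, of u] by simp
qed

lemma inner_abs_L2:
  "square_integrable f \<Longrightarrow> square_integrable g \<Longrightarrow>
     inner (abs_L2 f) (abs_L2 g) = (\<integral>x. f x * g x \<partial>unit_measure)"
  by (simp add: inner_L2.abs_eq)

lemma norm_abs_L2:
  "square_integrable f \<Longrightarrow> (norm (abs_L2 f))\<^sup>2 = (\<integral>x. (f x)\<^sup>2 \<partial>unit_measure)"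
  unfolding power2_norm_eq_inner by (simp add: inner_abs_L2 power2_eq_square)

lemma add_abs_L2:
  "square_integrable f \<Longrightarrow> square_integrable g \<Longrightarrow> abs_L2 f + abs_L2 g = abs_L2 (\<lambda>x. f x + g x)"
  by (simp add: plus_L2.abs_eq)

lemma scaleR_abs_L2:
  "square_integrable f \<Longrightarrow> c *\<^sub>R abs_L2 f = abs_L2 (\<lambda>x. c * f x)"
  by (simp add: scaleR_L2.abs_eq)

lemma diff_abs_L2:
  assumes "square_integrable f" "square_integrable g"
  shows "abs_L2 f - abs_L2 g = abs_L2 (\<lambda>x. f x - g x)"
  using add_abs_L2[OF assms(1) square_integrable_scale[OF assms(2), of "-1"]]
    scaleR_abs_L2[OF assms(2), of "-1"]
  by (simp add: diff_conv_add_uminus del: add_uminus_conv_diff)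

lemma square_integrable_diff:
  assumes "square_integrable f" "square_integrable g"
  shows "square_integrable (\<lambda>x. f x - g x)"
  using square_integrable_add[OF assms(1) square_integrable_scale[OF assms(2), of "-1"]] by simp

lemma integral_abs_le_norm_L2:
  assumes "square_integrable f"
  shows "(\<integral>x. \<bar>f x\<bar> \<partial>unit_measure) \<le> norm (abs_L2 f)"
proof -
  have 1: "square_integrable (\<lambda>x. 1)" by (rule square_integrable_bounded[of _ 1]) auto
  have 2: "square_integrable (\<lambda>x. \<bar>f x\<bar>)" using assms by (auto simp: square_integrable_def)
  have n1: "norm (abs_L2 (\<lambda>x. 1)) = 1"
    using norm_abs_L2[OF 1] norm_ge_zero[of "abs_L2 (\<lambda>x. 1)"] by (simp add: power2_eq_1_iff del: norm_ge_zero)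
  have "(norm (abs_L2 (\<lambda>x. \<bar>f x\<bar>)))\<^sup>2 = (norm (abs_L2 f))\<^sup>2"
    by (simp add: norm_abs_L2 2 assms)
  then have n2: "norm (abs_L2 (\<lambda>x. \<bar>f x\<bar>)) = norm (abs_L2 f)"
    by simp
  show ?thesis
    using norm_cauchy_schwarz[of "abs_L2 (\<lambda>x. \<bar>f x\<bar>)" "abs_L2 (\<lambda>x. 1)"]
    by (simp add: inner_abs_L2 1 2 n1 n2)
qed

instance L2 :: complete_space
proof
  fix X :: "nat \<Rightarrow> L2"
  assume "Cauchy X"
  then have "\<forall>k. \<exists>N. \<forall>m\<ge>N. \<forall>n\<ge>N. dist (X m) (X n) < (1/2)^k"
    unfolding Cauchy_def by (metis half_gt_zero_iff zero_less_power zero_less_one half_gt_zero)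
  then obtain N where N: "\<And>k m n. m \<ge> N k \<Longrightarrow> n \<ge> N k \<Longrightarrow> dist (X m) (X n) < (1/2)^k"
    by metis
  define r where "r k = (\<Sum>j\<le>k. N j) + k" for k
  have r: "strict_mono r" unfolding r_def strict_mono_Suc_iff by simp
  have rN: "N k \<le> r k" for k
    unfolding r_def by (rule trans_le_add1) (rule member_le_sum, auto)
  have Xr: "dist (X (r l)) (X (r k)) < (1/2)^k" if "k \<le> l" for k l
    using that rN[of k] strict_mono_leD[OF r that] by (intro N) auto
  obtain g where g: "\<And>k. square_integrable (g k)" "\<And>k. X (r k) = abs_L2 (g k)"
  proof -
    have "\<forall>k. \<exists>f. square_integrable f \<and> X (r k) = abs_L2 f"
      using L2_cases by blast
    then show ?thesis using that by metis
  qed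
  have g_meas [measurable]: "g k \<in> borel_measurable unit_measure" for k
    using g(1)[of k] by (simp add: square_integrable_def)
  have sq: "square_integrable (\<lambda>x. g l x - g k x)" for k l
    by (intro square_integrable_diff g)
  have dist_g: "dist (X (r l)) (X (r k)) = norm (abs_L2 (\<lambda>x. g l x - g k x))" for k l
    by (simp add: dist_norm g diff_abs_L2)
  have int_d: "integrable unit_measure (\<lambda>x. \<bar>g (Suc k) x - g k x\<bar>)" for k
  proof -
    have "square_integrable (\<lambda>x. \<bar>g (Suc k) x - g k x\<bar>)"
      using sq[of "Suc k" k] by (simp add: square_integrable_def)
    from square_integrable_mult[OF this square_integrable_bounded[of "\<lambda>_. 1" 1]] show ?thesis
      by simp
  qed
  have d_le: "(\<integral>x. \<bar>g (Suc k) x - g k x\<bar> \<partial>unit_measure) \<le> (1/2)^k" for k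
    using integral_abs_le_norm_L2[OF sq[of "Suc k" k]] Xr[of k "Suc k"] by (simp add: dist_g)
  have "(\<integral>\<^sup>+x. (\<Sum>k. ennreal \<bar>g (Suc k) x - g k x\<bar>) \<partial>unit_measure)
      = (\<Sum>k. \<integral>\<^sup>+x. ennreal \<bar>g (Suc k) x - g k x\<bar> \<partial>unit_measure)"
    by (intro nn_integral_suminf) auto
  also have "\<dots> \<le> (\<Sum>k. ennreal ((1/2)^k))"
    by (intro suminf_le) (auto simp: nn_integral_eq_integral int_d intro!: ennreal_leI d_le)
  also have "\<dots> < \<infinity>"
    by (subst suminf_ennreal2) (auto simp: summable_geometric)
  finally have "AE x in unit_measure. (\<Sum>k. ennreal \<bar>g (Suc k) x - g k x\<bar>) \<noteq> \<infinity>"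
    by (intro nn_integral_PInf_AE) auto
  then have conv: "AE x in unit_measure. convergent (\<lambda>k. g k x)"
  proof (rule eventually_mono)
    fix x assume "(\<Sum>k. ennreal \<bar>g (Suc k) x - g k x\<bar>) \<noteq> \<infinity>"
    then have "summable (\<lambda>k. \<bar>g (Suc k) x - g k x\<bar>)"
      by (intro summable_suminf_not_top) auto
    then have "summable (\<lambda>k. g (Suc k) x - g k x)"
      by (rule summable_rabs_cancel)
    then have "convergent (\<lambda>n. \<Sum>k<n. g (Suc k) x - g k x)"
      by (simp add: summable_iff_convergent)
    then have "convergent (\<lambda>n. g n x - g 0 x)"
      by (simp only: sum_lessThan_telescope[of "\<lambda>k. g k x"])
    then show "convergent (\<lambda>k. g k x)"
      using convergent_diff_const_right_iff by blast
  qed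
  define h where "h x = lim (\<lambda>k. g k x)" for x
  have h_meas [measurable]: "h \<in> borel_measurable unit_measure"
    unfolding h_def by measurable
  have gh: "AE x in unit_measure. (\<lambda>k. g k x) \<longlonglongrightarrow> h x"
    using conv by (rule eventually_mono) (simp add: h_def convergent_LIMSEQ_iff)
  have nn: "(\<integral>\<^sup>+x. ennreal ((h x - g k x)\<^sup>2) \<partial>unit_measure) \<le> ennreal (((1/2)^k)\<^sup>2)" for k
  proof -
    have "(\<integral>\<^sup>+x. ennreal ((h x - g k x)\<^sup>2) \<partial>unit_measure)
        = (\<integral>\<^sup>+x. liminf (\<lambda>l. ennreal ((g l x - g k x)\<^sup>2)) \<partial>unit_measure)"
    proof (rule nn_integral_cong_AE, use gh in \<open>rule eventually_mono\<close>)
      fix x assume "(\<lambda>k. g k x) \<longlonglongrightarrow> h x"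
      then have "(\<lambda>l. ennreal ((g l x - g k x)\<^sup>2)) \<longlonglongrightarrow> ennreal ((h x - g k x)\<^sup>2)"
        by (intro tendsto_ennrealI tendsto_intros)
      then show "ennreal ((h x - g k x)\<^sup>2) = liminf (\<lambda>l. ennreal ((g l x - g k x)\<^sup>2))"
        by (intro lim_imp_Liminf[symmetric] trivial_limit_sequentially)
    qed
    also have "\<dots> \<le> liminf (\<lambda>l. \<integral>\<^sup>+x. ennreal ((g l x - g k x)\<^sup>2) \<partial>unit_measure)"
      by (rule nn_integral_liminf) measurable
    also have "\<dots> \<le> liminf (\<lambda>l. ennreal (((1/2)^k)\<^sup>2))"
    proof (rule Liminf_mono, rule eventually_sequentiallyI[of k])
      fix l assume "k \<le> l"
      have "(\<integral>\<^sup>+x. ennreal ((g l x - g k x)\<^sup>2) \<partial>unit_measure)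
          = ennreal ((norm (abs_L2 (\<lambda>x. g l x - g k x)))\<^sup>2)"
        using sq[of l k] by (simp add: norm_abs_L2 square_integrable_def nn_integral_eq_integral)
      also have "\<dots> \<le> ennreal (((1/2)^k)\<^sup>2)"
        using Xr[OF \<open>k \<le> l\<close>] by (intro ennreal_leI power_mono) (auto simp: dist_g)
      finally show "(\<integral>\<^sup>+x. ennreal ((g l x - g k x)\<^sup>2) \<partial>unit_measure) \<le> ennreal (((1/2)^k)\<^sup>2)" .
    qed
    finally show ?thesis by (simp add: Liminf_const)
  qed
  have sq_hg: "square_integrable (\<lambda>x. h x - g k x)" for k
    unfolding square_integrable_def
    using nn[of k] by (auto intro!: integrableI_bounded simp: less_top[symmetric] top_unique)
  have sq_h: "square_integrable h"
    using square_integrable_add[OF sq_hg[of 0] g(1)[of 0]] by simp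
  have le: "dist (X (r k)) (abs_L2 h) \<le> (1/2)^k" for k
  proof -
    have "ennreal ((norm (abs_L2 (\<lambda>x. h x - g k x)))\<^sup>2) \<le> ennreal (((1/2)^k)\<^sup>2)"
      using nn[of k] sq_hg[of k]
      by (simp add: norm_abs_L2 square_integrable_def nn_integral_eq_integral)
    then have "(norm (abs_L2 (\<lambda>x. h x - g k x)))\<^sup>2 \<le> ((1/2)^k)\<^sup>2"
      by (subst (asm) ennreal_le_iff) auto
    then have "norm (abs_L2 (\<lambda>x. h x - g k x)) \<le> (1/2)^k"
      by (rule power2_le_imp_le) auto
    then show ?thesis
      by (subst dist_commute) (simp add: dist_norm g sq_h diff_abs_L2)
  qed
  have "(\<lambda>k. dist (X (r k)) (abs_L2 h)) \<longlonglongrightarrow> 0"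
    by (rule tendsto_sandwich[of "\<lambda>_. 0" _ _ "\<lambda>k. (1/2)^k"]) (auto simp: le LIMSEQ_realpow_zero)
  then have "(X \<circ> r) \<longlonglongrightarrow> abs_L2 h"
    by (subst tendsto_dist_iff) (simp add: o_def)
  then have "X \<longlonglongrightarrow> abs_L2 h"
    using Cauchy_converges_subseq[OF \<open>Cauchy X\<close> r] by blast
  then show "convergent X" by (auto simp: convergent_def)
qed

instance L2 :: banach ..

lemma square_integrable_indicator:
  "A \<in> sets unit_measure \<Longrightarrow> square_integrable (indicator A)"
  by (rule square_integrable_bounded[of _ 1]) (auto simp: indicator_def)

text \<open>Separability: rational combinations of indicators of intervals with rational endpoints
  are dense.\<close>

definition rational_step :: "(rat \<times> rat) list \<Rightarrow> L2" where
  "rational_step xs =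
     (\<Sum>(c, a)\<leftarrow>xs. of_rat c *\<^sub>R abs_L2 (indicator ({0<..<1} \<inter> {..of_rat a})))"

lemma rational_step_in_closure: "rational_step xs \<in> closure (range rational_step)"
  by (rule subsetD[OF closure_subset rangeI])

lemma closure_rational_stepI:
  "(\<And>n. x n \<in> range rational_step) \<Longrightarrow> x \<longlonglongrightarrow> u \<Longrightarrow> u \<in> closure (range rational_step)"
  unfolding closure_sequential by (intro exI[of _ x] conjI allI)

lemma closure_seqE:
  fixes S :: "'a::first_countable_topology set"
  assumes "u \<in> closure S"
  obtains x where "\<And>n. x n \<in> S" "x \<longlonglongrightarrow> u"
  using assms by (auto simp: closure_sequential)

lemma closure_rational_step_add:
  assumes "u \<in> closure (range rational_step)" "v \<in> closure (range rational_step)"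
  shows "u + v \<in> closure (range rational_step)"
proof -
  obtain x where x: "\<And>n. x n \<in> range rational_step" "x \<longlonglongrightarrow> u"
    using assms(1) by (rule closure_seqE) (rule that)
  obtain y where y: "\<And>n. y n \<in> range rational_step" "y \<longlonglongrightarrow> v"
    using assms(2) by (rule closure_seqE) (rule that)
  have "x n + y n \<in> range rational_step" for n
  proof -
    obtain xs ys where "x n = rational_step xs" "y n = rational_step ys"
      using x(1)[of n] y(1)[of n] by auto
    then have "x n + y n = rational_step (xs @ ys)"
      by (simp add: rational_step_def)
    then show ?thesis by simp
  qed
  moreover have "(\<lambda>n. x n + y n) \<longlonglongrightarrow> u + v"
    using x y by (intro tendsto_add)
  ultimately show ?thesis
    by (rule closure_rational_stepI)
qed

lemma closure_rational_step_scale: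
  assumes "u \<in> closure (range rational_step)"
  shows "c *\<^sub>R u \<in> closure (range rational_step)"
proof -
  obtain x where x: "\<And>n. x n \<in> range rational_step" "x \<longlonglongrightarrow> u"
    using assms by (rule closure_seqE) (rule that)
  have "c \<in> closure \<rat>"
    by (simp add: Rats_closure_real)
  then obtain q where q: "\<And>n. q n \<in> \<rat>" "q \<longlonglongrightarrow> c"
    by (rule closure_seqE) (rule that)
  have "q n *\<^sub>R x n \<in> range rational_step" for n
  proof -
    obtain xs where xs: "x n = rational_step xs"
      using x(1)[of n] by auto
    obtain p where p: "q n = of_rat p"
      using q(1)[of n] by (auto elim: Rats_cases)
    have "of_rat p *\<^sub>R rational_step xs = rational_step (map (\<lambda>(c, a). (p * c, a)) xs)"
      by (induction xs) (auto simp: rational_step_def scaleR_right_distrib of_rat_mult)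
    then show ?thesis by (simp add: xs p)
  qed
  moreover have "(\<lambda>n. q n *\<^sub>R x n) \<longlonglongrightarrow> c *\<^sub>R u"
    using x q by (intro tendsto_scaleR)
  ultimately show ?thesis
    by (rule closure_rational_stepI)
qed

lemma closure_rational_step_interval:
  "abs_L2 (indicator ({0<..<1} \<inter> {..of_rat a})) \<in> closure (range rational_step)"
proof -
  have "abs_L2 (indicator ({0<..<1} \<inter> {..of_rat a})) = rational_step [(1, a)]"
    by (simp add: rational_step_def)
  then show ?thesis by (simp only: rational_step_in_closure)
qed

lemma sets_unit_measure_sigma:
  "sets unit_measure = sigma_sets {0<..<1} (range (\<lambda>a. {0<..<1} \<inter> {..real_of_rat a}))"
proof -
  have borel: "sets (borel :: real measure) = sigma_sets UNIV (range (\<lambda>a. {..real_of_rat a}))"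
  proof (rule antisym)
    have "{..b} \<in> sigma_sets UNIV (range (\<lambda>a. {..real_of_rat a}))" for b :: real
    proof -
      have "{..b} = (\<Inter>a\<in>{a. b < real_of_rat a}. {..real_of_rat a})"
      proof safe
        fix x assume *: "x \<in> (\<Inter>a\<in>{a. b < real_of_rat a}. {..real_of_rat a})"
        show "x \<le> b"
        proof (rule ccontr)
          assume "\<not> x \<le> b"
          then obtain q where "b < real_of_rat q" "real_of_rat q < x"
            using of_rat_dense[of b x] by auto
          with * show False by force
        qed
      qed auto
      also have "\<dots> \<in> sigma_sets UNIV (range (\<lambda>a. {..real_of_rat a}))"
      proof (cases "{a. b < real_of_rat a} = {}")
        case True
        obtain q where "b < real_of_rat q" "real_of_rat q < b + 1"
          using of_rat_dense[of b "b+1"] by auto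
        with True show ?thesis by auto
      next
        case False
        interpret sigma_algebra UNIV "sigma_sets UNIV (range (\<lambda>a. {..real_of_rat a}))"
          by (rule sigma_algebra_sigma_sets) auto
        show ?thesis
          by (rule countable_INT') (use False in auto)
      qed
      finally show ?thesis .
    qed
    then have "sigma_sets UNIV (range (\<lambda>b::real. {..b})) \<subseteq> sigma_sets UNIV (range (\<lambda>a. {..real_of_rat a}))"
      by (intro sigma_sets_mono) auto
    then show "sets (borel :: real measure) \<subseteq> sigma_sets UNIV (range (\<lambda>a. {..real_of_rat a}))"
      by (subst borel_eq_atMost) (simp add: sets_measure_of)
    show "sigma_sets UNIV (range (\<lambda>a. {..real_of_rat a})) \<subseteq> sets (borel :: real measure)"
      by (rule sets.sigma_sets_subset[of _ "borel :: real measure", simplified]) auto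
  qed
  from borel have "sets unit_measure = (\<inter>) {0<..<1} ` sigma_sets UNIV (range (\<lambda>a. {..real_of_rat a}))"
    by (simp add: unit_measure_def sets_restrict_space)
  also have "\<dots> = sigma_sets {0<..<1} ((\<inter>) {0<..<1} ` range (\<lambda>a. {..real_of_rat a}))"
  proof (rule sigma_sets_Int)
    show "{0<..<1} \<in> sigma_sets UNIV (range (\<lambda>a. {..real_of_rat a}))"
      using borel by (metis borel_open open_greaterThanLessThan)
  qed simp
  finally show ?thesis by (simp add: image_image)
qed

lemma dist_indicator_L2:
  assumes "A \<in> sets unit_measure" "B \<in> sets unit_measure" "B \<subseteq> A"
  shows "(dist (abs_L2 (indicator B)) (abs_L2 (indicator A)))\<^sup>2
     = measure unit_measure A - measure unit_measure B"
proof -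
  have "(dist (abs_L2 (indicator B)) (abs_L2 (indicator A)))\<^sup>2
      = (\<integral>x. (indicator B x - indicator A x)\<^sup>2 \<partial>unit_measure)"
    using assms by (simp add: dist_norm diff_abs_L2 square_integrable_indicator norm_abs_L2
        square_integrable_diff)
  also have "\<dots> = (\<integral>x. indicator (A - B) x \<partial>unit_measure)"
    using assms(3) by (intro Bochner_Integration.integral_cong) (auto simp: indicator_def)
  also have "\<dots> = measure unit_measure (A - B)"
  proof -
    have "(A - B) \<inter> {0<..<1} = A - B"
      using sets.sets_into_space[OF assms(1)] by auto
    then show ?thesis by simp
  qed
  finally show ?thesis
    using assms unit_measure.finite_measure_Diff[of A B] by simp
qed

lemma abs_L2_indicator_empty: "abs_L2 (indicator {}) = 0"
proof -
  have "(indicator {} :: real \<Rightarrow> real) = (\<lambda>x. 0)" by (simp add: fun_eq_iff)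
  then show ?thesis by (simp only: zero_L2_def)
qed

lemma closure_rational_step_indicator:
  assumes "A \<in> sets unit_measure"
  shows "abs_L2 (indicator A) \<in> closure (range rational_step)"
proof -
  define G where "G = range (\<lambda>a. {0<..<1} \<inter> {..real_of_rat a})"
  have G: "sets unit_measure = sigma_sets {0<..<1} G"
    unfolding G_def by (rule sets_unit_measure_sigma)
  have zero: "0 \<in> closure (range rational_step)"
  proof -
    have "rational_step [] = 0" by (simp add: rational_step_def)
    then show ?thesis using rational_step_in_closure[of "[]"] by (simp only:)
  qed
  have one: "abs_L2 (indicator {0<..<1}) \<in> closure (range rational_step)"
  proof -
    have "{0<..<1} \<inter> {..of_rat 1} = {0<..<1::real}" by auto
    then show ?thesis using closure_rational_step_interval[of 1] by (simp only:)
  qed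
  have "Int_stable G"
    proof (rule Int_stableI)
      fix a b assume "a \<in> G" "b \<in> G"
      then obtain p q where "a = {0<..<1} \<inter> {..real_of_rat p}" "b = {0<..<1} \<inter> {..real_of_rat q}"
        by (auto simp: G_def)
      moreover have "real_of_rat (min p q) = min (real_of_rat p) (real_of_rat q)"
        by (simp add: min_def of_rat_less_eq)
      ultimately have "a \<inter> b = {0<..<1} \<inter> {..real_of_rat (min p q)}"
        by auto
      then show "a \<inter> b \<in> G" by (auto simp: G_def)
    qed
  moreover have "G \<subseteq> Pow {0<..<1}" by (auto simp: G_def)
  moreover have "A \<in> sigma_sets {0<..<1} G" using assms G by simp
  ultimately show ?thesis
  proof (induction rule: sigma_sets_induct_disjoint)
    case (basic A)
    then show ?case using closure_rational_step_interval by (auto simp: G_def)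
  next
    case empty
    have "abs_L2 (indicator {}) = 0" by (rule abs_L2_indicator_empty)
    with zero show ?case by (simp only:)
  next
    case (compl A)
    then have A: "A \<in> sets unit_measure" by (simp add: G)
    have "abs_L2 (indicator ({0<..<1} - A)) + abs_L2 (indicator A) = abs_L2 (indicator {0<..<1})"
    proof -
      have "A \<subseteq> {0<..<1}" using sets.sets_into_space[OF A] by simp
      then have "(\<lambda>x. indicator ({0<..<1} - A) x + indicator A x) = (indicator {0<..<1} :: real \<Rightarrow> real)"
        by (auto simp: indicator_def fun_eq_iff)
      moreover have "{0<..<1} - A \<in> sets unit_measure"
        using sets.compl_sets[OF A] by simp
      ultimately show ?thesis
        using A by (simp add: add_abs_L2 square_integrable_indicator)
    qed
    then have "abs_L2 (indicator ({0<..<1} - A))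
        = abs_L2 (indicator {0<..<1}) + (-1) *\<^sub>R abs_L2 (indicator A)"
      by (simp add: eq_diff_eq)
    also have "\<dots> \<in> closure (range rational_step)"
      by (intro closure_rational_step_add closure_rational_step_scale one compl)
    finally show ?case .
  next
    case (union A)
    have A: "A i \<in> sets unit_measure" for i
      using union.hyps(2) by (auto simp: G image_subset_iff)
    define B where "B n = (\<Union>i<n. A i)" for n
    have B [simp]: "B n \<in> sets unit_measure" "(\<Union>i. A i) \<in> sets unit_measure" for n
      using A by (auto simp: B_def)
    have "abs_L2 (indicator (B n)) \<in> closure (range rational_step)" for n
    proof (induction n)
      case 0
      have "B 0 = {}" by (simp add: B_def)
      with zero show ?case by (simp only: abs_L2_indicator_empty)
    next
      case (Suc n)
      have "B n \<inter> A n = {}"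
      proof -
        have "A i \<inter> A n = {}" if "i < n" for i
          using union.hyps(1) that unfolding disjoint_family_on_def by (metis UNIV_I less_irrefl)
        then show ?thesis unfolding B_def by blast
      qed
      then have "(\<lambda>x. indicator (B n) x + indicator (A n) x) = (indicator (B (Suc n)) :: real \<Rightarrow> real)"
        by (auto simp: indicator_def fun_eq_iff B_def lessThan_Suc)
      then have "abs_L2 (indicator (B (Suc n))) = abs_L2 (indicator (B n)) + abs_L2 (indicator (A n))"
        by (simp add: add_abs_L2 square_integrable_indicator A)
      then show ?case
        using Suc union.IH[of n] by (simp add: closure_rational_step_add)
    qed
    moreover have "(\<lambda>n. abs_L2 (indicator (B n))) \<longlonglongrightarrow> abs_L2 (indicator (\<Union>i. A i))"
    proof -
      have "incseq B" by (rule incseq_SucI) (auto simp: B_def lessThan_Suc)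
      then have "(\<lambda>n. measure unit_measure (B n)) \<longlonglongrightarrow> measure unit_measure (\<Union>n. B n)"
        by (intro unit_measure.finite_Lim_measure_incseq) auto
      moreover have "(\<Union>n. B n) = (\<Union>i. A i)" by (auto simp: B_def)
      ultimately have "(\<lambda>n. measure unit_measure (\<Union>i. A i) - measure unit_measure (B n))
          \<longlonglongrightarrow> measure unit_measure (\<Union>i. A i) - measure unit_measure (\<Union>i. A i)"
        by (intro tendsto_intros) simp
      then have "(\<lambda>n. (dist (abs_L2 (indicator (B n))) (abs_L2 (indicator (\<Union>i. A i))))\<^sup>2) \<longlonglongrightarrow> 0"
        by (subst dist_indicator_L2) (auto simp: B_def A)
      from tendsto_real_sqrt[OF this] show ?thesis
        by (subst tendsto_dist_iff) simp
    qed
    ultimately show ?case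
      by (rule closed_sequentially[OF closed_closure])
  qed
qed

lemma closure_rational_step: "closure (range rational_step) = UNIV"
proof -
  have "u \<in> closure (range rational_step)" for u
  proof -
    obtain f where f: "square_integrable f" "u = abs_L2 f" by (rule L2_cases)
    then have [measurable]: "f \<in> borel_measurable unit_measure"
      by (simp add: square_integrable_def)
    have "\<exists>s. (\<forall>i. simple_function unit_measure (s i)) \<and>
        (\<forall>x\<in>{0<..<1}. (\<lambda>i. s i x) \<longlonglongrightarrow> f x) \<and> (\<forall>i. \<forall>x\<in>{0<..<1}. \<bar>s i x\<bar> \<le> 2 * \<bar>f x\<bar>)"
      using borel_measurable_implies_sequence_metric[of f unit_measure 0] by simp
    then obtain s where s: "\<And>i. simple_function unit_measure (s i)"
      "\<And>x. x \<in> {0<..<1} \<Longrightarrow> (\<lambda>i. s i x) \<longlonglongrightarrow> f x"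
      "\<And>i x. x \<in> {0<..<1} \<Longrightarrow> \<bar>s i x\<bar> \<le> 2 * \<bar>f x\<bar>"
      by blast
    have [measurable]: "s i \<in> borel_measurable unit_measure" for i
      using s(1) by (rule borel_measurable_simple_function)
    have sq_s: "square_integrable (s i)" for i
      unfolding square_integrable_def
    proof
      show "integrable unit_measure (\<lambda>x. (s i x)\<^sup>2)"
      proof (rule Bochner_Integration.integrable_bound)
        show "integrable unit_measure (\<lambda>x. 4 * (f x)\<^sup>2)"
          using f by (simp add: square_integrable_def)
        have "(s i x)\<^sup>2 \<le> 4 * (f x)\<^sup>2" if "x \<in> {0<..<1}" for x
          using power_mono[OF s(3)[OF that, of i], of 2] by (simp add: power_mult_distrib)
        then show "AE x in unit_measure. norm ((s i x)\<^sup>2) \<le> norm (4 * (f x)\<^sup>2)"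
          by (intro AE_I2) auto
      qed measurable
    qed measurable
    have in_cl: "abs_L2 (s i) \<in> closure (range rational_step)" for i
    proof -
      define R where "R = s i ` {0<..<1}"
      have fin: "finite R" using s(1)[of i] by (simp add: R_def simple_function_def)
      define P where "P y = s i -` {y} \<inter> {0<..<1}" for y
      have P: "P y \<in> sets unit_measure" for y
        unfolding P_def using measurable_sets[of "s i" unit_measure borel "{y}"] by simp
      have step: "square_integrable (\<lambda>x. \<Sum>y\<in>S. y * indicator (P y) x) \<and>
          abs_L2 (\<lambda>x. \<Sum>y\<in>S. y * indicator (P y) x) \<in> closure (range rational_step)"
        if "finite S" for S
        using that
      proof induction
        case empty
        have "abs_L2 (\<lambda>x. 0) = rational_step []" by (simp add: rational_step_def zero_L2_def)
        then have "abs_L2 (\<lambda>x. 0) \<in> closure (range rational_step)"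
          by (simp only: rational_step_in_closure)
        then show ?case by (simp add: square_integrable_def)
      next
        case (insert y S)
        have sq: "square_integrable (\<lambda>x. y * indicator (P y) x)"
          by (intro square_integrable_scale square_integrable_indicator P)
        have "abs_L2 (\<lambda>x. y * indicator (P y) x) \<in> closure (range rational_step)"
          using closure_rational_step_scale[OF closure_rational_step_indicator[OF P], of y]
          by (simp add: scaleR_abs_L2 square_integrable_indicator P)
        then have "abs_L2 (\<lambda>x. y * indicator (P y) x) + abs_L2 (\<lambda>x. \<Sum>y\<in>S. y * indicator (P y) x)
            \<in> closure (range rational_step)"
          using insert.IH by (intro closure_rational_step_add) blast+
        then have "abs_L2 (\<lambda>x. y * indicator (P y) x + (\<Sum>y\<in>S. y * indicator (P y) x))
            \<in> closure (range rational_step)"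
          using sq insert.IH by (simp only: add_abs_L2)
        moreover have "square_integrable (\<lambda>x. y * indicator (P y) x + (\<Sum>y\<in>S. y * indicator (P y) x))"
          using sq insert.IH by (intro square_integrable_add) blast+
        ultimately show ?case
          by (simp only: sum.insert[OF insert.hyps] simp_thms)
      qed
      have "abs_L2 (s i) = abs_L2 (\<lambda>x. \<Sum>y\<in>R. y * indicator (P y) x)"
      proof -
        have "s i x = (\<Sum>y\<in>R. y * indicator (P y) x)" if "x \<in> {0<..<1}" for x
        proof -
          have "(\<Sum>y\<in>R. y * indicator (P y) x) = (\<Sum>y\<in>R. if y = s i x then y else 0)"
            using that by (intro sum.cong) (auto simp: P_def indicator_def)
          then show ?thesis using fin that by (simp add: R_def)
        qed
        then have "AE x in unit_measure. s i x = (\<Sum>y\<in>R. y * indicator (P y) x)"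
          by (intro AE_I2) simp
        then show ?thesis
          using conjunct1[OF step[OF fin]] sq_s[of i] by (intro Quotient_rel_abs[OF Quotient_L2] conjI)
      qed
      then show ?thesis using conjunct2[OF step[OF fin]] by (simp only:)
    qed
    have "(\<lambda>i. \<integral>x. (s i x - f x)\<^sup>2 \<partial>unit_measure) \<longlonglongrightarrow> (\<integral>x. 0 \<partial>unit_measure)"
    proof (rule integral_dominated_convergence)
      show "integrable unit_measure (\<lambda>x. 9 * (f x)\<^sup>2)"
        using f by (simp add: square_integrable_def)
      show "AE x in unit_measure. (\<lambda>i. (s i x - f x)\<^sup>2) \<longlonglongrightarrow> 0"
      proof (rule AE_I2)
        fix x assume "x \<in> space unit_measure"
        then have "(\<lambda>i. (s i x - f x)\<^sup>2) \<longlonglongrightarrow> (f x - f x)\<^sup>2"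
          by (intro tendsto_intros s) simp
        then show "(\<lambda>i. (s i x - f x)\<^sup>2) \<longlonglongrightarrow> 0" by simp
      qed
      show "AE x in unit_measure. norm ((s i x - f x)\<^sup>2) \<le> 9 * (f x)\<^sup>2" for i
      proof (rule AE_I2)
        fix x assume "x \<in> space unit_measure"
        then have "\<bar>s i x - f x\<bar> \<le> 3 * \<bar>f x\<bar>"
          using s(3)[of x i] by simp
        from power_mono[OF this, of 2] show "norm ((s i x - f x)\<^sup>2) \<le> 9 * (f x)\<^sup>2"
          by (simp add: power_mult_distrib)
      qed
    qed measurable
    then have "(\<lambda>i. (dist (abs_L2 (s i)) u)\<^sup>2) \<longlonglongrightarrow> 0"
      by (simp add: dist_norm f(2) diff_abs_L2 norm_abs_L2 sq_s f(1) square_integrable_diff)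
    from tendsto_real_sqrt[OF this] have "(\<lambda>i. abs_L2 (s i)) \<longlonglongrightarrow> u"
      by (subst tendsto_dist_iff) simp
    with in_cl show ?thesis
      by (rule closed_sequentially[OF closed_closure])
  qed
  then show ?thesis by auto
qed

instance L2 :: second_countable_topology
proof
  define \<B> where "\<B> = (\<lambda>(xs, n). ball (rational_step xs) (1 / Suc n)) ` UNIV"
  have "topological_basis \<B>"
  proof (rule topological_basisI)
    show "open B" if "B \<in> \<B>" for B using that by (auto simp: \<B>_def)
    fix U :: "L2 set" and u assume "open U" "u \<in> U"
    then obtain e where e: "e > 0" "ball u e \<subseteq> U" by (meson openE)
    obtain n :: nat where n: "1 / Suc n < e / 2"
      using e(1) nat_approx_posE[of "e/2"] by auto
    have "u \<in> closure (range rational_step)" by (simp add: closure_rational_step)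
    then obtain xs where xs: "dist (rational_step xs) u < 1 / Suc n"
    proof -
      have "0 < 1 / real (Suc n)" by simp
      then have "\<exists>w\<in>range rational_step. dist w u < 1 / Suc n"
        using \<open>u \<in> closure (range rational_step)\<close> unfolding closure_approachable by blast
      then show ?thesis using that by auto
    qed
    have "u \<in> ball (rational_step xs) (1 / Suc n)" using xs by simp
    moreover have "ball (rational_step xs) (1 / Suc n) \<subseteq> U"
    proof
      fix v assume "v \<in> ball (rational_step xs) (1 / Suc n)"
      then have "dist u v < e"
        using xs n dist_triangle[of u v "rational_step xs"] by (simp add: dist_commute)
      then show "v \<in> U" using e(2) by auto
    qed
    moreover have "ball (rational_step xs) (1 / Suc n) \<in> \<B>" by (auto simp: \<B>_def)
    ultimately show "\<exists>B\<in>\<B>. u \<in> B \<and> B \<subseteq> U" by blast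
  qed
  moreover have "countable \<B>"
    unfolding \<B>_def by (intro countable_image) simp
  ultimately show "\<exists>B :: L2 set set. countable B \<and> open = generate_topology B"
    by (blast intro: topological_basis_imp_subbasis)
qed


section \<open>Sobolev spaces on the unit interval and the Dirichlet Laplacian\<close>

definition smooth_fun :: "(real \<Rightarrow> real) \<Rightarrow> bool" where
  "smooth_fun f \<longleftrightarrow> (\<forall>n x. (deriv ^^ n) f differentiable (at x))"

definition test_fun :: "(real \<Rightarrow> real) \<Rightarrow> bool" where
  "test_fun f \<longleftrightarrow> smooth_fun f \<and> (\<exists>a b. 0 < a \<and> b < 1 \<and> (\<forall>\<xi>. \<xi> \<notin> {a..b} \<longrightarrow> f \<xi> = 0))"

text \<open>\<open>sobolev_limit m C w\<close>: some sequence in \<open>C\<close> converges to \<open>w 0\<close> in the norm of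
  \<open>H\<^sup>m((0,1))\<close>, and \<open>w j\<close> is the \<open>j\<close>-th Sobolev derivative of the limit. The spaces below are
  closures in these norms, of the restrictions of smooth functions on the line, respectively of the
  smooth functions with compact support in \<open>(0,1)\<close>.\<close>

definition sobolev_limit :: "nat \<Rightarrow> ((real \<Rightarrow> real) \<Rightarrow> bool) \<Rightarrow> (nat \<Rightarrow> L2) \<Rightarrow> bool" where
  "sobolev_limit m C w \<longleftrightarrow>
     (\<exists>g. (\<forall>k. C (g k)) \<and> (\<forall>j\<le>m. (\<lambda>k. abs_L2 ((deriv ^^ j) (g k))) \<longlonglongrightarrow> w j))"

definition H2 :: "L2 set" where
  "H2 = {u. \<exists>w. sobolev_limit 2 smooth_fun w \<and> w 0 = u}"

definition H10 :: "L2 set" where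
  "H10 = {u. \<exists>w. sobolev_limit 1 test_fun w \<and> w 0 = u}"

definition laplacian_dom :: "L2 set" where
  "laplacian_dom = H10 \<inter> H2"

definition laplacian :: "L2 \<Rightarrow> L2" where
  "laplacian u = (THE v. \<exists>w. sobolev_limit 2 smooth_fun w \<and> w 0 = u \<and> w 2 = v)"

definition laplacian_inverse :: "L2 \<Rightarrow> L2" where \<comment> \<open>\<open>(-A)\<^sup>-\<^sup>1\<close>\<close>
  "laplacian_inverse = the_inv_into laplacian_dom (\<lambda>u. - laplacian u)"

definition sin_basis :: "nat \<Rightarrow> L2" where \<comment> \<open>\<open>e\<^sub>i\<close>, used for \<open>i \<ge> 1\<close>\<close>
  "sin_basis i = abs_L2 (\<lambda>\<xi>. sqrt 2 * sin (real i * pi * \<xi>))"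

definition eigval :: "nat \<Rightarrow> real" where
  "eigval i = pi\<^sup>2 * (real i)\<^sup>2"

text \<open>Functional calculus \<open>f(-A)\<close> of the operator \<open>-A\<close>, which is diagonal in the sine basis. The
  series starts at \<open>e\<^sub>1\<close>. \<open>spectral_apply f u\<close> is meaningful only for \<open>u\<close> in the domain of \<open>f(-A)\<close>.\<close>

definition spectral_apply :: "(real \<Rightarrow> real) \<Rightarrow> L2 \<Rightarrow> L2" where
  "spectral_apply f u =
     (\<Sum>i. (f (eigval (Suc i)) * inner u (sin_basis (Suc i))) *\<^sub>R sin_basis (Suc i))"

definition spectral_dom :: "(real \<Rightarrow> real) \<Rightarrow> L2 set" where
  "spectral_dom f = {u. summable (\<lambda>i. (f (eigval (Suc i)) * inner u (sin_basis (Suc i)))\<^sup>2)}"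

definition neg_laplacian_powr :: "real \<Rightarrow> L2 \<Rightarrow> L2" where
  "neg_laplacian_powr s = spectral_apply (\<lambda>l. l powr s)"

definition Hdot :: "real \<Rightarrow> L2 set" where
  "Hdot \<gamma> = spectral_dom (\<lambda>l. l powr (\<gamma> / 2))"

definition norm_Hdot :: "real \<Rightarrow> L2 \<Rightarrow> real" where
  "norm_Hdot \<gamma> u = norm (neg_laplacian_powr (\<gamma> / 2) u)"

definition heat_semigroup :: "real \<Rightarrow> L2 \<Rightarrow> L2" where
  "heat_semigroup t = spectral_apply (\<lambda>l. exp (- (t * l)))"


section \<open>Operators on the Hilbert space\<close>

definition self_adjoint :: "(L2 \<Rightarrow> L2) \<Rightarrow> bool" where
  "self_adjoint B \<longleftrightarrow> (\<forall>u v. inner (B u) v = inner u (B v))"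

definition op_sqrt :: "(L2 \<Rightarrow> L2) \<Rightarrow> L2 \<Rightarrow> L2" where
  "op_sqrt B = (THE R. bounded_linear R \<and> self_adjoint R \<and> (\<forall>u. 0 \<le> inner (R u) u) \<and>
     (\<forall>u. R (R u) = B u))"

text \<open>The inverse of an injective square root; its domain is \<open>range (op_sqrt B)\<close>.\<close>

definition op_inv_sqrt :: "(L2 \<Rightarrow> L2) \<Rightarrow> L2 \<Rightarrow> L2" where
  "op_inv_sqrt B = the_inv_into UNIV (op_sqrt B)"

definition hilbert_schmidt :: "(L2 \<Rightarrow> L2) \<Rightarrow> bool" where
  "hilbert_schmidt B \<longleftrightarrow>
     bounded_linear B \<and> summable (\<lambda>i. (norm (B (sin_basis (Suc i))))\<^sup>2)"


section \<open>Paths and the anisotropic Sobolev space\<close>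

text \<open>Paths are functions on the real line of which only the values on \<open>[0,T]\<close> matter.
  Membership in \<open>L\<^sup>2(0,T;H)\<close>:\<close>

definition L2_path :: "real \<Rightarrow> (real \<Rightarrow> L2) \<Rightarrow> bool" where
  "L2_path T \<phi> \<longleftrightarrow> set_borel_measurable lborel {0..T} \<phi> \<and>
     set_integrable lborel {0..T} (\<lambda>t. (norm (\<phi> t))\<^sup>2)"

definition partial_t :: "(real \<Rightarrow> real \<Rightarrow> real) \<Rightarrow> real \<Rightarrow> real \<Rightarrow> real" where
  "partial_t f t \<xi> = deriv (\<lambda>s. f s \<xi>) t"

definition partial_xi :: "(real \<Rightarrow> real \<Rightarrow> real) \<Rightarrow> real \<Rightarrow> real \<Rightarrow> real" where
  "partial_xi f t \<xi> = deriv (f t) \<xi>"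

text \<open>All iterated partial derivatives are differentiable functions on the plane.
  \<open>C\<^sup>\<infinity>([0,T]\<times>[0,1])\<close> is the set of restrictions of such functions.\<close>

definition smooth_fun2 :: "(real \<Rightarrow> real \<Rightarrow> real) \<Rightarrow> bool" where
  "smooth_fun2 f \<longleftrightarrow> (\<forall>ds. set ds \<subseteq> {partial_t, partial_xi} \<longrightarrow>
     (\<lambda>(t, \<xi>). foldr (\<lambda>d g. d g) ds f t \<xi>) differentiable_on UNIV)"

text \<open>\<open>W12_limit T z v w1 w2\<close>: \<open>z\<close>, with weak derivatives \<open>v\<close> in time and \<open>w1\<close>, \<open>w2\<close> (first and
  second) in space, is the limit of smooth functions in the norm of \<open>W\<^sub>2\<^sup>1\<^sup>,\<^sup>2(T)\<close>. Functions of
  \<open>(t,\<xi>)\<close> are identified with paths in \<open>L2\<close>; since \<open>W\<^sub>2\<^sup>1\<^sup>,\<^sup>2(T)\<close> embeds into \<open>C([0,T];H)\<close>,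
  the continuous representative \<open>z\<close> is taken.\<close>

definition W12_limit ::
  "real \<Rightarrow> (real \<Rightarrow> L2) \<Rightarrow> (real \<Rightarrow> L2) \<Rightarrow> (real \<Rightarrow> L2) \<Rightarrow> (real \<Rightarrow> L2) \<Rightarrow> bool" where
  "W12_limit T z v w1 w2 \<longleftrightarrow>
     continuous_on {0..T} z \<and> L2_path T v \<and> L2_path T w1 \<and> L2_path T w2 \<and>
     (\<exists>f. (\<forall>k. smooth_fun2 (f k)) \<and>
       (\<lambda>k. LINT t:{0..T}|lborel.
          (norm (abs_L2 (f k t) - z t))\<^sup>2
        + (norm (abs_L2 (partial_t (f k) t) - v t))\<^sup>2
        + (norm (abs_L2 (partial_xi (f k) t) - w1 t))\<^sup>2
        + (norm (abs_L2 (partial_xi (partial_xi (f k)) t) - w2 t))\<^sup>2) \<longlonglongrightarrow> 0)"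

definition W12_Q :: "real \<Rightarrow> (L2 \<Rightarrow> L2) \<Rightarrow> (L2 \<Rightarrow> L2) \<Rightarrow> (real \<Rightarrow> L2) set" where
  "W12_Q T F Q = {z. \<exists>v w1 w2. W12_limit T z v w1 w2 \<and>
     (AE t\<in>{0..T} in lborel. z t \<in> laplacian_dom \<and>
        v t - laplacian (z t) - F (z t) \<in> range (op_sqrt Q)) \<and>
     set_integrable lborel {0..T}
       (\<lambda>t. (norm (op_inv_sqrt Q (v t - laplacian (z t) - F (z t))))\<^sup>2)}"


section \<open>Skeleton equation and rate function\<close>

definition mild_solution ::
  "real \<Rightarrow> (L2 \<Rightarrow> L2) \<Rightarrow> (L2 \<Rightarrow> L2) \<Rightarrow> L2 \<Rightarrow> (real \<Rightarrow> L2) \<Rightarrow> (real \<Rightarrow> L2) \<Rightarrow> bool" where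
  "mild_solution T F Q x \<phi> z \<longleftrightarrow> continuous_on {0..T} z \<and>
     (\<forall>t\<in>{0..T}. z t = heat_semigroup t x +
        (LINT s:{0..t}|lborel. heat_semigroup (t - s) (F (z s) + op_sqrt Q (\<phi> s))))"

definition rate :: "real \<Rightarrow> (L2 \<Rightarrow> L2) \<Rightarrow> (L2 \<Rightarrow> L2) \<Rightarrow> L2 \<Rightarrow> (real \<Rightarrow> L2) \<Rightarrow> ereal" where
  "rate T F Q x z = ereal (1/2) *
     (INF \<phi>\<in>{\<phi>. L2_path T \<phi> \<and> mild_solution T F Q x \<phi> z}.
        ereal (LINT t:{0..T}|lborel. (norm (\<phi> t))\<^sup>2))"


section \<open>Spectral Galerkin method\<close>

definition galerkin_space :: "nat \<Rightarrow> L2 set" where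
  "galerkin_space n = span (sin_basis ` {1..n})"

definition galerkin_proj :: "nat \<Rightarrow> L2 \<Rightarrow> L2" where
  "galerkin_proj n u = (\<Sum>i=1..n. inner u (sin_basis i) *\<^sub>R sin_basis i)"

definition galerkin_laplacian :: "nat \<Rightarrow> L2 \<Rightarrow> L2" where
  "galerkin_laplacian n u = galerkin_proj n (laplacian u)"

definition op_exp :: "(L2 \<Rightarrow> L2) \<Rightarrow> real \<Rightarrow> L2 \<Rightarrow> L2" where \<comment> \<open>\<open>exp(tB) u\<close>\<close>
  "op_exp B t u = (\<Sum>k. (t ^ k / fact k) *\<^sub>R (B ^^ k) u)"

definition galerkin_mild_solution ::
  "real \<Rightarrow> (L2 \<Rightarrow> L2) \<Rightarrow> (L2 \<Rightarrow> L2) \<Rightarrow> nat \<Rightarrow> L2 \<Rightarrow> (real \<Rightarrow> L2) \<Rightarrow> (real \<Rightarrow> L2) \<Rightarrow> bool" where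
  "galerkin_mild_solution T F Q n y \<psi> z \<longleftrightarrow>
     continuous_on {0..T} z \<and> (\<forall>t\<in>{0..T}. z t \<in> galerkin_space n) \<and>
     (\<forall>t\<in>{0..T}. z t = op_exp (galerkin_laplacian n) t y +
        (LINT s:{0..t}|lborel. op_exp (galerkin_laplacian n) (t - s)
           (galerkin_proj n (F (z s)) + galerkin_proj n (op_sqrt Q (\<psi> s)))))"

definition galerkin_L2_path :: "nat \<Rightarrow> real \<Rightarrow> (real \<Rightarrow> L2) \<Rightarrow> bool" where
  "galerkin_L2_path n T \<psi> \<longleftrightarrow> L2_path T \<psi> \<and> (\<forall>t\<in>{0..T}. \<psi> t \<in> galerkin_space n)"

definition galerkin_rate ::
  "real \<Rightarrow> (L2 \<Rightarrow> L2) \<Rightarrow> (L2 \<Rightarrow> L2) \<Rightarrow> nat \<Rightarrow> L2 \<Rightarrow> (real \<Rightarrow> L2) \<Rightarrow> ereal" where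
  "galerkin_rate T F Q n y z = ereal (1/2) *
     (INF \<psi>\<in>{\<psi>. galerkin_L2_path n T \<psi> \<and> galerkin_mild_solution T F Q n y \<psi> z}.
        ereal (LINT t:{0..T}|lborel. (norm (\<psi> t))\<^sup>2))"

definition galerkin_rate_dom :: "nat \<Rightarrow> L2 \<Rightarrow> real \<Rightarrow> (real \<Rightarrow> L2) set" where
  "galerkin_rate_dom n y T = {z. continuous_on {0..T} z \<and> (\<forall>t\<in>{0..T}. z t \<in> galerkin_space n) \<and>
     (\<exists>\<upsilon>. galerkin_L2_path n T \<upsilon> \<and>
       (\<forall>t\<in>{0..T}. z t = y + (LINT s:{0..t}|lborel. \<upsilon> s)))}"

end

(*
  Let phi be the control driving z in the skeleton equation, and let z_n solve the Galerkin skeleton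
  equation with the projected control P_n phi. Since Q is diagonal in the sine basis, subtracting
  P_n of the mild formulation of z leaves a fixed point problem
    z_n(t) = P_n z(t) + int_0^t exp((t-s) A_n) P_n (F(z_n(s)) - F(z(s))) ds,
  which is a contraction in an exponentially weighted norm. It gives existence of z_n and
  |z - z_n| <= 2 exp(2 L_F T) sup_t |z(t) - P_n z(t)|, which tends to 0 by compactness of z([0,T]).
  Controls are determined almost everywhere by the solutions they drive, so both infima are attained
  only at these controls: the rates are |phi|^2 / 2 and |P_n phi|^2 / 2, and their difference tends
  to 0 by dominated convergence.
*)
theory Submission
  imports Defs
begin


text \<open>Keeping the control and letting the path move is what makes the costs converge. The more
  direct candidate \<open>P_n z\<close> is driven by \<open>P_n \<phi>\<close> plus the inverse of
  \<open>Q_n^{1/2}\<close> applied to \<open>P_n (F(z) - F(P_n z))\<close>, and that inverse has no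
  bound uniform in n. With the control fixed, the error sits in the nonlinearity instead, where the
  Lipschitz bound absorbs it: the weight exp(2 L_F t) gives contraction factor 1/2, and the
  geometric series with this ratio gives the leading 2 in the estimate. The second difficulty is
  that phi exists. It has to be \<open>Q^{-1/2}(dz/dt - A z - F(z))\<close>, but
  \<open>laplacian\<close> and \<open>op_sqrt\<close> are definite descriptions, dz/dt is only a
  limit along smooth approximants, and the skeleton equation is in mild form. All of this is settled
  on sine coefficients: completeness of the basis reduces equalities and measurability in H to
  scalar ones, the time derivative becomes a scalar primitive, and Duhamel's formula becomes a
  product rule with an integrating factor.\<close>

section \<open>Integrable functions with vanishing initial integrals\<close>

text \<open>Extended by zero, the positive and negative parts of \<open>h\<close> are densities of
  two finite measures with equal mass on every half-line. The measures therefore coincide, so the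
  two parts agree almost everywhere; as at most one of them is nonzero at any point, both vanish.
  This serves completeness of the sine basis as well as uniqueness of controls.\<close>

lemma AE_zero_if_initial_integrals_zero:
  fixes h :: "real \<Rightarrow> real"
  assumes h: "set_integrable lborel {a..b} h"
    and zero: "\<And>t. t \<in> {a..b} \<Longrightarrow> (LINT s:{a..t}|lborel. h s) = 0"
  shows "AE s in lborel. s \<in> {a..b} \<longrightarrow> h s = 0"
proof -
  define g where "g s = indicator {a..b} s * h s" for s
  have g: "integrable lborel g"
    using h by (simp add: set_integrable_def g_def[abs_def])
  have [measurable]: "g \<in> borel_measurable lborel"
    using g by simp
  have atMost: "(\<integral>s. indicator {..x} s * g s \<partial>lborel) = 0" for x
  proof -
    consider "x < a \<or> b < a" | "a \<le> x" "x \<le> b" | "b \<le> x" "a \<le> b" by linarith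
    then show ?thesis
    proof cases
      case 1
      then have "(\<lambda>s. indicator {..x} s * g s) = (\<lambda>_. 0)"
        by (auto simp: g_def indicator_def)
      then show ?thesis by simp
    next
      case 2
      then have "(\<lambda>s. indicator {..x} s * g s) = (\<lambda>s. indicator {a..x} s *\<^sub>R h s)"
        by (auto simp: g_def indicator_def)
      with zero[of x] 2 show ?thesis by (simp add: set_lebesgue_integral_def)
    next
      case 3
      then have "(\<lambda>s. indicator {..x} s * g s) = (\<lambda>s. indicator {a..b} s *\<^sub>R h s)"
        by (auto simp: g_def indicator_def)
      with zero[of b] 3 show ?thesis by (simp add: set_lebesgue_integral_def)
    qed
  qed
  have total: "(\<integral>s. g s \<partial>lborel) = 0"
  proof -
    have "(\<lambda>s. indicator {..b} s * g s) = g"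
      by (auto simp: g_def indicator_def)
    with atMost[of b] show ?thesis by simp
  qed
  \<comment> \<open>The uniqueness theorem for measures applied below compares open upper
    half-lines, hence the passage to complements.\<close>
  have greater: "(\<integral>s. indicator {x<..} s * g s \<partial>lborel) = 0" for x
  proof -
    have "(\<integral>s. indicator {x<..} s * g s \<partial>lborel) = (\<integral>s. g s - indicator {..x} s * g s \<partial>lborel)"
      by (intro Bochner_Integration.integral_cong) (auto simp: indicator_def)
    also have "\<dots> = 0"
      using integrable_real_mult_indicator[of "{..x}" lborel g] g atMost[of x]
      by (subst Bochner_Integration.integral_diff) (auto simp: total mult.commute[of _ "indicator _ _"])
    finally show ?thesis .
  qed
  have pos: "integrable lborel (\<lambda>s. max 0 (g s))" and neg: "integrable lborel (\<lambda>s. max 0 (- g s))"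
    using g by auto
  have em: "emeasure (density lborel (\<lambda>s. ennreal (f s))) {x<..}
      = ennreal (\<integral>s. indicator {x<..} s * f s \<partial>lborel)"
    if f: "integrable lborel f" "\<And>s. 0 \<le> f s" for f :: "real \<Rightarrow> real" and x
  proof -
    have [measurable]: "f \<in> borel_measurable lborel" using f by simp
    have "emeasure (density lborel (\<lambda>s. ennreal (f s))) {x<..}
        = (\<integral>\<^sup>+s. ennreal (indicator {x<..} s * f s) \<partial>lborel)"
      by (simp add: emeasure_density mult.commute ennreal_mult'' ennreal_indicator)
    also have "\<dots> = ennreal (\<integral>s. indicator {x<..} s * f s \<partial>lborel)"
      using f integrable_real_mult_indicator[of "{x<..}" lborel f]
      by (intro nn_integral_eq_integral) (auto simp: mult.commute)
    finally show ?thesis .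
  qed
  have "density lborel (\<lambda>s. ennreal (max 0 (g s))) = density lborel (\<lambda>s. ennreal (max 0 (- g s)))"
  proof (rule measure_eqI_lessThan)
    fix x
    have "(\<integral>s. indicator {x<..} s * max 0 (g s) \<partial>lborel)
        - (\<integral>s. indicator {x<..} s * max 0 (- g s) \<partial>lborel)
        = (\<integral>s. indicator {x<..} s * max 0 (g s) - indicator {x<..} s * max 0 (- g s) \<partial>lborel)"
      using integrable_real_mult_indicator[OF _ pos, of "{x<..}"]
        integrable_real_mult_indicator[OF _ neg, of "{x<..}"]
      by (subst Bochner_Integration.integral_diff) (auto simp: mult.commute[of _ "indicator _ _"])
    also have "\<dots> = (\<integral>s. indicator {x<..} s * g s \<partial>lborel)"
      by (intro Bochner_Integration.integral_cong) (auto simp: indicator_def)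
    finally have "(\<integral>s. indicator {x<..} s * max 0 (g s) \<partial>lborel)
        = (\<integral>s. indicator {x<..} s * max 0 (- g s) \<partial>lborel)"
      using greater[of x] by simp
    then show "emeasure (density lborel (\<lambda>s. ennreal (max 0 (g s)))) {x<..}
      = emeasure (density lborel (\<lambda>s. ennreal (max 0 (- g s)))) {x<..}"
      using pos neg by (simp add: em)
    show "emeasure (density lborel (\<lambda>s. ennreal (max 0 (g s)))) {x<..} < \<infinity>"
      using pos by (simp add: em)
  qed simp_all
  then have "AE s in lborel. ennreal (max 0 (g s)) = ennreal (max 0 (- g s))"
    by (intro sigma_finite_measure.density_unique[OF lborel.sigma_finite_measure_axioms]) auto
  then show ?thesis
    by (rule eventually_mono) (auto simp: g_def indicator_def max_def split: if_splits)
qed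

section \<open>The sine basis\<close>

text \<open>Transfers integrals over the open interval of \<open>unit_measure\<close> to gauge
  integrals over [0,1], where the fundamental theorem of calculus is available. The two endpoints
  form a null set.\<close>

lemma unit_integral_eq:
  assumes "continuous_on {0..1} f" "(f has_integral I) {0..1::real}"
  shows "integrable unit_measure f" "(\<integral>x. f x \<partial>unit_measure) = (I::real)"
proof -
  have f: "set_integrable lborel {0..1} f"
    by (rule borel_integrable_atLeastAtMost'[OF assms(1)])
  have f': "set_integrable lborel {0<..<1} f"
    by (rule set_integrable_subset[OF f]) auto
  then show "integrable unit_measure f"
    unfolding unit_measure_def set_integrable_def
    by (subst integrable_restrict_space) (auto simp: mult.commute)
  have "(\<integral>x. f x \<partial>unit_measure) = (LINT x:{0<..<1}|lborel. f x)"
    unfolding unit_measure_def set_lebesgue_integral_def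
    by (subst integral_restrict_space) auto
  also have "\<dots> = (LINT x:{0..1}|lborel. f x)"
  proof (rule set_integral_cong_set)
    show "set_borel_measurable lborel {0<..<1} f" "set_borel_measurable lborel {0..1} f"
      using f f' by (auto simp: set_integrable_def set_borel_measurable_def)
    have "AE x in lborel. x \<notin> {0, 1::real}"
      by (rule AE_not_in) (auto intro: countable_imp_null_set_lborel)
    then show "AE x in lborel. (x \<in> {0..1}) = (x \<in> {0<..<1::real})"
      by (rule eventually_mono) auto
  qed
  also have "\<dots> = I"
    using set_borel_integral_eq_integral[OF f] assms(2) by (simp add: integral_unique)
  finally show "(\<integral>x. f x \<partial>unit_measure) = I" .
qed

lemma square_integrable_continuous:
  assumes "continuous_on {0..1} f"
  shows "square_integrable f"
  unfolding square_integrable_def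
proof
  show "f \<in> borel_measurable unit_measure"
    unfolding unit_measure_def
    using borel_measurable_continuous_on_indicator[OF _ continuous_on_subset[OF assms], of "{0<..<1}"]
    by (simp add: borel_measurable_restrict_space_iff greaterThanLessThan_subseteq_atLeastAtMost_iff)
  have "continuous_on {0..1} (\<lambda>x. (f x)\<^sup>2)"
    using assms by (intro continuous_intros)
  then show "integrable unit_measure (\<lambda>x. (f x)\<^sup>2)"
    using unit_integral_eq(1) integrable_integral[OF integrable_continuous_real] by blast
qed

lemma inner_abs_L2_continuous:
  assumes "continuous_on {0..1} f" "continuous_on {0..1} g"
  shows "inner (abs_L2 f) (abs_L2 g) = integral {0..1} (\<lambda>x. f x * g x)"
proof -
  have "continuous_on {0..1} (\<lambda>x. f x * g x)"
    using assms by (intro continuous_intros)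
  then show ?thesis
    using assms unit_integral_eq(2)[OF _ integrable_integral[OF integrable_continuous_real]]
    by (simp add: inner_abs_L2 square_integrable_continuous)
qed

lemma integral_cos_multiple:
  fixes k :: int
  assumes "k \<noteq> 0"
  shows "((\<lambda>x. cos (k * pi * x)) has_integral 0) {0..1}"
proof -
  have "((\<lambda>x. cos (k * pi * x)) has_integral (sin (k * pi * 1) / (k * pi) - sin (k * pi * 0) / (k * pi))) {0..1}"
    using assms
    by (intro fundamental_theorem_of_calculus)
      (auto intro!: derivative_eq_intros simp flip: has_real_derivative_iff_has_vector_derivative)
  moreover have "sin (k * pi) = 0"
    by (simp add: sin_zero_iff_int2)
  ultimately show ?thesis by simp
qed

lemma inner_sin_basis:
  assumes "i \<ge> 1" "j \<ge> 1"
  shows "inner (sin_basis i) (sin_basis j) = (if i = j then 1 else 0)"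
proof -
  \<comment> \<open>The difference of the indices is taken in the integers because natural
    subtraction would truncate. For \<open>i = j\<close> the first cosine is the constant 1, while
    \<open>i + j\<close> is never 0.\<close>
  have eq: "(sqrt 2 * sin (i * pi * x)) * (sqrt 2 * sin (j * pi * x))
      = cos (of_int (int i - int j) * pi * x) - cos (of_int (int i + int j) * pi * x)" for x
  proof -
    have "(sqrt 2 * sin (i * pi * x)) * (sqrt 2 * sin (j * pi * x))
        = 2 * (sin (i * pi * x) * sin (j * pi * x))"
      by (simp add: algebra_simps)
    also have "\<dots> = cos (i * pi * x - j * pi * x) - cos (i * pi * x + j * pi * x)"
      by (simp add: sin_times_sin)
    finally show ?thesis by (simp add: algebra_simps)
  qed
  have "((\<lambda>x. cos (of_int (int i - int j) * pi * x)) has_integral (if i = j then 1 else 0)) {0..1}"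
    using integral_cos_multiple[of "int i - int j"] has_integral_const_real[of 1 0 1]
    by (cases "i = j") auto
  moreover have "((\<lambda>x. cos (of_int (int i + int j) * pi * x)) has_integral 0) {0..1}"
    using assms by (intro integral_cos_multiple) auto
  ultimately have "((\<lambda>x. (sqrt 2 * sin (i * pi * x)) * (sqrt 2 * sin (j * pi * x)))
      has_integral (if i = j then 1 else 0)) {0..1}"
    unfolding eq using has_integral_diff by (metis diff_zero)
  then show ?thesis
    unfolding sin_basis_def by (subst inner_abs_L2_continuous) (auto intro!: continuous_intros integral_unique)
qed

text \<open>If \<open>u\<close> is orthogonal to all \<open>e\<^sub>i\<close>, then \<open>u(\<xi>) sin(\<pi>\<xi>)\<close> is orthogonal to every polynomial in
  \<open>cos(\<pi>\<xi>)\<close>, hence by the Weierstrass theorem to every continuous function of \<open>\<xi>\<close>.\<close>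

lemma L2_eq_0_if_orthogonal_sin:
  assumes orth: "\<And>i. i \<ge> 1 \<Longrightarrow> inner u (sin_basis i) = 0"
  shows "u = 0"
proof -
  obtain f where f: "square_integrable f" and u: "u = abs_L2 f" by (rule L2_cases)
  have fm [measurable]: "f \<in> borel_measurable unit_measure"
    using f by (simp add: square_integrable_def)
  have one: "square_integrable (\<lambda>x. 1)" by (rule square_integrable_bounded[of _ 1]) auto
  have fint: "integrable unit_measure f"
    using square_integrable_mult[OF f one] by simp
  have bounded_int: "integrable unit_measure (\<lambda>x. f x * g x)"
    if "g \<in> borel_measurable unit_measure" "\<And>x. x \<in> {0<..<1} \<Longrightarrow> \<bar>g x\<bar> \<le> B" for g B
  proof (rule Bochner_Integration.integrable_bound)
    show "integrable unit_measure (\<lambda>x. B * f x)" using fint by simp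
    show "AE x in unit_measure. norm (f x * g x) \<le> norm (B * f x)"
    proof (rule AE_I2)
      fix x assume "x \<in> space unit_measure"
      then have "\<bar>g x\<bar> \<le> B" using that(2) by simp
      then have "\<bar>f x\<bar> * \<bar>g x\<bar> \<le> \<bar>f x\<bar> * \<bar>B\<bar>"
        by (intro mult_left_mono) auto
      then show "norm (f x * g x) \<le> norm (B * f x)" by (simp add: abs_mult mult.commute)
    qed
  qed (use that in measurable)
  have cm [measurable]: "(\<lambda>x. G x) \<in> borel_measurable unit_measure"
    if "continuous_on UNIV G" for G :: "real \<Rightarrow> real"
    using borel_measurable_continuous_onI[OF that] unfolding unit_measure_def
    by (intro measurable_restrict_space1) simp
  \<comment> \<open>The value \<open>j = 0\<close> is included because the recursion in
    \<open>pow0\<close> lowers \<open>j\<close> by one and may reach it.\<close>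
  have sin0: "(\<integral>x. f x * sin (j * pi * x) \<partial>unit_measure) = 0" for j :: nat
  proof (cases "j = 0")
    case False
    have sq: "square_integrable (\<lambda>x. sqrt 2 * sin (real j * pi * x))"
      by (rule square_integrable_continuous) (intro continuous_intros)
    have "inner u (sin_basis j) = sqrt 2 * (\<integral>x. f x * sin (j * pi * x) \<partial>unit_measure)"
      unfolding u sin_basis_def inner_abs_L2[OF f sq]
      by (subst Bochner_Integration.integral_mult_right_zero[symmetric])
        (intro Bochner_Integration.integral_cong refl, simp)
    moreover have "inner u (sin_basis j) = 0" using orth[of j] False by simp
    ultimately show ?thesis by simp
  qed simp
  \<comment> \<open>Each factor cos(pi x) is absorbed by the product formula for sin and cos, which
    replaces the frequency j by j + 1 and j - 1; hence the induction over all \<open>j\<close> at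
    once.\<close>
  have pow0: "(\<integral>x. f x * (sin (j * pi * x) * cos (pi * x) ^ k) \<partial>unit_measure) = 0" for j k :: nat
  proof (induction k arbitrary: j)
    case 0
    then show ?case by (simp add: sin0)
  next
    case (Suc k)
    show ?case
    proof (cases "j = 0")
      case False
      then have j: "real (j - 1) = real j - 1" by (simp add: of_nat_diff)
      have eq: "sin (j * pi * x) * cos (pi * x) ^ Suc k
        = (sin (Suc j * pi * x) * cos (pi * x) ^ k + sin ((j - 1) * pi * x) * cos (pi * x) ^ k) / 2" for x
      proof -
        have "sin (j * pi * x) * cos (pi * x) = (sin (j * pi * x + pi * x) + sin (j * pi * x - pi * x)) / 2"
          by (rule sin_times_cos)
        moreover have "j * pi * x + pi * x = Suc j * pi * x" "j * pi * x - pi * x = (j - 1) * pi * x"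
          unfolding j by (simp_all add: algebra_simps)
        ultimately have "sin (j * pi * x) * cos (pi * x)
            = (sin (Suc j * pi * x) + sin ((j - 1) * pi * x)) / 2" by metis
        then show ?thesis by (simp add: distrib_right[symmetric] mult.assoc[symmetric])
      qed
      have int: "integrable unit_measure (\<lambda>x. f x * (sin (j * pi * x) * cos (pi * x) ^ k))" for j :: nat
      proof (rule bounded_int[where B=1])
        show "\<bar>sin (j * pi * x) * cos (pi * x) ^ k\<bar> \<le> 1" for x
          by (simp add: abs_mult power_abs mult_le_one power_le_one)
      qed (intro cm continuous_intros)
      have "(\<integral>x. f x * (sin (j * pi * x) * cos (pi * x) ^ Suc k) \<partial>unit_measure)
        = (\<integral>x. f x * (sin (Suc j * pi * x) * cos (pi * x) ^ k) / 2
              + f x * (sin ((j - 1) * pi * x) * cos (pi * x) ^ k) / 2 \<partial>unit_measure)"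
        unfolding eq by (intro Bochner_Integration.integral_cong) (auto simp: algebra_simps)
      also have "\<dots> = 0"
        using int[of "Suc j"] int[of "j - 1"] Suc[of "Suc j"] Suc[of "j - 1"]
        by (subst Bochner_Integration.integral_add) auto
      finally show ?thesis .
    qed simp
  qed
  \<comment> \<open>The weight sin(pi x) is the case \<open>j = 1\<close> of \<open>pow0\<close>. It
    is positive on (0,1) and is divided out at the end.\<close>
  define h where "h x = f x * sin (pi * x)" for x
  have hint: "integrable unit_measure h"
    unfolding h_def by (rule bounded_int[where B=1]) (auto intro!: cm continuous_intros)
  have hg0: "(\<integral>x. h x * g x \<partial>unit_measure) = 0" if g: "continuous_on UNIV g" for g :: "real \<Rightarrow> real"
  proof -
    have gbd: "\<exists>B. \<forall>x\<in>{0..1}. \<bar>g x\<bar> \<le> B"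
      using compact_imp_bounded[OF compact_continuous_image[OF continuous_on_subset[OF g] compact_Icc[of 0 1]]]
      by (auto simp: bounded_iff)
    have gint: "integrable unit_measure (\<lambda>x. h x * g x)"
    proof -
      obtain B where "\<forall>x\<in>{0..1}. \<bar>g x\<bar> \<le> B" using gbd by blast
      then have "integrable unit_measure (\<lambda>x. f x * (sin (pi * x) * g x))"
        by (intro bounded_int[where B="1 * B"])
          (auto intro!: cm continuous_on_mult continuous_on_sin continuous_on_id continuous_on_const g mult_mono
            simp only: abs_mult abs_ge_zero abs_sin_le_one atLeastAtMost_iff greaterThanLessThan_iff less_imp_le simp_thms)
      then show ?thesis by (simp add: h_def mult.assoc)
    qed
    \<comment> \<open>Substituting y = cos(pi x) turns \<open>g\<close> into a continuous function
      on [-1,1]. Its polynomial approximations in y become polynomials in cos(pi x), to which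
      \<open>h\<close> is orthogonal.\<close>
    have "continuous_on {-1..1} (\<lambda>y. g (arccos y / pi))"
      by (rule continuous_on_compose2[OF g]) (auto intro!: continuous_on_divide continuous_on_const continuous_on_arccos')
    have small: "\<bar>\<integral>x. h x * g x \<partial>unit_measure\<bar> \<le> e * (\<integral>x. \<bar>h x\<bar> \<partial>unit_measure)" if "e > 0" for e
    proof -
      obtain p where p: "real_polynomial_function p"
        "\<And>y. y \<in> {-1..1} \<Longrightarrow> \<bar>g (arccos y / pi) - p y\<bar> < e"
        using Stone_Weierstrass_real_polynomial_function[OF compact_Icc \<open>continuous_on {-1..1} _\<close> \<open>e > 0\<close>]
        by blast
      obtain a n where an: "p = (\<lambda>x. \<Sum>i\<le>n. a i * x^i)"
        using p(1) by (auto simp: real_polynomial_function_iff_sum)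
      have close: "\<bar>g x - p (cos (pi * x))\<bar> \<le> e" if "x \<in> {0<..<1}" for x
      proof -
        have "arccos (cos (pi * x)) = pi * x" using that by (intro arccos_cos) auto
        then show ?thesis using p(2)[of "cos (pi * x)"] by simp
      qed
      have p_int: "integrable unit_measure (\<lambda>x. f x * (sin (real 1 * pi * x) * cos (pi * x) ^ k))" for k
        by (rule bounded_int[where B=1])
          (auto intro!: cm continuous_intros simp: abs_mult power_abs mult_le_one power_le_one)
      have hp: "h x * p (cos (pi * x)) = (\<Sum>i\<le>n. a i * (f x * (sin (real 1 * pi * x) * cos (pi * x) ^ i)))" for x
        by (simp add: h_def an sum_distrib_left algebra_simps)
      have hp_int: "integrable unit_measure (\<lambda>x. h x * p (cos (pi * x)))"
        unfolding hp using p_int by (intro Bochner_Integration.integrable_sum integrable_mult_right) auto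
      have hp0: "(\<integral>x. h x * p (cos (pi * x)) \<partial>unit_measure) = 0"
        unfolding hp using p_int pow0[of 1] by (subst Bochner_Integration.integral_sum) auto
      have "(\<integral>x. h x * g x \<partial>unit_measure) = (\<integral>x. h x * g x - h x * p (cos (pi * x)) \<partial>unit_measure)"
        using gint hp_int hp0 by (subst Bochner_Integration.integral_diff) auto
      also have "\<bar>\<dots>\<bar> \<le> (\<integral>x. \<bar>h x * g x - h x * p (cos (pi * x))\<bar> \<partial>unit_measure)"
        using integral_norm_bound[of unit_measure "\<lambda>x. h x * g x - h x * p (cos (pi * x))"] by simp
      also have "\<dots> \<le> (\<integral>x. e * \<bar>h x\<bar> \<partial>unit_measure)"
      proof (rule integral_mono)
        fix x assume "x \<in> space unit_measure"
        then have "\<bar>h x\<bar> * \<bar>g x - p (cos (pi * x))\<bar> \<le> \<bar>h x\<bar> * e"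
          by (intro mult_left_mono close) auto
        then show "\<bar>h x * g x - h x * p (cos (pi * x))\<bar> \<le> e * \<bar>h x\<bar>"
          by (simp only: abs_mult right_diff_distrib[symmetric] mult.commute[of e])
      qed (use gint hp_int hint in auto)
      finally show ?thesis by simp
    qed
    show ?thesis
    proof (rule ccontr)
      define I where "I = (\<integral>x. \<bar>h x\<bar> \<partial>unit_measure)"
      define J where "J = \<bar>\<integral>x. h x * g x \<partial>unit_measure\<bar>"
      assume "(\<integral>x. h x * g x \<partial>unit_measure) \<noteq> 0"
      then have J: "J > 0" by (simp add: J_def)
      have I: "I \<ge> 0" by (simp add: I_def)
      \<comment> \<open>The tolerance J / (2 (I + 1)) makes the bound smaller than J; the summand 1
        covers \<open>I = 0\<close>.\<close>
      have "J \<le> J / (2 * (I + 1)) * I"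
        using J I small[of "J / (2 * (I + 1))"] unfolding I_def[symmetric] J_def[symmetric] by auto
      also have "\<dots> < J"
        using J I by (simp add: field_simps add_strict_increasing2)
      finally show False by simp
    qed
  qed
  have h0: "(LINT s:{0..t}|lborel. indicator {0<..<1} s * h s) = 0" for t
  proof -
    \<comment> \<open>Continuous cutoffs equal to 1 up to \<open>t\<close> and to 0 beyond
      \<open>t + 1/m\<close>. They converge pointwise to the indicator of the half-line, which
      carries orthogonality over to initial integrals.\<close>
    define g where "g m x = max 0 (min 1 (1 - real m * (x - t)))" for m x
    have lim: "(\<lambda>m. g m x) \<longlonglongrightarrow> indicator {..t} x" for x
    proof (cases "x \<le> t")
      case True
      then have "real m * (x - t) \<le> 0" for m by (simp add: mult_nonneg_nonpos)
      then have "g m x = 1" for m by (simp add: g_def min_def)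
      then show ?thesis using True by simp
    next
      case False
      obtain m0 :: nat where m0: "1 / (x - t) < m0" using reals_Archimedean2 by blast
      have "g m x = 0" if "m \<ge> m0" for m
      proof -
        have "1 / (x - t) < m" using m0 that by linarith
        then have "1 < m * (x - t)" using False by (simp add: field_simps)
        then show ?thesis by (simp add: g_def)
      qed
      then have "\<forall>\<^sub>F m in sequentially. g m x = 0" by (auto simp: eventually_sequentially)
      then show ?thesis using False by (simp add: tendsto_eventually)
    qed
    have gm [measurable]: "g m \<in> borel_measurable unit_measure" for m
      unfolding g_def[abs_def] by (intro cm continuous_intros)
    have [measurable]: "h \<in> borel_measurable unit_measure" using hint by simp
    have [measurable]: "indicator {..t} \<in> borel_measurable unit_measure"
      unfolding unit_measure_def by (intro measurable_restrict_space1) simp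
    have "(\<lambda>m. \<integral>x. h x * g m x \<partial>unit_measure) \<longlonglongrightarrow> (\<integral>x. h x * indicator {..t} x \<partial>unit_measure)"
    proof (rule integral_dominated_convergence[where w="\<lambda>x. \<bar>h x\<bar>"])
      show "AE x in unit_measure. (\<lambda>m. h x * g m x) \<longlonglongrightarrow> h x * indicator {..t} x"
        by (intro AE_I2 tendsto_intros lim)
      show "AE x in unit_measure. norm (h x * g m x) \<le> \<bar>h x\<bar>" for m
        by (intro AE_I2) (auto simp: abs_mult g_def intro!: mult_left_le)
    qed (use hint in auto)
    moreover have "(\<integral>x. h x * g m x \<partial>unit_measure) = 0" for m
      by (rule hg0) (auto simp: g_def[abs_def] intro!: continuous_intros)
    ultimately have "(\<integral>x. h x * indicator {..t} x \<partial>unit_measure) = 0"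
      by (simp add: LIMSEQ_const_iff)
    then have "(\<integral>x. indicator {0<..<1} x *\<^sub>R (h x * indicator {..t} x) \<partial>lborel) = 0"
      unfolding unit_measure_def by (subst (asm) integral_restrict_space) auto
    also have "(\<lambda>x. indicator {0<..<1} x *\<^sub>R (h x * indicator {..t} x))
      = (\<lambda>x. indicator {0..t} x *\<^sub>R (indicator {0<..<1} x * h x))"
      by (auto simp: indicator_def)
    finally show ?thesis by (simp add: set_lebesgue_integral_def)
  qed
  have "AE s in lborel. s \<in> {0..1} \<longrightarrow> indicat_real {0<..<1} s * h s = 0"
  proof (rule AE_zero_if_initial_integrals_zero)
    have "integrable lborel (\<lambda>x. indicator {0<..<1} x *\<^sub>R h x)"
      using hint unfolding unit_measure_def by (subst (asm) integrable_restrict_space) auto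
    also have "(\<lambda>x. indicator {0<..<1} x *\<^sub>R h x)
      = (\<lambda>x. indicator {0..1} x *\<^sub>R (indicator {0<..<1} x * h x))"
      by (auto simp: indicator_def)
    finally show "set_integrable lborel {0..1} (\<lambda>s. indicat_real {0<..<1} s * h s)"
      by (simp only: set_integrable_def)
  qed (rule h0)
  then have "AE s in lborel. s \<in> {0<..<1} \<longrightarrow> f s = 0"
  proof (rule eventually_mono, intro impI)
    fix s :: real assume *: "s \<in> {0..1} \<longrightarrow> indicator {0<..<1} s * h s = 0" "s \<in> {0<..<1}"
    have "sin (pi * s) > 0" using *(2) by (intro sin_gt_zero) auto
    then show "f s = 0" using * by (auto simp: h_def)
  qed
  then have "AE x in unit_measure. f x = 0"
    unfolding unit_measure_def by (subst AE_restrict_space_iff) auto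
  then have "abs_L2 f = abs_L2 (\<lambda>x. 0)"
    using f by (intro Quotient_rel_abs[OF Quotient_L2]) (simp add: square_integrable_def)
  then show ?thesis by (simp add: u zero_L2_def)
qed


lemma L2_eqI:
  assumes "\<And>i. i \<ge> 1 \<Longrightarrow> inner u (sin_basis i) = inner v (sin_basis i)"
  shows "u = v"
  using L2_eq_0_if_orthogonal_sin[of "u - v"] assms by (simp add: inner_diff_left)

lemma norm_sin_basis: "i \<ge> 1 \<Longrightarrow> norm (sin_basis i) = 1"
  by (simp add: norm_eq_sqrt_inner inner_sin_basis)

lemma inner_sum_sin_basis:
  assumes "finite S" "S \<subseteq> {1..}" "i \<ge> 1"
  shows "inner (\<Sum>j\<in>S. a j *\<^sub>R sin_basis j) (sin_basis i) = (if i \<in> S then a i else 0)"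
proof -
  have "inner (\<Sum>j\<in>S. a j *\<^sub>R sin_basis j) (sin_basis i) = (\<Sum>j\<in>S. if j = i then a j else 0)"
    using assms unfolding inner_sum_left
    by (intro sum.cong refl) (auto simp: inner_sin_basis subset_eq)
  then show ?thesis using assms by simp
qed

lemma norm_sum_sin_basis:
  assumes "finite S" "S \<subseteq> {1..}"
  shows "(norm (\<Sum>j\<in>S. a j *\<^sub>R sin_basis j))\<^sup>2 = (\<Sum>j\<in>S. (a j)\<^sup>2)"
proof -
  let ?v = "\<Sum>j\<in>S. a j *\<^sub>R sin_basis j"
  have "inner ?v ?v = (\<Sum>j\<in>S. a j * inner ?v (sin_basis j))"
    by (subst inner_sum_right) simp
  also have "\<dots> = (\<Sum>j\<in>S. (a j)\<^sup>2)"
    using assms by (intro sum.cong refl, subst inner_sum_sin_basis) (auto simp: power2_eq_square)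
  finally show ?thesis by (simp add: power2_norm_eq_inner)
qed

lemma inner_galerkin_proj:
  "i \<ge> 1 \<Longrightarrow> inner (galerkin_proj n u) (sin_basis i) = (if i \<le> n then inner u (sin_basis i) else 0)"
  unfolding galerkin_proj_def by (subst inner_sum_sin_basis) auto

lemma norm_galerkin_proj_le: "norm (galerkin_proj n u) \<le> norm u"
proof -
  let ?P = "galerkin_proj n u"
  have "inner ?P ?P = inner u ?P"
  proof -
    have "inner v ?P = (\<Sum>i=1..n. inner u (sin_basis i) * inner v (sin_basis i))" for v
      by (simp add: galerkin_proj_def inner_sum_right)
    then show ?thesis by (auto simp: inner_galerkin_proj intro!: sum.cong)
  qed
  then have "(norm ?P)\<^sup>2 \<le> norm u * norm ?P"
    by (simp add: power2_norm_eq_inner norm_cauchy_schwarz)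
  then have "norm ?P * norm ?P \<le> norm u * norm ?P"
    by (simp add: power2_eq_square)
  then show ?thesis
    by (cases "norm ?P = 0") (auto simp: mult_le_cancel_right)
qed

lemma galerkin_proj_lessThan:
  "galerkin_proj n u = (\<Sum>i<n. inner u (sin_basis (Suc i)) *\<^sub>R sin_basis (Suc i))"
  unfolding galerkin_proj_def by (rule sum.reindex_bij_witness[of _ Suc "\<lambda>i. i - 1"]) auto

lemma norm_galerkin_proj: "(norm (galerkin_proj n u))\<^sup>2 = (\<Sum>i<n. (inner u (sin_basis (Suc i)))\<^sup>2)"
proof -
  have "(norm (galerkin_proj n u))\<^sup>2 = (\<Sum>i=1..n. (inner u (sin_basis i))\<^sup>2)"
    unfolding galerkin_proj_def by (rule norm_sum_sin_basis) auto
  also have "\<dots> = (\<Sum>i<n. (inner u (sin_basis (Suc i)))\<^sup>2)"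
    by (rule sum.reindex_bij_witness[of _ Suc "\<lambda>i. i - 1"]) auto
  finally show ?thesis .
qed

lemma summable_sin_coeffs: "summable (\<lambda>i. (inner u (sin_basis (Suc i)))\<^sup>2)"
proof (rule summableI_nonneg_bounded)
  show "(\<Sum>i<n. (inner u (sin_basis (Suc i)))\<^sup>2) \<le> (norm u)\<^sup>2" for n
    unfolding norm_galerkin_proj[symmetric] by (intro power_mono norm_galerkin_proj_le) simp
qed simp

text \<open>By Pythagoras the squared norm of a block of the series is the matching block of the
  series of squares, so the Cauchy criterion carries over. Blocks are shifted by one because the
  basis starts at index 1.\<close>

lemma summable_sin_series:
  assumes "summable (\<lambda>i. (a i)\<^sup>2)"
  shows "summable (\<lambda>i. a i *\<^sub>R sin_basis (Suc i))"
  unfolding summable_Cauchy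
proof (intro allI impI)
  fix e :: real assume "0 < e"
  then obtain N where N: "\<And>m n. m \<ge> N \<Longrightarrow> norm (\<Sum>i\<in>{m..<n}. (a i)\<^sup>2) < e\<^sup>2"
    using assms unfolding summable_Cauchy by (meson zero_less_power)
  show "\<exists>N. \<forall>m\<ge>N. \<forall>n. norm (\<Sum>i\<in>{m..<n}. a i *\<^sub>R sin_basis (Suc i)) < e"
  proof (intro exI[of _ N] allI impI)
    fix m n assume "m \<ge> N"
    have "(\<Sum>i\<in>{m..<n}. a i *\<^sub>R sin_basis (Suc i)) = (\<Sum>i\<in>{Suc m..<Suc n}. a (i - 1) *\<^sub>R sin_basis i)"
      by (subst sum.shift_bounds_Suc_ivl) simp
    then have "(norm (\<Sum>i\<in>{m..<n}. a i *\<^sub>R sin_basis (Suc i)))\<^sup>2 = (\<Sum>i\<in>{Suc m..<Suc n}. (a (i - 1))\<^sup>2)"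
      by (simp only:, subst norm_sum_sin_basis) auto
    also have "\<dots> = (\<Sum>i\<in>{m..<n}. (a i)\<^sup>2)"
      by (subst sum.shift_bounds_Suc_ivl) simp
    also have "\<dots> < e\<^sup>2"
      using N[OF \<open>m \<ge> N\<close>, of n] by simp
    finally show "norm (\<Sum>i\<in>{m..<n}. a i *\<^sub>R sin_basis (Suc i)) < e"
      using \<open>0 < e\<close> by (rule power2_less_imp_less[OF _ less_imp_le])
  qed
qed

lemma inner_sin_series:
  assumes "summable (\<lambda>i. (a i)\<^sup>2)" "j \<ge> 1"
  shows "inner (\<Sum>i. a i *\<^sub>R sin_basis (Suc i)) (sin_basis j) = a (j - 1)"
proof -
  have "inner (\<Sum>i. a i *\<^sub>R sin_basis (Suc i)) (sin_basis j)
      = (\<Sum>i. inner (a i *\<^sub>R sin_basis (Suc i)) (sin_basis j))"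
    by (rule bounded_linear.suminf[OF bounded_linear_inner_left summable_sin_series[OF assms(1)]])
  also have "\<dots> = (\<Sum>i\<in>{j - 1}. inner (a i *\<^sub>R sin_basis (Suc i)) (sin_basis j))"
    using assms(2) by (intro suminf_finite) (auto simp: inner_sin_basis)
  finally show ?thesis using assms(2) by (simp add: inner_sin_basis)
qed

text \<open>Bessel's inequality makes the Fourier series converge, and its sum has the same
  coefficients as \<open>u\<close>; completeness of the basis then identifies the two.\<close>

lemma sums_sin_basis: "(\<lambda>i. inner u (sin_basis (Suc i)) *\<^sub>R sin_basis (Suc i)) sums u"
proof -
  have "(\<Sum>i. inner u (sin_basis (Suc i)) *\<^sub>R sin_basis (Suc i)) = u"
    by (rule L2_eqI) (simp add: inner_sin_series[OF summable_sin_coeffs])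
  then show ?thesis
    using summable_sums[OF summable_sin_series[OF summable_sin_coeffs[of u]]] by simp
qed

lemma galerkin_proj_tendsto: "(\<lambda>n. galerkin_proj n u) \<longlonglongrightarrow> u"
  using sums_sin_basis[of u] by (simp add: sums_def galerkin_proj_lessThan)

lemma norm_L2_sums: "(\<lambda>i. (inner u (sin_basis (Suc i)))\<^sup>2) sums (norm u)\<^sup>2"
  unfolding sums_def norm_galerkin_proj[symmetric]
  by (intro tendsto_intros galerkin_proj_tendsto)

lemma norm_le_if_sin_coeffs_le:
  assumes "\<And>i. i \<ge> 1 \<Longrightarrow> \<bar>inner u (sin_basis i)\<bar> \<le> C * \<bar>inner v (sin_basis i)\<bar>" "C \<ge> 0"
  shows "norm u \<le> C * norm v"
proof -
  have "(norm u)\<^sup>2 \<le> C\<^sup>2 * (norm v)\<^sup>2"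
  proof (rule sums_le)
    show "(inner u (sin_basis (Suc i)))\<^sup>2 \<le> C\<^sup>2 * (inner v (sin_basis (Suc i)))\<^sup>2" for i
      using power_mono[OF assms(1)[of "Suc i"], of 2] by (simp add: power_mult_distrib)
    show "(\<lambda>i. C\<^sup>2 * (inner v (sin_basis (Suc i)))\<^sup>2) sums (C\<^sup>2 * (norm v)\<^sup>2)"
      by (intro sums_mult norm_L2_sums)
  qed (rule norm_L2_sums)
  then show ?thesis
    using assms(2) power2_le_imp_le[of "norm u" "C * norm v"] by (simp add: power_mult_distrib)
qed

lemma bounded_linear_galerkin_proj: "bounded_linear (galerkin_proj n)"
proof (rule bounded_linear_intro[where K=1])
  show "galerkin_proj n (u + v) = galerkin_proj n u + galerkin_proj n v" for u v
    by (rule L2_eqI) (simp add: inner_galerkin_proj inner_add_left)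
  show "galerkin_proj n (c *\<^sub>R u) = c *\<^sub>R galerkin_proj n u" for c u
    by (rule L2_eqI) (simp add: inner_galerkin_proj)
qed (simp add: norm_galerkin_proj_le)

lemma galerkin_proj_diff: "galerkin_proj n (u - v) = galerkin_proj n u - galerkin_proj n v"
  by (rule linear_diff[OF bounded_linear.linear[OF bounded_linear_galerkin_proj]])

lemma galerkin_proj_in_space: "galerkin_proj n u \<in> galerkin_space n"
  unfolding galerkin_proj_def galerkin_space_def
  by (intro span_sum span_scale span_base) auto

lemma galerkin_space_iff: "u \<in> galerkin_space n \<longleftrightarrow> galerkin_proj n u = u"
proof
  assume "u \<in> galerkin_space n"
  then show "galerkin_proj n u = u"
    unfolding galerkin_space_def
  proof (induction rule: span_induct_alt)
    case base
    show ?case by (simp add: galerkin_proj_def)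
  next
    case (step c x y)
    then obtain j where j: "j \<in> {1..n}" "x = sin_basis j" by auto
    then have "galerkin_proj n x = x"
      by (intro L2_eqI) (simp add: inner_galerkin_proj inner_sin_basis)
    then show ?case
      using step.IH linear_add[OF bounded_linear.linear[OF bounded_linear_galerkin_proj]]
        linear_scale[OF bounded_linear.linear[OF bounded_linear_galerkin_proj]] by simp
  qed
qed (metis galerkin_proj_in_space)

lemma galerkin_spaceI:
  assumes "\<And>i. i > n \<Longrightarrow> inner u (sin_basis i) = 0"
  shows "u \<in> galerkin_space n"
  unfolding galerkin_space_iff using assms by (intro L2_eqI) (auto simp: inner_galerkin_proj)

lemma inner_galerkin_space:
  "u \<in> galerkin_space n \<Longrightarrow> i > n \<Longrightarrow> inner u (sin_basis i) = 0"
  by (metis galerkin_space_iff inner_galerkin_proj leD le_less_trans less_one not_le zero_le)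

text \<open>Finite Fourier sums have measurable coefficients and converge pointwise. This gives
  measurability of paths such as \<open>heat_semigroup (t - s) (h s)\<close>, where the operator
  varies with the point, and of controls obtained by inverting an operator.\<close>

lemma borel_measurable_L2I:
  assumes "\<And>i. i \<ge> 1 \<Longrightarrow> (\<lambda>x. inner (f x) (sin_basis i)) \<in> borel_measurable M"
  shows "f \<in> borel_measurable M"
proof (rule borel_measurable_LIMSEQ_metric)
  show "(\<lambda>x. galerkin_proj n (f x)) \<in> borel_measurable M" for n
    unfolding galerkin_proj_def using assms by (intro borel_measurable_sum borel_measurable_scaleR) auto
qed (rule galerkin_proj_tendsto)

section \<open>Diagonal operators\<close>

text \<open>A common form for the heat semigroup at nonnegative times, the square root of
  \<open>Q\<close> and the Laplacian truncated at \<open>n\<close>. Only bounded symbols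
  \<open>c\<close> are used, which ensures convergence; \<open>c 0\<close> is never read.\<close>

definition diagonal_op :: "(nat \<Rightarrow> real) \<Rightarrow> L2 \<Rightarrow> L2" where
  "diagonal_op c u = (\<Sum>i. (c (Suc i) * inner u (sin_basis (Suc i))) *\<^sub>R sin_basis (Suc i))"

lemma inner_diagonal_op:
  assumes "\<And>i. i \<ge> 1 \<Longrightarrow> \<bar>c i\<bar> \<le> C" "j \<ge> 1"
  shows "inner (diagonal_op c u) (sin_basis j) = c j * inner u (sin_basis j)"
proof -
  have "summable (\<lambda>i. (c (Suc i) * inner u (sin_basis (Suc i)))\<^sup>2)"
  proof (rule summable_comparison_test)
    have "(c (Suc i))\<^sup>2 \<le> C\<^sup>2" for i
      using power_mono[OF assms(1)[of "Suc i"], of 2] by simp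
    then show "\<exists>N. \<forall>n\<ge>N. norm ((c (Suc n) * inner u (sin_basis (Suc n)))\<^sup>2)
        \<le> C\<^sup>2 * (inner u (sin_basis (Suc n)))\<^sup>2"
      by (auto simp: power_mult_distrib intro!: mult_right_mono)
  qed (intro summable_mult summable_sin_coeffs)
  from inner_sin_series[OF this assms(2)] show ?thesis
    using assms(2) by (simp add: diagonal_op_def)
qed

lemma norm_diagonal_op_le:
  assumes "\<And>i. i \<ge> 1 \<Longrightarrow> \<bar>c i\<bar> \<le> C"
  shows "norm (diagonal_op c u) \<le> C * norm u"
proof (rule norm_le_if_sin_coeffs_le)
  show "0 \<le> C" using assms[of 1] by simp
  show "\<bar>inner (diagonal_op c u) (sin_basis i)\<bar> \<le> C * \<bar>inner u (sin_basis i)\<bar>" if "i \<ge> 1" for i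
    using assms[OF that] that by (simp add: inner_diagonal_op[OF assms] abs_mult mult_right_mono)
qed

lemma bounded_linear_diagonal_op:
  assumes c: "\<And>i. i \<ge> 1 \<Longrightarrow> \<bar>c i\<bar> \<le> C"
  shows "bounded_linear (diagonal_op c)"
proof (rule bounded_linear_intro[where K=C])
  show "diagonal_op c (u + v) = diagonal_op c u + diagonal_op c v" for u v
    by (rule L2_eqI) (simp add: inner_diagonal_op[OF c] inner_add_left distrib_left)
  show "diagonal_op c (r *\<^sub>R u) = r *\<^sub>R diagonal_op c u" for r u
    by (rule L2_eqI) (simp add: inner_diagonal_op[OF c])
qed (simp add: norm_diagonal_op_le[OF c] mult.commute)

lemma heat_semigroup_diagonal: "heat_semigroup t = diagonal_op (\<lambda>i. exp (- (t * eigval i)))"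
  by (simp add: fun_eq_iff heat_semigroup_def spectral_apply_def diagonal_op_def)

lemma eigval_nonneg: "0 \<le> eigval i"
  by (simp add: eigval_def)

lemma inner_heat_semigroup:
  assumes "t \<ge> 0" "i \<ge> 1"
  shows "inner (heat_semigroup t u) (sin_basis i) = exp (- (t * eigval i)) * inner u (sin_basis i)"
  unfolding heat_semigroup_diagonal
  by (rule inner_diagonal_op[where C=1]) (use assms eigval_nonneg in auto)

lemma norm_heat_semigroup_le:
  assumes "t \<ge> 0"
  shows "norm (heat_semigroup t u) \<le> norm u"
  using norm_diagonal_op_le[of "\<lambda>i. exp (- (t * eigval i))" 1] assms eigval_nonneg
  by (simp add: heat_semigroup_diagonal)

section \<open>The covariance operator and its square root\<close>

lemma bounded_linear_eqI_sin_basis: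
  fixes R S :: "L2 \<Rightarrow> L2"
  assumes "bounded_linear R" "bounded_linear S" "\<And>i. i \<ge> 1 \<Longrightarrow> R (sin_basis i) = S (sin_basis i)"
  shows "R = S"
proof
  fix u
  have *: "(\<lambda>i. inner u (sin_basis (Suc i)) *\<^sub>R B (sin_basis (Suc i))) sums B u"
    if "bounded_linear B" for B :: "L2 \<Rightarrow> L2"
    using bounded_linear.sums[OF that sums_sin_basis[of u]]
    by (simp add: linear_scale[OF bounded_linear.linear[OF that]])
  show "R u = S u"
    using sums_unique2[OF *[OF assms(1)]] *[OF assms(2)] assms(3) by simp
qed

locale diagonal_covariance =
  fixes Q :: "L2 \<Rightarrow> L2" and q :: "nat \<Rightarrow> real"
  assumes bounded_linear_Q: "bounded_linear Q"
    and Q_sin_basis: "\<And>i. i \<ge> 1 \<Longrightarrow> Q (sin_basis i) = q i *\<^sub>R sin_basis i"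
    and q_pos: "\<And>i. i \<ge> 1 \<Longrightarrow> q i > 0"
begin

lemma q_le: "i \<ge> 1 \<Longrightarrow> \<bar>q i\<bar> \<le> onorm Q"
  using onorm[OF bounded_linear_Q, of "sin_basis i"] by (simp add: Q_sin_basis norm_sin_basis)

lemma sqrt_q_le: "i \<ge> 1 \<Longrightarrow> \<bar>sqrt (q i)\<bar> \<le> sqrt (onorm Q)"
  using q_le[of i] q_pos[of i] by simp

lemma Q_diagonal: "Q = diagonal_op q"
proof (rule bounded_linear_eqI_sin_basis[OF bounded_linear_Q])
  show "bounded_linear (diagonal_op q)"
    by (rule bounded_linear_diagonal_op[OF q_le])
  show "Q (sin_basis i) = diagonal_op q (sin_basis i)" if "i \<ge> 1" for i
    by (rule L2_eqI) (use that in \<open>simp add: Q_sin_basis inner_diagonal_op[OF q_le] inner_sin_basis\<close>)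
qed

text \<open>Since \<open>op_sqrt\<close> is a definite description, uniqueness is required as well
  as existence. A competing nonnegative root is not known to be diagonal, so it is compared with the
  diagonal one at each basis vector.\<close>

lemma op_sqrt_diagonal: "op_sqrt Q = diagonal_op (\<lambda>i. sqrt (q i))"
  unfolding op_sqrt_def
proof (rule the_equality)
  let ?R = "diagonal_op (\<lambda>i. sqrt (q i))"
  note in_R = inner_diagonal_op[of "\<lambda>i. sqrt (q i)", OF sqrt_q_le]
  have bl: "bounded_linear ?R"
    by (rule bounded_linear_diagonal_op[OF sqrt_q_le])
  have in_sums: "(\<lambda>i. inner u (sin_basis (Suc i)) * inner v (sin_basis (Suc i))) sums inner u v" for u v
    using bounded_linear.sums[OF bounded_linear_inner_left sums_sin_basis[of u], of v]
    by (simp add: inner_commute)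
  have "self_adjoint ?R"
    unfolding self_adjoint_def
  proof (intro allI)
    fix u v
    show "inner (?R u) v = inner u (?R v)"
      using sums_unique2[OF in_sums[of "?R u" v]] in_sums[of u "?R v"]
      by (simp add: in_R mult.left_commute mult.assoc)
  qed
  moreover have "0 \<le> inner (?R u) u" for u
  proof (rule sums_le[OF _ sums_zero in_sums])
    show "0 \<le> inner (?R u) (sin_basis (Suc i)) * inner u (sin_basis (Suc i))" for i
      using q_pos[of "Suc i"] by (simp add: in_R mult.assoc)
  qed
  moreover have "?R (?R u) = Q u" for u
  proof (rule L2_eqI)
    fix i :: nat assume "i \<ge> 1"
    then show "inner (?R (?R u)) (sin_basis i) = inner (Q u) (sin_basis i)"
      using q_pos[of i] by (simp add: Q_diagonal in_R inner_diagonal_op[OF q_le] mult.assoc[symmetric])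
  qed
  ultimately show "bounded_linear ?R \<and> self_adjoint ?R \<and> (\<forall>u. 0 \<le> inner (?R u) u) \<and> (\<forall>u. ?R (?R u) = Q u)"
    using bl by blast
next
  fix R assume R: "bounded_linear R \<and> self_adjoint R \<and> (\<forall>u. 0 \<le> inner (R u) u) \<and> (\<forall>u. R (R u) = Q u)"
  then have bl: "bounded_linear R" and pos: "\<And>u. 0 \<le> inner (R u) u" and sq: "\<And>u. R (R u) = Q u"
    by auto
  note lin = bounded_linear.linear[OF bl]
  show "R = diagonal_op (\<lambda>i. sqrt (q i))"
  proof (rule bounded_linear_eqI_sin_basis[OF bl])
    show "bounded_linear (diagonal_op (\<lambda>i. sqrt (q i)))"
      by (rule bounded_linear_diagonal_op[OF sqrt_q_le])
    fix i :: nat assume i: "i \<ge> 1"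
    define w where "w = R (sin_basis i) - sqrt (q i) *\<^sub>R sin_basis i"
    \<comment> \<open>\<open>R + \<surd>q\<^sub>i\<close> is injective by positivity and maps \<open>w\<close> to \<open>(Q - q\<^sub>i) e\<^sub>i = 0\<close>.\<close>
    have "R w + sqrt (q i) *\<^sub>R w = 0"
      using q_pos[OF i]
      by (simp add: w_def linear_diff[OF lin] linear_scale[OF lin] sq Q_sin_basis[OF i] scaleR_diff_right)
    then have "inner (R w) w + sqrt (q i) * inner w w = 0"
      by (metis inner_add_left inner_scaleR_left inner_zero_left)
    moreover have "0 \<le> inner (R w) w" "0 \<le> sqrt (q i) * inner w w" "sqrt (q i) > 0"
      using pos q_pos[OF i] by auto
    ultimately have "inner w w = 0"
      by (metis add_nonneg_eq_0_iff less_irrefl mult_eq_0_iff)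
    then have "R (sin_basis i) = sqrt (q i) *\<^sub>R sin_basis i"
      by (simp add: w_def)
    also have "\<dots> = diagonal_op (\<lambda>i. sqrt (q i)) (sin_basis i)"
      using i by (intro L2_eqI) (auto simp: inner_diagonal_op[of "\<lambda>i. sqrt (q i)", OF sqrt_q_le] inner_sin_basis)
    finally show "R (sin_basis i) = diagonal_op (\<lambda>i. sqrt (q i)) (sin_basis i)" .
  qed
qed

lemma inner_op_sqrt:
  "i \<ge> 1 \<Longrightarrow> inner (op_sqrt Q u) (sin_basis i) = sqrt (q i) * inner u (sin_basis i)"
  unfolding op_sqrt_diagonal by (rule inner_diagonal_op[of "\<lambda>i. sqrt (q i)", OF sqrt_q_le])

lemma bounded_linear_op_sqrt: "bounded_linear (op_sqrt Q)"
  unfolding op_sqrt_diagonal by (rule bounded_linear_diagonal_op[OF sqrt_q_le])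

lemma inj_op_sqrt: "inj (op_sqrt Q)"
proof (rule injI)
  fix u v assume *: "op_sqrt Q u = op_sqrt Q v"
  show "u = v"
  proof (rule L2_eqI)
    fix i :: nat assume i: "i \<ge> 1"
    show "inner u (sin_basis i) = inner v (sin_basis i)"
      using inner_op_sqrt[OF i, of u] inner_op_sqrt[OF i, of v] q_pos[OF i] * by simp
  qed
qed

lemma op_sqrt_op_inv_sqrt:
  "u \<in> range (op_sqrt Q) \<Longrightarrow> op_sqrt Q (op_inv_sqrt Q u) = u"
  unfolding op_inv_sqrt_def using inj_op_sqrt by (intro f_the_inv_into_f) auto

end


section \<open>The Dirichlet Laplacian in the sine basis\<close>

text \<open>An invariant principle: a class of differentiable functions closed under
  \<open>deriv\<close> contains only smooth functions. The class has to be chosen large enough, for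
  instance all combinations of sine and cosine of one frequency.\<close>

lemma smooth_funI:
  assumes "P f" "\<And>f x. P f \<Longrightarrow> f differentiable (at x)" "\<And>f. P f \<Longrightarrow> P (deriv f)"
  shows "smooth_fun f"
proof -
  have "P ((deriv ^^ n) f)" for n
    using assms(1,3) by (induction n) auto
  with assms(2) show ?thesis unfolding smooth_fun_def by blast
qed

lemma smooth_fun_deriv: "smooth_fun f \<Longrightarrow> smooth_fun (deriv f)"
  unfolding smooth_fun_def by (metis comp_apply funpow_Suc_right)

lemma smooth_fun_has_derivative:
  assumes "smooth_fun f"
  shows "(f has_real_derivative deriv f x) (at x within A)"
proof -
  have "f differentiable (at x)"
    using assms unfolding smooth_fun_def by (metis funpow_0)
  then show ?thesis
    by (metis DERIV_deriv_iff_real_differentiable has_field_derivative_at_within)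
qed

lemma smooth_fun_continuous: "smooth_fun f \<Longrightarrow> continuous_on A f"
  by (rule DERIV_continuous_on[OF smooth_fun_has_derivative])

lemma smooth_fun_lincomb:
  assumes "smooth_fun f" "smooth_fun g"
  shows "smooth_fun (\<lambda>x. c * f x + g x)"
proof (rule smooth_funI[where P="\<lambda>h. \<exists>f g. smooth_fun f \<and> smooth_fun g \<and> h = (\<lambda>x. c * f x + g x)"])
  fix h assume "\<exists>f g. smooth_fun f \<and> smooth_fun g \<and> h = (\<lambda>x. c * f x + g x)"
  then obtain f g where fg: "smooth_fun f" "smooth_fun g" "h = (\<lambda>x. c * f x + g x)" by blast
  have *: "(h has_real_derivative c * deriv f x + deriv g x) (at x)" for x
    unfolding fg(3) by (intro derivative_intros smooth_fun_has_derivative fg DERIV_cmult)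
  show "h differentiable (at x)" for x
    using * real_differentiable_def by blast
  have "deriv h = (\<lambda>x. c * deriv f x + deriv g x)"
    using * by (auto intro: DERIV_imp_deriv)
  then show "\<exists>f g. smooth_fun f \<and> smooth_fun g \<and> deriv h = (\<lambda>x. c * f x + g x)"
    using fg smooth_fun_deriv by blast
qed (use assms in blast)

lemma smooth_fun_trig: "smooth_fun (\<lambda>x. b * sin (a * x) + c * cos (a * x))"
proof (rule smooth_funI[where P="\<lambda>h. \<exists>b c. h = (\<lambda>x. b * sin (a * x) + c * cos (a * x))"])
  fix h assume "\<exists>b c. h = (\<lambda>x. b * sin (a * x) + c * cos (a * x))"
  then obtain b c where h: "h = (\<lambda>x. b * sin (a * x) + c * cos (a * x))" by blast
  have *: "(h has_real_derivative (- (a * c)) * sin (a * x) + (a * b) * cos (a * x)) (at x)" for x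
    unfolding h by (auto intro!: derivative_eq_intros)
  show "h differentiable (at x)" for x
    using * real_differentiable_def by blast
  have "deriv h = (\<lambda>x. (- (a * c)) * sin (a * x) + (a * b) * cos (a * x))"
    using * by (auto intro: DERIV_imp_deriv)
  then show "\<exists>b c. deriv h = (\<lambda>x. b * sin (a * x) + c * cos (a * x))" by blast
qed blast

text \<open>The boundary condition concerns the products \<open>g p\<close>, so that either factor
  may supply the zeros: the sine when \<open>g\<close> is an arbitrary smooth function, or
  \<open>g\<close> when it is paired with a cosine.\<close>

lemma inner_deriv_by_parts:
  assumes g: "smooth_fun g" and p: "continuous_on {0..1} p" "continuous_on {0..1} p'"
    "\<And>x. x \<in> {0..1} \<Longrightarrow> (p has_real_derivative p' x) (at x within {0..1})"
    and bd: "g 0 * p 0 = 0" "g 1 * p 1 = 0"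
  shows "inner (abs_L2 (deriv g)) (abs_L2 p) = - inner (abs_L2 g) (abs_L2 p')"
proof -
  have g': "continuous_on {0..1} g" "continuous_on {0..1} (deriv g)"
    using g smooth_fun_deriv smooth_fun_continuous by blast+
  have "((\<lambda>x. deriv g x * p x + g x * p' x) has_integral (g 1 * p 1 - g 0 * p 0)) {0..1}"
    by (intro fundamental_theorem_of_calculus)
      (auto intro!: derivative_eq_intros p smooth_fun_has_derivative g simp flip: has_real_derivative_iff_has_vector_derivative)
  then have "integral {0..1} (\<lambda>x. deriv g x * p x + g x * p' x) = 0"
    using bd by (simp add: integral_unique)
  moreover have "integral {0..1} (\<lambda>x. deriv g x * p x + g x * p' x)
      = integral {0..1} (\<lambda>x. deriv g x * p x) + integral {0..1} (\<lambda>x. g x * p' x)"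
    by (intro Henstock_Kurzweil_Integration.integral_add integrable_continuous_real continuous_intros p g')
  ultimately show ?thesis
    by (simp add: inner_abs_L2_continuous g' p)
qed

definition sin_deriv :: "nat \<Rightarrow> L2" where
  "sin_deriv i = abs_L2 (\<lambda>\<xi>. sqrt 2 * (real i * pi) * cos (real i * pi * \<xi>))"

lemma inner_deriv_sin_basis:
  assumes "smooth_fun g"
  shows "inner (abs_L2 (deriv g)) (sin_basis i) = - inner (abs_L2 g) (sin_deriv i)"
  unfolding sin_basis_def sin_deriv_def
  by (rule inner_deriv_by_parts[OF assms]) (auto intro!: continuous_intros derivative_eq_intros)

lemma inner_deriv_sin_deriv:
  assumes "smooth_fun g" "g 0 = 0" "g 1 = 0"
  shows "inner (abs_L2 (deriv g)) (sin_deriv i) = eigval i * inner (abs_L2 g) (sin_basis i)"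
proof -
  have "inner (abs_L2 (deriv g)) (sin_deriv i)
      = - inner (abs_L2 g) (abs_L2 (\<lambda>\<xi>. - eigval i * (sqrt 2 * sin (real i * pi * \<xi>))))"
    unfolding sin_deriv_def
    by (rule inner_deriv_by_parts)
      (use assms in \<open>auto intro!: continuous_intros derivative_eq_intros simp: eigval_def power2_eq_square\<close>)
  also have "abs_L2 (\<lambda>\<xi>. - eigval i * (sqrt 2 * sin (real i * pi * \<xi>))) = (- eigval i) *\<^sub>R sin_basis i"
    unfolding sin_basis_def
    by (subst scaleR_abs_L2) (auto intro!: square_integrable_continuous continuous_intros)
  finally show ?thesis by simp
qed

text \<open>Integration by parts passes to the limit. The sines vanish at both endpoints, so no
  boundary condition on the approximants enters, and the sine coefficients of each derivative are
  determined by the preceding one.\<close>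

lemma sobolev_limit_inner_deriv:
  assumes "sobolev_limit m smooth_fun w" "j < m"
  shows "inner (w (Suc j)) (sin_basis i) = - inner (w j) (sin_deriv i)"
proof -
  obtain g where g: "\<And>k. smooth_fun (g k)" "\<And>j. j \<le> m \<Longrightarrow> (\<lambda>k. abs_L2 ((deriv ^^ j) (g k))) \<longlonglongrightarrow> w j"
    using assms(1) by (auto simp: sobolev_limit_def)
  have sm: "smooth_fun ((deriv ^^ j) (g k))" for k
    using g(1)[of k] by (induction j) (auto intro: smooth_fun_deriv)
  have "(\<lambda>k. inner (abs_L2 ((deriv ^^ Suc j) (g k))) (sin_basis i)) \<longlonglongrightarrow> inner (w (Suc j)) (sin_basis i)"
    by (intro tendsto_intros g(2)) (use assms(2) in simp)
  moreover have "(\<lambda>k. - inner (abs_L2 ((deriv ^^ j) (g k))) (sin_deriv i)) \<longlonglongrightarrow> - inner (w j) (sin_deriv i)"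
    by (intro tendsto_intros g(2)) (use assms(2) in simp)
  ultimately show ?thesis
    using LIMSEQ_unique by (simp add: inner_deriv_sin_basis[OF sm])
qed

text \<open>The definite description is well defined: two approximations with the same limit share
  the first derivative and therefore the second, by comparison of sine coefficients.\<close>

lemma laplacian_eq:
  assumes w: "sobolev_limit 2 smooth_fun w"
  shows "laplacian (w 0) = w 2"
  unfolding laplacian_def
proof (rule the_equality)
  fix v assume "\<exists>w'. sobolev_limit 2 smooth_fun w' \<and> w' 0 = w 0 \<and> w' 2 = v"
  then obtain w' where w': "sobolev_limit 2 smooth_fun w'" "w' 0 = w 0" "w' 2 = v" by blast
  note D = sobolev_limit_inner_deriv[OF w] sobolev_limit_inner_deriv[OF w'(1)]
  have "w 1 = w' 1"
    using D(1)[of 0] D(2)[of 0] w'(2) by (intro L2_eqI) simp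
  then have "w' 2 = w 2"
    using D(1)[of 1] D(2)[of 1] by (intro L2_eqI) (simp add: numeral_2_eq_2)
  then show "v = w 2" using w' by simp
qed (use w in blast)

text \<open>Two approximations of \<open>u\<close> are combined. Smooth functions provide the second
  derivative but no boundary values; test functions provide boundary values but only one derivative.
  The first derivatives agree, so the second integration by parts, against the cosine, can use the
  test functions.\<close>

lemma inner_laplacian:
  assumes "u \<in> laplacian_dom"
  shows "inner (laplacian u) (sin_basis i) = - eigval i * inner u (sin_basis i)"
proof -
  obtain w where w: "sobolev_limit 1 test_fun w" "w 0 = u"
    using assms by (auto simp: laplacian_dom_def H10_def)
  obtain w' where w': "sobolev_limit 2 smooth_fun w'" "w' 0 = u"
    using assms by (auto simp: laplacian_dom_def H2_def)
  have w_smooth: "sobolev_limit 1 smooth_fun w"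
    using w(1) by (auto simp: sobolev_limit_def test_fun_def)
  have "w 1 = w' 1"
    using sobolev_limit_inner_deriv[OF w_smooth, of 0] sobolev_limit_inner_deriv[OF w'(1), of 0] w w'
    by (intro L2_eqI) simp
  obtain g where g: "\<And>k. test_fun (g k)" "\<And>j. j \<le> 1 \<Longrightarrow> (\<lambda>k. abs_L2 ((deriv ^^ j) (g k))) \<longlonglongrightarrow> w j"
    using w(1) by (auto simp: sobolev_limit_def)
  have "(\<lambda>k. inner (abs_L2 (deriv (g k))) (sin_deriv i)) \<longlonglongrightarrow> inner (w 1) (sin_deriv i)"
    using g(2)[of 1] by (intro tendsto_intros) simp
  moreover have "(\<lambda>k. eigval i * inner (abs_L2 (g k)) (sin_basis i)) \<longlonglongrightarrow> eigval i * inner u (sin_basis i)"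
    using g(2)[of 0] w(2) by (intro tendsto_intros) simp
  moreover have "inner (abs_L2 (deriv (g k))) (sin_deriv i) = eigval i * inner (abs_L2 (g k)) (sin_basis i)" for k
    using g(1)[of k] by (intro inner_deriv_sin_deriv) (fastforce simp: test_fun_def)+
  ultimately have "inner (w 1) (sin_deriv i) = eigval i * inner u (sin_basis i)"
    using LIMSEQ_unique by simp
  then show ?thesis
    using sobolev_limit_inner_deriv[OF w'(1), of 1] laplacian_eq[OF w'(1)] w'(2) \<open>w 1 = w' 1\<close>
    by (simp add: numeral_2_eq_2)
qed

text \<open>Approximation by test functions is bypassed: an element of
  \<open>galerkin_space n\<close> has a smooth representative vanishing at both endpoints, and the
  constant sequence of this representative computes the Laplacian.\<close>

lemma inner_laplacian_galerkin_space:
  assumes "u \<in> galerkin_space n"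
  shows "inner (laplacian u) (sin_basis i) = - eigval i * inner u (sin_basis i)"
proof -
  have "\<exists>g. smooth_fun g \<and> g 0 = 0 \<and> g 1 = 0 \<and> u = abs_L2 g"
    using assms unfolding galerkin_space_def
  proof (induction rule: span_induct_alt)
    case base
    have "smooth_fun (\<lambda>x. 0)" using smooth_fun_trig[of 0 0 0] by simp
    then show ?case by (metis zero_L2_def)
  next
    case (step c v u)
    then obtain g where g: "smooth_fun g" "g 0 = 0" "g 1 = 0" "u = abs_L2 g" by blast
    obtain j where j: "v = sin_basis j" using step.hyps by auto
    define f where "f \<xi> = sqrt 2 * sin (real j * pi * \<xi>)" for \<xi>
    have f: "smooth_fun f" "f 0 = 0" "f 1 = 0" "v = abs_L2 f"
      using smooth_fun_trig[of "sqrt 2" "real j * pi" 0] by (auto simp: f_def[abs_def] j sin_basis_def)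
    have sq: "square_integrable f" "square_integrable g"
      using f g by (auto intro: square_integrable_continuous smooth_fun_continuous)
    have "c *\<^sub>R v + u = abs_L2 (\<lambda>x. c * f x + g x)"
      using sq by (simp add: f g scaleR_abs_L2 add_abs_L2 square_integrable_scale)
    moreover have "smooth_fun (\<lambda>x. c * f x + g x)"
      by (rule smooth_fun_lincomb[OF f(1) g(1)])
    ultimately show ?case using f g by (intro exI[of _ "\<lambda>x. c * f x + g x"]) simp
  qed
  then obtain g where g: "smooth_fun g" "g 0 = 0" "g 1 = 0" "u = abs_L2 g" by blast
  have "sobolev_limit 2 smooth_fun (\<lambda>j. abs_L2 ((deriv ^^ j) g))"
    unfolding sobolev_limit_def using g(1) by (intro exI[of _ "\<lambda>_. g"]) simp
  from laplacian_eq[OF this] have "laplacian u = abs_L2 (deriv (deriv g))"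
    by (simp add: g(4) numeral_2_eq_2)
  then show ?thesis
    using g by (simp add: inner_deriv_sin_basis smooth_fun_deriv inner_deriv_sin_deriv)
qed

text \<open>The powers stay in \<open>galerkin_space n\<close>, where the operator multiplies the
  coefficient of each e_i by minus its eigenvalue. The operator series thus splits into
  \<open>n\<close> scalar exponential series.\<close>

lemma op_exp_galerkin_laplacian:
  assumes u: "u \<in> galerkin_space n" and t: "t \<ge> 0"
  shows "op_exp (galerkin_laplacian n) t u = heat_semigroup t u"
proof -
  let ?B = "galerkin_laplacian n"
  have space: "(?B ^^ k) u \<in> galerkin_space n" for k
    using u by (induction k) (auto simp: galerkin_laplacian_def galerkin_proj_in_space)
  have coeff: "inner ((?B ^^ k) u) (sin_basis i) = (- eigval i) ^ k * inner u (sin_basis i)"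
    if "i \<ge> 1" for i k
  proof (induction k)
    case (Suc k)
    show ?case
    proof (cases "i \<le> n")
      case True
      then show ?thesis
        using that Suc inner_laplacian_galerkin_space[OF space, of k i]
        by (simp add: galerkin_laplacian_def[of n "(?B ^^ k) u"] inner_galerkin_proj)
    next
      case False
      then show ?thesis
        using inner_galerkin_space[OF space, of i "Suc k"] inner_galerkin_space[OF u, of i] by simp
    qed
  qed simp
  have term_eq: "(t ^ k / fact k) *\<^sub>R (?B ^^ k) u
      = (\<Sum>i=1..n. (((- (t * eigval i)) ^ k /\<^sub>R fact k) * inner u (sin_basis i)) *\<^sub>R sin_basis i)" for k
  proof (rule L2_eqI)
    fix i :: nat assume i: "i \<ge> 1"
    have pow: "(- (t * eigval i)) ^ k = t ^ k * (- eigval i) ^ k"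
      by (simp add: power_mult_distrib[symmetric])
    show "inner ((t ^ k / fact k) *\<^sub>R (?B ^^ k) u) (sin_basis i) = inner (\<Sum>i=1..n.
      (((- (t * eigval i)) ^ k /\<^sub>R fact k) * inner u (sin_basis i)) *\<^sub>R sin_basis i) (sin_basis i)"
      using i inner_galerkin_space[OF u, of i]
      by (subst inner_sum_sin_basis) (auto simp: coeff pow field_simps)
  qed
  have "(\<lambda>k. (t ^ k / fact k) *\<^sub>R (?B ^^ k) u) sums
      (\<Sum>i=1..n. (exp (- (t * eigval i)) * inner u (sin_basis i)) *\<^sub>R sin_basis i)"
    unfolding term_eq
    by (intro sums_sum bounded_linear.sums[OF bounded_linear_scaleR_left] sums_mult2 exp_converges)
  then have "op_exp ?B t u = (\<Sum>i=1..n. (exp (- (t * eigval i)) * inner u (sin_basis i)) *\<^sub>R sin_basis i)"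
    unfolding op_exp_def by (rule sums_unique[symmetric])
  also have "\<dots> = heat_semigroup t u"
  proof (rule L2_eqI)
    fix i :: nat assume i: "i \<ge> 1"
    show "inner (\<Sum>i=1..n. (exp (- (t * eigval i)) * inner u (sin_basis i)) *\<^sub>R sin_basis i) (sin_basis i)
        = inner (heat_semigroup t u) (sin_basis i)"
      using i t inner_galerkin_space[OF u, of i]
      by (subst inner_sum_sin_basis) (auto simp: inner_heat_semigroup)
  qed
  finally show ?thesis .
qed


section \<open>Duhamel's formula\<close>

lemma set_integrable_mult_continuous:
  fixes f g :: "real \<Rightarrow> real"
  assumes f: "set_integrable lborel {a..b} f" and g: "continuous_on {a..b} g"
  shows "set_integrable lborel {a..b} (\<lambda>s. f s * g s)"
proof -
  have "\<exists>B. \<forall>s\<in>{a..b}. \<bar>g s\<bar> \<le> B"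
    using compact_imp_bounded[OF compact_continuous_image[OF g compact_Icc]]
    by (auto simp: bounded_iff)
  then obtain B where B: "\<And>s. s \<in> {a..b} \<Longrightarrow> \<bar>g s\<bar> \<le> B"
    by blast
  show ?thesis
  proof (rule set_integrable_bound)
    show "set_integrable lborel {a..b} (\<lambda>s. B * f s)" using f by simp
    have fm: "(\<lambda>s. indicator {a..b} s *\<^sub>R f s) \<in> borel_measurable lborel"
      using f by (simp add: set_integrable_def)
    have gm: "(\<lambda>s. indicator {a..b} s *\<^sub>R g s) \<in> borel_measurable lborel"
      using borel_measurable_continuous_on_indicator[OF _ g] by simp
    have "(\<lambda>s. (indicator {a..b} s *\<^sub>R f s) * (indicator {a..b} s *\<^sub>R g s))
        = (\<lambda>s. indicator {a..b} s *\<^sub>R (f s * g s))"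
      by (auto simp: indicator_def)
    with borel_measurable_times[OF fm gm] show "set_borel_measurable lborel {a..b} (\<lambda>s. f s * g s)"
      unfolding set_borel_measurable_def by (simp only:)
    show "AE s in lborel. s \<in> {a..b} \<longrightarrow> norm (f s * g s) \<le> norm (B * f s)"
    proof (intro AE_I2 impI)
      fix s assume "s \<in> {a..b}"
      then have "\<bar>g s\<bar> \<le> \<bar>B\<bar>" using B[of s] by simp
      then have "\<bar>f s\<bar> * \<bar>g s\<bar> \<le> \<bar>f s\<bar> * \<bar>B\<bar>" by (intro mult_left_mono) auto
      then show "norm (f s * g s) \<le> norm (B * f s)" by (simp add: abs_mult mult.commute)
    qed
  qed
qed

lemma set_integrable_initial:
  fixes f :: "real \<Rightarrow> 'a::{banach, second_countable_topology}"
  shows "set_integrable lborel {0..T} f \<Longrightarrow> t \<in> {0..T} \<Longrightarrow> set_integrable lborel {0..t} f"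
  by (rule set_integrable_subset) auto

lemma continuous_set_integral_initial:
  fixes f :: "real \<Rightarrow> real"
  assumes "set_integrable lborel {0..T} f"
  shows "continuous_on {0..T} (\<lambda>t. LINT s:{0..t}|lborel. f s)"
proof -
  have "continuous_on {0..T} (\<lambda>t. integral {0..t} f)"
    by (intro indefinite_integral_continuous_1 set_borel_integral_eq_integral assms)
  then show ?thesis
    by (rule continuous_on_eq)
      (metis set_borel_integral_eq_integral(2) set_integrable_initial[OF assms])
qed

text \<open>Both sides integrate f(r) g(s) over the triangle r \<le> s. Extended by zero, the
  product of the two functions is integrable on the plane, so Fubini applies.\<close>

lemma integral_triangle_swap:
  fixes f g :: "real \<Rightarrow> real"
  assumes f: "set_integrable lborel {0..t} f" and g: "set_integrable lborel {0..t} g"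
  shows "(LINT s:{0..t}|lborel. (LINT r:{0..s}|lborel. f r) * g s)
    = (LINT r:{0..t}|lborel. f r * (LINT s:{r..t}|lborel. g s))"
proof -
  let ?f = "\<lambda>r. indicator {0..t} r * f r" and ?g = "\<lambda>s. indicator {0..t} s * g s"
  let ?h = "\<lambda>(s, r). indicator {(s, r). r \<le> s} (s, r) * (?f r * ?g s)"
  have fi: "integrable lborel ?f" and gi: "integrable lborel ?g"
    using f g by (simp_all add: set_integrable_def)
  have [measurable]: "?f \<in> borel_measurable lborel" "?g \<in> borel_measurable lborel"
    using fi gi by auto
  have prod: "integrable (lborel \<Otimes>\<^sub>M lborel) (\<lambda>(s, r). ?f r * ?g s)"
  proof (rule lborel_pair.Fubini_integrable)
    show "integrable lborel (\<lambda>s. \<integral>r. norm (case (s, r) of (s, r) \<Rightarrow> ?f r * ?g s) \<partial>lborel)"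
      using integrable_abs[OF gi] by (simp add: abs_mult)
    show "AE s in lborel. integrable lborel (\<lambda>r. case (s, r) of (s, r) \<Rightarrow> ?f r * ?g s)"
      using fi by (intro AE_I2) simp
  qed measurable
  have meas: "?h \<in> borel_measurable (lborel \<Otimes>\<^sub>M lborel)"
    by measurable
  have h: "integrable (lborel \<Otimes>\<^sub>M lborel) ?h"
    by (rule Bochner_Integration.integrable_bound[OF prod meas])
      (auto simp: indicator_def)
  have "(LINT s:{0..t}|lborel. (LINT r:{0..s}|lborel. f r) * g s)
      = (\<integral>s. (\<integral>r. ?h (s, r) \<partial>lborel) \<partial>lborel)"
    unfolding set_lebesgue_integral_def
  proof (intro Bochner_Integration.integral_cong refl)
    fix s :: real
    have eq: "(\<integral>r. ?h (s, r) \<partial>lborel) = ?g s * (\<integral>r. indicator {0..s} r *\<^sub>R f r \<partial>lborel)"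
      by (subst integral_mult_right_zero[symmetric])
        (intro Bochner_Integration.integral_cong, auto simp: indicator_def)
    show "indicator {0..t} s *\<^sub>R ((\<integral>r. indicator {0..s} r *\<^sub>R f r \<partial>lborel) * g s)
        = (\<integral>r. ?h (s, r) \<partial>lborel)"
      unfolding eq by (simp add: mult_ac)
  qed
  also have "\<dots> = (\<integral>r. (\<integral>s. ?h (s, r) \<partial>lborel) \<partial>lborel)"
    using lborel_pair.Fubini_integral[of "\<lambda>s r. ?h (s, r)"] h by (simp add: case_prod_beta')
  also have "\<dots> = (LINT r:{0..t}|lborel. f r * (LINT s:{r..t}|lborel. g s))"
    unfolding set_lebesgue_integral_def
  proof (intro Bochner_Integration.integral_cong refl)
    fix r :: real
    have eq: "(\<integral>s. ?h (s, r) \<partial>lborel) = ?f r * (\<integral>s. indicator {r..t} s *\<^sub>R g s \<partial>lborel)"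
      by (subst integral_mult_right_zero[symmetric])
        (intro Bochner_Integration.integral_cong, auto simp: indicator_def)
    show "(\<integral>s. ?h (s, r) \<partial>lborel)
        = indicator {0..t} r *\<^sub>R (f r * (\<integral>s. indicator {r..t} s *\<^sub>R g s \<partial>lborel))"
      unfolding eq by (simp add: mult_ac)
  qed
  finally show ?thesis .
qed

lemma set_integral_derivative:
  fixes B B' :: "real \<Rightarrow> real"
  assumes "r \<le> t" "continuous_on {r..t} B'"
    "\<And>s. s \<in> {r..t} \<Longrightarrow> (B has_real_derivative B' s) (at s within {r..t})"
  shows "(LINT s:{r..t}|lborel. B' s) = B t - B r"
proof -
  have "(B' has_integral (B t - B r)) {r..t}"
    using assms by (intro fundamental_theorem_of_calculus) (auto simp flip: has_real_derivative_iff_has_vector_derivative)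
  then show ?thesis
    using set_borel_integral_eq_integral(2)[OF borel_integrable_atLeastAtMost'[OF assms(2)]]
    by (simp add: integral_unique)
qed

text \<open>\<open>A\<close> is merely the primitive of an integrable function and need not be
  differentiable at every point. Writing the increments of \<open>B\<close> as integrals of
  \<open>B'\<close> and exchanging the order of integration replaces differentiation of the
  product.\<close>

lemma product_rule_abs_continuous:
  fixes A B :: "real \<Rightarrow> real"
  assumes t: "t \<ge> 0" and f: "set_integrable lborel {0..t} f"
    and A: "\<And>s. s \<in> {0..t} \<Longrightarrow> A s = a + (LINT r:{0..s}|lborel. f r)"
    and B: "\<And>s. (B has_real_derivative B' s) (at s)" and B': "continuous_on UNIV B'"
  shows "A t * B t = a * B 0 + (LINT s:{0..t}|lborel. f s * B s + A s * B' s)"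
proof -
  have Bc: "continuous_on S B" for S
    using B DERIV_continuous_on has_field_derivative_at_within by blast
  have B'c: "continuous_on S B'" for S
    using B' by (rule continuous_on_subset) simp
  have B'i: "set_integrable lborel {r..t} B'" for r
    by (intro borel_integrable_atLeastAtMost' B'c)
  have FTC: "(LINT s:{r..t}|lborel. B' s) = B t - B r" if "r \<le> t" for r
    by (rule set_integral_derivative[OF that B'c has_field_derivative_at_within[OF B]])
  have fB: "set_integrable lborel {0..t} (\<lambda>s. f s * B s)"
    by (intro set_integrable_mult_continuous f Bc)
  have Fc: "continuous_on {0..t} (\<lambda>s. LINT r:{0..s}|lborel. f r)"
    by (rule continuous_set_integral_initial[OF f])
  have FB': "set_integrable lborel {0..t} (\<lambda>s. (LINT r:{0..s}|lborel. f r) * B' s)"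
    by (intro borel_integrable_atLeastAtMost' continuous_intros Fc B'c)
  have "(LINT s:{0..t}|lborel. f s * B s + A s * B' s)
      = (LINT s:{0..t}|lborel. f s * B s + (a * B' s + (LINT r:{0..s}|lborel. f r) * B' s))"
    by (intro set_lebesgue_integral_cong) (auto simp: A distrib_right)
  also have "\<dots> = (LINT s:{0..t}|lborel. f s * B s)
      + (a * (B t - B 0) + (LINT s:{0..t}|lborel. (LINT r:{0..s}|lborel. f r) * B' s))"
    using fB FB' B'i t by (subst set_integral_add, simp, simp, subst set_integral_add) (auto simp: FTC)
  also have "(LINT s:{0..t}|lborel. (LINT r:{0..s}|lborel. f r) * B' s)
      = (LINT r:{0..t}|lborel. f r * (LINT s:{r..t}|lborel. B' s))"
    by (rule integral_triangle_swap[OF f B'i])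
  also have "\<dots> = (LINT r:{0..t}|lborel. B t * f r - f r * B r)"
    by (intro set_lebesgue_integral_cong) (auto simp: FTC algebra_simps)
  also have "\<dots> = B t * (LINT r:{0..t}|lborel. f r) - (LINT r:{0..t}|lborel. f r * B r)"
    using f fB by (subst set_integral_diff) auto
  finally show ?thesis
    using A[of t] t by (simp add: algebra_simps)
qed

lemma exp_weight_set_integral:
  fixes h :: "real \<Rightarrow> real"
  shows "(LINT s:{0..t}|lborel. exp (- ((t - s) * l)) * h s)
    = exp (- (t * l)) * (LINT s:{0..t}|lborel. h s * exp (s * l))"
proof -
  have "exp (- ((t - s) * l)) * h s = exp (- (t * l)) * (h s * exp (s * l))" for s
  proof -
    have "exp (- ((t - s) * l)) = exp (- (t * l)) * exp (s * l)"
      by (simp add: algebra_simps flip: exp_add)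
    then show ?thesis by simp
  qed
  then show ?thesis by (simp only: set_integral_mult_right)
qed

text \<open>One direction multiplies by the integrating factor exp(t l), which cancels the terms
  containing \<open>z\<close>; the other starts from z(t) exp(t l) and multiplies by exp(- t
  l).\<close>

lemma scalar_duhamel_iff:
  fixes z h :: "real \<Rightarrow> real"
  assumes z: "continuous_on {0..T} z" and h: "set_integrable lborel {0..T} h"
  shows "(\<forall>t\<in>{0..T}. z t = exp (- (t * l)) * a + (LINT s:{0..t}|lborel. exp (- ((t - s) * l)) * h s))
    \<longleftrightarrow> (\<forall>t\<in>{0..T}. z t = a + (LINT s:{0..t}|lborel. - l * z s + h s))" (is "?mild \<longleftrightarrow> ?int")
proof
  assume ?int
  show ?mild
  proof
    fix t assume t: "t \<in> {0..T}"
    have zc: "continuous_on {0..t} z"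
      using z by (rule continuous_on_subset) (use t in auto)
    have f: "set_integrable lborel {0..t} (\<lambda>s. - l * z s + h s)"
      using borel_integrable_atLeastAtMost'[OF zc] set_integrable_initial[OF h t]
      by (auto intro!: set_integral_add(1) set_integrable_mult_right simp del: mult_minus_left)
    have A: "z s = a + (LINT r:{0..s}|lborel. - l * z r + h r)" if "s \<in> {0..t}" for s
      using \<open>?int\<close> that t by simp
    have "z t * exp (t * l) = a * exp (0 * l) + (LINT s:{0..t}|lborel. (- l * z s + h s) * exp (s * l) + z s * (exp (s * l) * l))"
      by (rule product_rule_abs_continuous[OF _ f A])
        (use t in \<open>auto intro!: derivative_eq_intros continuous_intros\<close>)
    also have "(\<lambda>s. (- l * z s + h s) * exp (s * l) + z s * (exp (s * l) * l)) = (\<lambda>s. h s * exp (s * l))"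
      by (simp add: algebra_simps)
    finally have E: "z t * exp (t * l) = a + (LINT s:{0..t}|lborel. h s * exp (s * l))" by simp
    have "z t = exp (- (t * l)) * (z t * exp (t * l))"
      by (simp add: exp_minus)
    then show "z t = exp (- (t * l)) * a + (LINT s:{0..t}|lborel. exp (- ((t - s) * l)) * h s)"
      unfolding E exp_weight_set_integral distrib_left .
  qed
next
  assume ?mild
  show ?int
  proof
    fix t assume t: "t \<in> {0..T}"
    have f: "set_integrable lborel {0..t} (\<lambda>s. h s * exp (s * l))"
      by (intro set_integrable_mult_continuous set_integrable_initial[OF h t] continuous_intros)
    have A: "z s * exp (s * l) = a + (LINT r:{0..s}|lborel. h r * exp (r * l))" if "s \<in> {0..t}" for s
    proof -
      have "z s = exp (- (s * l)) * (a + (LINT r:{0..s}|lborel. h r * exp (r * l)))"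
        using \<open>?mild\<close> that t by (simp add: exp_weight_set_integral distrib_left)
      then show ?thesis by (simp add: exp_minus field_simps)
    qed
    have E: "z t * exp (t * l) * exp (- (t * l)) = a * exp (- (0 * l)) + (LINT s:{0..t}|lborel.
        h s * exp (s * l) * exp (- (s * l)) + z s * exp (s * l) * (- (exp (- (s * l)) * l)))"
      by (rule product_rule_abs_continuous[OF _ f A])
        (use t in \<open>auto intro!: derivative_eq_intros continuous_intros\<close>)
    have E1: "x * exp (s * l) * exp (- (s * l)) = x" for x s
      by (simp add: mult.assoc flip: exp_add)
    have E2: "x * exp (s * l) * (- (exp (- (s * l)) * l)) = - l * x" for x s
      by (simp add: mult.assoc mult.left_commute[of l] exp_minus)
    show "z t = a + (LINT s:{0..t}|lborel. - l * z s + h s)"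
      using E[unfolded E1 E2] by (simp add: add.commute)
  qed
qed

lemma scalar_duhamel_unique:
  fixes h1 h2 :: "real \<Rightarrow> real"
  assumes h: "set_integrable lborel {0..T} h1" "set_integrable lborel {0..T} h2"
    and eq: "\<And>t. t \<in> {0..T} \<Longrightarrow> (LINT s:{0..t}|lborel. exp (- ((t - s) * l)) * h1 s)
      = (LINT s:{0..t}|lborel. exp (- ((t - s) * l)) * h2 s)"
  shows "AE s in lborel. s \<in> {0..T} \<longrightarrow> h1 s = h2 s"
proof -
  have i: "set_integrable lborel {0..T} (\<lambda>s. h1 s * exp (s * l))" "set_integrable lborel {0..T} (\<lambda>s. h2 s * exp (s * l))"
    by (intro set_integrable_mult_continuous h continuous_intros)+
  have "AE s in lborel. s \<in> {0..T} \<longrightarrow> h1 s * exp (s * l) - h2 s * exp (s * l) = 0"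
  proof (rule AE_zero_if_initial_integrals_zero)
    fix t assume t: "t \<in> {0..T}"
    have "(LINT s:{0..t}|lborel. h1 s * exp (s * l)) = (LINT s:{0..t}|lborel. h2 s * exp (s * l))"
      using eq[OF t] by (simp add: exp_weight_set_integral)
    then show "(LINT s:{0..t}|lborel. h1 s * exp (s * l) - h2 s * exp (s * l)) = 0"
      using set_integrable_initial[OF i(1) t] set_integrable_initial[OF i(2) t] by (subst set_integral_diff) auto
  qed (use i in auto)
  then show ?thesis by (rule eventually_mono) (auto simp: left_diff_distrib[symmetric])
qed

section \<open>Convolution with the heat semigroup\<close>

text \<open>Measurability is checked on coefficients and integrability follows from contractivity.
  The indicator of [0,t] keeps \<open>t - s\<close> nonnegative, which the formulas for the
  semigroup require.\<close>

lemma heat_integrand: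
  assumes h: "set_integrable lborel {0..t} h" and i: "i \<ge> 1"
  shows "set_integrable lborel {0..t} (\<lambda>s. heat_semigroup (t - s) (h s))"
    and "set_integrable lborel {0..t} (\<lambda>s. inner (h s) (sin_basis i))"
    and "inner (LINT s:{0..t}|lborel. heat_semigroup (t - s) (h s)) (sin_basis i)
      = (LINT s:{0..t}|lborel. exp (- ((t - s) * eigval i)) * inner (h s) (sin_basis i))"
proof -
  have [measurable]: "(\<lambda>s. indicator {0..t} s *\<^sub>R h s) \<in> borel_measurable lborel"
    using h by (simp add: set_integrable_def)
  have coord: "inner (indicator {0..t} s *\<^sub>R heat_semigroup (t - s) (h s)) (sin_basis i)
      = exp (- ((t - s) * eigval i)) * inner (indicator {0..t} s *\<^sub>R h s) (sin_basis i)"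
    if "i \<ge> 1" for s i
    using that by (auto simp: indicator_def inner_heat_semigroup)
  have "(\<lambda>s. indicator {0..t} s *\<^sub>R heat_semigroup (t - s) (h s)) \<in> borel_measurable lborel"
    by (rule borel_measurable_L2I, subst coord) measurable
  then show int: "set_integrable lborel {0..t} (\<lambda>s. heat_semigroup (t - s) (h s))"
    by (intro set_integrable_bound[OF h]) (auto simp: set_borel_measurable_def norm_heat_semigroup_le)
  show "set_integrable lborel {0..t} (\<lambda>s. inner (h s) (sin_basis i))"
    using integrable_inner_left[of "sin_basis i" lborel "\<lambda>s. indicator {0..t} s *\<^sub>R h s"] h
    by (simp add: set_integrable_def)
  have "inner (LINT s:{0..t}|lborel. heat_semigroup (t - s) (h s)) (sin_basis i)
      = (\<integral>s. inner (indicator {0..t} s *\<^sub>R heat_semigroup (t - s) (h s)) (sin_basis i) \<partial>lborel)"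
    using int unfolding set_lebesgue_integral_def set_integrable_def by (subst integral_inner_left) auto
  also have "\<dots> = (LINT s:{0..t}|lborel. exp (- ((t - s) * eigval i)) * inner (h s) (sin_basis i))"
    unfolding set_lebesgue_integral_def
    using i by (intro Bochner_Integration.integral_cong) (auto simp: indicator_def inner_heat_semigroup)
  finally show "inner (LINT s:{0..t}|lborel. heat_semigroup (t - s) (h s)) (sin_basis i)
      = (LINT s:{0..t}|lborel. exp (- ((t - s) * eigval i)) * inner (h s) (sin_basis i))" .
qed

lemma norm_heat_integral_le:
  assumes h: "set_integrable lborel {0..t} h"
  shows "norm (LINT s:{0..t}|lborel. heat_semigroup (t - s) (h s)) \<le> (LINT s:{0..t}|lborel. norm (h s))"
proof -
  note int = heat_integrand(1)[OF h le_refl]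
  have "norm (LINT s:{0..t}|lborel. heat_semigroup (t - s) (h s))
      \<le> (LINT s:{0..t}|lborel. norm (heat_semigroup (t - s) (h s)))"
    by (rule set_integral_norm_bound[OF int])
  also have "\<dots> \<le> (LINT s:{0..t}|lborel. norm (h s))"
    using set_integrable_norm[OF int] set_integrable_norm[OF h]
    by (rule set_integral_mono) (simp add: norm_heat_semigroup_le)
  finally show ?thesis .
qed

text \<open>Each coefficient yields one exceptional null set, and countably many coefficients
  suffice. This is the source of uniqueness of controls in both rate functions.\<close>

lemma heat_integral_unique:
  assumes h: "set_integrable lborel {0..T} h1" "set_integrable lborel {0..T} h2"
    and eq: "\<And>t. t \<in> {0..T} \<Longrightarrow> (LINT s:{0..t}|lborel. heat_semigroup (t - s) (h1 s))
      = (LINT s:{0..t}|lborel. heat_semigroup (t - s) (h2 s))"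
  shows "AE s in lborel. s \<in> {0..T} \<longrightarrow> h1 s = h2 s"
proof -
  have "AE s in lborel. \<forall>i. s \<in> {0..T} \<longrightarrow> inner (h1 s) (sin_basis (Suc i)) = inner (h2 s) (sin_basis (Suc i))"
    unfolding AE_all_countable
  proof
    fix i
    show "AE s in lborel. s \<in> {0..T} \<longrightarrow> inner (h1 s) (sin_basis (Suc i)) = inner (h2 s) (sin_basis (Suc i))"
    proof (rule scalar_duhamel_unique)
      fix t assume t: "t \<in> {0..T}"
      show "(LINT s:{0..t}|lborel. exp (- ((t - s) * eigval (Suc i))) * inner (h1 s) (sin_basis (Suc i)))
          = (LINT s:{0..t}|lborel. exp (- ((t - s) * eigval (Suc i))) * inner (h2 s) (sin_basis (Suc i)))"
        using eq[OF t] heat_integrand(3)[OF set_integrable_initial[OF h(1) t], of "Suc i"]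
          heat_integrand(3)[OF set_integrable_initial[OF h(2) t], of "Suc i"] by simp
    qed (intro heat_integrand(2) h, simp)+
  qed
  then show ?thesis
  proof (rule eventually_mono, intro impI)
    fix s assume *: "\<forall>i. s \<in> {0..T} \<longrightarrow> inner (h1 s) (sin_basis (Suc i)) = inner (h2 s) (sin_basis (Suc i))"
      and s: "s \<in> {0..T}"
    show "h1 s = h2 s"
    proof (rule L2_eqI)
      fix i :: nat assume "i \<ge> 1"
      then show "inner (h1 s) (sin_basis i) = inner (h2 s) (sin_basis i)"
        using *[rule_format, OF s, of "i - 1"] by simp
    qed
  qed
qed

text \<open>The bridge between mild solutions and time derivatives. It is read from right to left to
  see that the control of a Sobolev path drives it, and from left to right to differentiate a
  Galerkin solution.\<close>

lemma duhamel_iff: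
  assumes z: "continuous_on {0..T} z" and h: "set_integrable lborel {0..T} h"
  shows "(\<forall>t\<in>{0..T}. z t = heat_semigroup t x + (LINT s:{0..t}|lborel. heat_semigroup (t - s) (h s)))
    \<longleftrightarrow> (\<forall>i\<ge>1. \<forall>t\<in>{0..T}. inner (z t) (sin_basis i) = inner x (sin_basis i)
          + (LINT s:{0..t}|lborel. - eigval i * inner (z s) (sin_basis i) + inner (h s) (sin_basis i)))"
    (is "?mild \<longleftrightarrow> ?int")
proof -
  have "?mild \<longleftrightarrow> (\<forall>i\<ge>1. \<forall>t\<in>{0..T}. inner (z t) (sin_basis i)
      = inner (heat_semigroup t x + (LINT s:{0..t}|lborel. heat_semigroup (t - s) (h s))) (sin_basis i))"
    by (auto intro: L2_eqI)
  also have "\<dots> \<longleftrightarrow> (\<forall>i\<ge>1. \<forall>t\<in>{0..T}. inner (z t) (sin_basis i) = exp (- (t * eigval i)) * inner x (sin_basis i)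
      + (LINT s:{0..t}|lborel. exp (- ((t - s) * eigval i)) * inner (h s) (sin_basis i)))"
  proof (intro all_cong ball_cong refl)
    fix i :: nat and t assume i: "i \<ge> 1" and t: "t \<in> {0..T}"
    show "(inner (z t) (sin_basis i)
        = inner (heat_semigroup t x + (LINT s:{0..t}|lborel. heat_semigroup (t - s) (h s))) (sin_basis i))
      \<longleftrightarrow> (inner (z t) (sin_basis i) = exp (- (t * eigval i)) * inner x (sin_basis i)
      + (LINT s:{0..t}|lborel. exp (- ((t - s) * eigval i)) * inner (h s) (sin_basis i)))"
      using t heat_integrand(3)[OF set_integrable_initial[OF h t] i] inner_heat_semigroup[OF _ i]
      by (simp add: inner_add_left)
  qed
  also have "\<dots> \<longleftrightarrow> ?int"
    by (intro all_cong scalar_duhamel_iff continuous_intros z heat_integrand(2)[OF h])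
  finally show ?thesis .
qed

text \<open>With values in \<open>galerkin_space n\<close> only finitely many coefficients survive,
  and each is an exponential times a continuous primitive. Continuity thus needs no estimate on the
  semigroup.\<close>

lemma galerkin_heat_integral:
  assumes h: "set_integrable lborel {0..T} h" and space: "\<And>s. s \<in> {0..T} \<Longrightarrow> h s \<in> galerkin_space n"
  shows "\<And>t. t \<in> {0..T} \<Longrightarrow> (LINT s:{0..t}|lborel. heat_semigroup (t - s) (h s)) \<in> galerkin_space n"
    and "continuous_on {0..T} (\<lambda>t. LINT s:{0..t}|lborel. heat_semigroup (t - s) (h s))"
proof -
  let ?G = "\<lambda>t. LINT s:{0..t}|lborel. heat_semigroup (t - s) (h s)"
  have coord: "inner (?G t) (sin_basis i)
      = exp (- (t * eigval i)) * (LINT s:{0..t}|lborel. inner (h s) (sin_basis i) * exp (s * eigval i))"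
    if "t \<in> {0..T}" "i \<ge> 1" for t i
    using heat_integrand(3)[OF set_integrable_initial[OF h that(1)] that(2)]
    by (simp add: exp_weight_set_integral)
  show G: "?G t \<in> galerkin_space n" if "t \<in> {0..T}" for t
  proof (rule galerkin_spaceI)
    fix i assume "i > n"
    then have "(LINT s:{0..t}|lborel. inner (h s) (sin_basis i) * exp (s * eigval i)) = (LINT s:{0..t}|lborel. 0)"
      using that by (intro set_lebesgue_integral_cong) (auto simp: inner_galerkin_space[OF space])
    then show "inner (?G t) (sin_basis i) = 0"
      using coord[OF that, of i] \<open>i > n\<close> by simp
  qed
  have "continuous_on {0..T} (\<lambda>t. \<Sum>i=1..n. inner (?G t) (sin_basis i) *\<^sub>R sin_basis i)"
  proof (intro continuous_on_sum continuous_on_scaleR continuous_on_const)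
    fix i assume "i \<in> {1..n}"
    then have i: "i \<ge> 1" by simp
    have "continuous_on {0..T} (\<lambda>t. exp (- (t * eigval i)) * (LINT s:{0..t}|lborel. inner (h s) (sin_basis i) * exp (s * eigval i)))"
      by (intro continuous_intros continuous_set_integral_initial set_integrable_mult_continuous heat_integrand(2)[OF h i])
    then show "continuous_on {0..T} (\<lambda>t. inner (?G t) (sin_basis i))"
      by (rule continuous_on_eq) (simp add: coord[OF _ i])
  qed
  then show "continuous_on {0..T} ?G"
  proof (rule continuous_on_eq)
    fix t assume "t \<in> {0..T}"
    then show "(\<Sum>i=1..n. inner (?G t) (sin_basis i) *\<^sub>R sin_basis i) = ?G t"
      using G[of t] by (simp add: galerkin_space_iff galerkin_proj_def)
  qed
qed

lemma L2_path_set_integrable: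
  assumes "L2_path T f"
  shows "set_integrable lborel {0..T} f"
proof (rule set_integrable_bound)
  show "set_integrable lborel {0..T} (\<lambda>t. 1 + (norm (f t))\<^sup>2)"
    using assms borel_integrable_atLeastAtMost'[of 0 T "\<lambda>_. 1::real"]
    by (intro set_integral_add) (auto simp: L2_path_def)
  have "norm (f t) \<le> 1 + (norm (f t))\<^sup>2" for t
    using sum_squares_bound[of 1 "norm (f t)"] norm_ge_zero[of "f t"] by (simp del: norm_ge_zero)
  then show "AE t in lborel. t \<in> {0..T} \<longrightarrow> norm (f t) \<le> norm (1 + (norm (f t))\<^sup>2)"
    by (auto intro: order_trans)
qed (use assms in \<open>simp add: L2_path_def\<close>)


section \<open>Time derivatives in the anisotropic Sobolev space\<close>

lemma smooth_fun2_partials: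
  assumes "smooth_fun2 g" "d \<in> {partial_t, partial_xi}"
  shows "smooth_fun2 (d g)"
  unfolding smooth_fun2_def
proof (intro allI impI)
  fix ds :: "((real \<Rightarrow> real \<Rightarrow> real) \<Rightarrow> real \<Rightarrow> real \<Rightarrow> real) list"
  assume "set ds \<subseteq> {partial_t, partial_xi}"
  \<comment> \<open>\<open>foldr\<close> applies the last entry of the list first, so the additional
    derivative is appended at the end.\<close>
  then have "set (ds @ [d]) \<subseteq> {partial_t, partial_xi}" using assms(2) by auto
  then show "(\<lambda>(t, \<xi>). foldr (\<lambda>d g. d g) ds (d g) t \<xi>) differentiable_on UNIV"
    using assms(1) unfolding smooth_fun2_def by (metis (no_types, lifting) comp_apply foldr_Cons foldr_Nil foldr_append id_apply)
qed

lemma smooth_fun2_differentiable: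
  assumes "smooth_fun2 g"
  shows "(\<lambda>(t, \<xi>). g t \<xi>) differentiable (at p)"
proof -
  have "(\<lambda>(t, \<xi>). foldr (\<lambda>d g. d g) [] g t \<xi>) differentiable_on UNIV"
    using assms unfolding smooth_fun2_def by (metis empty_set empty_subsetI)
  then have "(\<lambda>(t, \<xi>). g t \<xi>) differentiable_on UNIV" by simp
  then show ?thesis unfolding differentiable_on_def by (metis UNIV_I)
qed

lemma smooth_fun2_continuous:
  assumes "smooth_fun2 g"
  shows "continuous_on S (\<lambda>(t, \<xi>). g t \<xi>)"
  using smooth_fun2_differentiable[OF assms]
  by (intro differentiable_imp_continuous_on differentiable_at_imp_differentiable_on) auto

lemma continuous_slice:
  fixes g :: "real \<Rightarrow> real \<Rightarrow> real"
  assumes "continuous_on UNIV (\<lambda>(t, \<xi>). g t \<xi>)"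
  shows "continuous_on S (g t)"
proof -
  have "continuous_on S (\<lambda>\<xi>. case (t, \<xi>) of (t, \<xi>) \<Rightarrow> g t \<xi>)"
    by (rule continuous_on_compose2[OF assms continuous_on_Pair[OF continuous_on_const continuous_on_id]]) simp
  then show ?thesis by simp
qed

lemma smooth_fun2_partial_t:
  assumes "smooth_fun2 g"
  shows "((\<lambda>s. g s \<xi>) has_real_derivative partial_t g t \<xi>) (at t)"
proof -
  have "((\<lambda>(t, \<xi>). g t \<xi>) \<circ> (\<lambda>s. (s, \<xi>))) differentiable (at t)"
    by (rule differentiable_chain_at)
      (use smooth_fun2_differentiable[OF assms] in \<open>auto simp: differentiable_Pair\<close>)
  then have "(\<lambda>s. g s \<xi>) differentiable (at t)" by (simp add: o_def)
  then show ?thesis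
    unfolding partial_t_def by (simp add: DERIV_deriv_iff_real_differentiable)
qed

lemma norm_abs_L2_le:
  assumes f: "continuous_on {0..1} f" and B: "\<And>x. x \<in> {0..1} \<Longrightarrow> \<bar>f x\<bar> \<le> B"
  shows "norm (abs_L2 f) \<le> B"
proof -
  have "(norm (abs_L2 f))\<^sup>2 = integral {0..1} (\<lambda>x. (f x)\<^sup>2)"
    using inner_abs_L2_continuous[OF f f] unfolding power2_norm_eq_inner by (simp add: power2_eq_square)
  also have "\<dots> \<le> integral {0..1} (\<lambda>x::real. B\<^sup>2)"
  proof (rule integral_le)
    show "(f x)\<^sup>2 \<le> B\<^sup>2" if "x \<in> {0..1}" for x
      using power_mono[OF B[OF that], of 2] by simp
  qed (intro integrable_continuous_real continuous_intros f)+
  finally show ?thesis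
    using B[of 0] power2_le_imp_le[of "norm (abs_L2 f)" B] by simp
qed

text \<open>Uniform continuity on the compact rectangle makes nearby slices uniformly close, and the
  sup norm dominates the \<open>L2\<close> norm on the unit interval.\<close>

lemma continuous_abs_L2_slice:
  fixes g :: "real \<Rightarrow> real \<Rightarrow> real"
  assumes g: "continuous_on UNIV (\<lambda>(t, \<xi>). g t \<xi>)"
  shows "continuous_on {0..T} (\<lambda>t. abs_L2 (g t))"
  unfolding continuous_on_iff
proof (intro ballI allI impI)
  fix t and e :: real assume t: "t \<in> {0..T}" and e: "e > 0"
  note sl = continuous_slice[OF g]
  have "uniformly_continuous_on ({0..T} \<times> {0..1}) (\<lambda>(t, \<xi>). g t \<xi>)"
    by (rule compact_uniformly_continuous)
      (auto intro: continuous_on_subset[OF g] compact_Times)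
  then obtain d where d: "d > 0"
    "\<And>p p'. p \<in> {0..T} \<times> {0..1} \<Longrightarrow> p' \<in> {0..T} \<times> {0..1} \<Longrightarrow> dist p' p < d
      \<Longrightarrow> dist (case p' of (t, \<xi>) \<Rightarrow> g t \<xi>) (case p of (t, \<xi>) \<Rightarrow> g t \<xi>) < e / 2"
    unfolding uniformly_continuous_on_def using half_gt_zero[OF e] by metis
  show "\<exists>d>0. \<forall>s\<in>{0..T}. dist s t < d \<longrightarrow> dist (abs_L2 (g s)) (abs_L2 (g t)) < e"
  proof (intro exI[of _ d] conjI ballI impI d(1))
    fix s assume s: "s \<in> {0..T}" "dist s t < d"
    have "norm (abs_L2 (\<lambda>\<xi>. g s \<xi> - g t \<xi>)) \<le> e / 2"
    proof (rule norm_abs_L2_le)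
      show "\<bar>g s \<xi> - g t \<xi>\<bar> \<le> e / 2" if "\<xi> \<in> {0..1}" for \<xi>
        using d(2)[of "(t, \<xi>)" "(s, \<xi>)"] s t that by (simp add: dist_Pair_Pair dist_real_def)
    qed (intro continuous_intros sl)
    then show "dist (abs_L2 (g s)) (abs_L2 (g t)) < e"
      using e by (simp add: dist_norm diff_abs_L2 square_integrable_continuous sl)
  qed
qed

lemma smooth_fun2_inner_time:
  assumes g: "smooth_fun2 g" and t: "t \<ge> 0"
  shows "inner (abs_L2 (g t)) (sin_basis i)
    = inner (abs_L2 (g 0)) (sin_basis i) + (LINT s:{0..t}|lborel. inner (abs_L2 (partial_t g s)) (sin_basis i))"
proof -
  define e where "e \<xi> = sqrt 2 * sin (real i * pi * \<xi>)" for \<xi>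
  have ec: "continuous_on S e" for S
    unfolding e_def by (intro continuous_intros)
  have sb: "sin_basis i = abs_L2 e"
    by (simp add: sin_basis_def e_def[abs_def])
  have g': "smooth_fun2 (partial_t g)"
    using smooth_fun2_partials[OF g] by simp
  have sl: "continuous_on {0..1} (h t)" if "smooth_fun2 h" for h t
    by (rule continuous_slice[OF smooth_fun2_continuous[OF that]])
  have inn: "inner (abs_L2 (h t)) (sin_basis i) = integral {0..1} (\<lambda>\<xi>. h t \<xi> * e \<xi>)" if "smooth_fun2 h" for h t
    unfolding sb by (rule inner_abs_L2_continuous[OF sl[OF that] ec])
  have deriv: "((\<lambda>s. inner (abs_L2 (g s)) (sin_basis i)) has_real_derivative
      inner (abs_L2 (partial_t g s)) (sin_basis i)) (at s within {0..t})" if "s \<in> {0..t}" for s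
    unfolding inn[OF g] inn[OF g'] box_real(2)[symmetric]
  proof (rule leibniz_rule_field_derivative)
    show "((\<lambda>s. g s \<xi> * e \<xi>) has_real_derivative partial_t g s \<xi> * e \<xi>) (at s within cbox 0 t)" for s \<xi>
      by (rule DERIV_cmult_right[OF has_field_derivative_at_within[OF smooth_fun2_partial_t[OF g]]])
    show "(\<lambda>\<xi>. g s \<xi> * e \<xi>) integrable_on cbox 0 1" for s
      unfolding box_real by (intro integrable_continuous_real continuous_intros sl g ec)
    have "continuous_on (cbox 0 t \<times> cbox 0 1) (\<lambda>p. (case p of (t, \<xi>) \<Rightarrow> partial_t g t \<xi>) * e (snd p))"
      by (intro continuous_intros smooth_fun2_continuous[OF g'] continuous_on_compose2[OF ec[of UNIV]]) auto
    then show "continuous_on (cbox 0 t \<times> cbox 0 1) (\<lambda>(s, \<xi>). partial_t g s \<xi> * e \<xi>)"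
      by (simp add: case_prod_beta')
  qed (use that in auto)
  have "continuous_on {0..t} (\<lambda>s. inner (abs_L2 (partial_t g s)) (sin_basis i))"
    by (intro continuous_intros continuous_abs_L2_slice smooth_fun2_continuous[OF g'])
  from set_integral_derivative[OF t this deriv] show ?thesis by simp
qed

lemma L2_path_diff:
  assumes "L2_path T f" "L2_path T g"
  shows "L2_path T (\<lambda>t. f t - g t)"
  unfolding L2_path_def
proof
  have "(\<lambda>t. indicator {0..T} t *\<^sub>R f t - indicator {0..T} t *\<^sub>R g t) \<in> borel_measurable lborel"
    using assms unfolding L2_path_def set_borel_measurable_def by (intro borel_measurable_diff) auto
  then show m: "set_borel_measurable lborel {0..T} (\<lambda>t. f t - g t)"
    by (simp add: set_borel_measurable_def scaleR_diff_right)
  show "set_integrable lborel {0..T} (\<lambda>t. (norm (f t - g t))\<^sup>2)"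
  proof (rule set_integrable_bound)
    show "set_integrable lborel {0..T} (\<lambda>t. 2 * (norm (f t))\<^sup>2 + 2 * (norm (g t))\<^sup>2)"
      using assms by (intro set_integral_add(1)) (auto simp: L2_path_def)
    have "(\<lambda>t. (norm (indicator {0..T} t *\<^sub>R (f t - g t)))\<^sup>2) \<in> borel_measurable lborel"
      using m unfolding set_borel_measurable_def
      by (intro borel_measurable_power measurable_compose[OF _ borel_measurable_norm])
    also have "(\<lambda>t. (norm (indicator {0..T} t *\<^sub>R (f t - g t)))\<^sup>2)
        = (\<lambda>t. indicat_real {0..T} t *\<^sub>R (norm (f t - g t))\<^sup>2)"
      by (auto simp: indicator_def)
    finally show "set_borel_measurable lborel {0..T} (\<lambda>t. (norm (f t - g t))\<^sup>2)"
      by (simp only: set_borel_measurable_def)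
    have "(norm (a - b))\<^sup>2 \<le> 2 * (norm a)\<^sup>2 + 2 * (norm b)\<^sup>2" for a b :: L2
    proof -
      have "(norm (a - b))\<^sup>2 \<le> (norm a + norm b)\<^sup>2"
        by (intro power_mono norm_triangle_ineq4) auto
      also have "\<dots> \<le> 2 * (norm a)\<^sup>2 + 2 * (norm b)\<^sup>2"
        using sum_squares_bound[of "norm a" "norm b"] by (simp add: power2_sum)
      finally show ?thesis .
    qed
    then show "AE t in lborel. t \<in> {0..T} \<longrightarrow> norm ((norm (f t - g t))\<^sup>2) \<le> norm (2 * (norm (f t))\<^sup>2 + 2 * (norm (g t))\<^sup>2)"
      by simp
  qed
qed

lemma L2_path_continuous:
  assumes "continuous_on {0..T} f"
  shows "L2_path T f"
proof -
  have "continuous_on {0..T} (\<lambda>t. (norm (f t))\<^sup>2)"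
    by (intro continuous_intros assms)
  then show ?thesis
    unfolding L2_path_def set_borel_measurable_def
    using borel_measurable_continuous_on_indicator[OF _ assms] borel_integrable_atLeastAtMost' by auto
qed

text \<open>For every d > 0 a nonnegative number a satisfies a \<le> d + a^2 / d, by comparing a
  with d. Integrating this bounds the integral of the norm by that of its square plus an arbitrarily
  small term.\<close>

lemma integral_norm_tendsto_0:
  assumes T: "T > 0" and h: "\<And>k. L2_path T (h k)"
    and lim: "(\<lambda>k. LINT t:{0..T}|lborel. (norm (h k t))\<^sup>2) \<longlonglongrightarrow> 0"
  shows "(\<lambda>k. LINT t:{0..T}|lborel. norm (h k t)) \<longlonglongrightarrow> 0"
proof (rule LIMSEQ_I)
  fix e :: real assume e: "e > 0"
  \<comment> \<open>Chosen so that the constant \<open>d\<close> integrates to \<open>e / 2\<close>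
    over [0,T].\<close>
  define d where "d = e / (2 * T)"
  have d: "d > 0" using e T by (simp add: d_def)
  have le: "(LINT t:{0..T}|lborel. norm (h k t)) \<le> e / 2 + (LINT t:{0..T}|lborel. (norm (h k t))\<^sup>2) / d" for k
  proof -
    have sq: "set_integrable lborel {0..T} (\<lambda>t. (norm (h k t))\<^sup>2)"
      using h[of k] by (simp add: L2_path_def)
    have const: "set_integrable lborel {0..T} (\<lambda>t. d)"
      by (intro borel_integrable_atLeastAtMost' continuous_intros)
    have "(LINT t:{0..T}|lborel. norm (h k t)) \<le> (LINT t:{0..T}|lborel. d + (norm (h k t))\<^sup>2 / d)"
    proof (rule set_integral_mono)
      show "norm (h k t) \<le> d + (norm (h k t))\<^sup>2 / d" for t
      proof (cases "norm (h k t) \<le> d")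
        case True
        moreover have "0 \<le> (norm (h k t))\<^sup>2 / d" using d by simp
        ultimately show ?thesis by linarith
      next
        case False
        then have "norm (h k t) * d \<le> norm (h k t) * norm (h k t)" by (intro mult_left_mono) auto
        then have "norm (h k t) \<le> (norm (h k t))\<^sup>2 / d"
          using d by (simp add: pos_le_divide_eq power2_eq_square)
        then show ?thesis using d by linarith
      qed
    qed (intro set_integrable_norm L2_path_set_integrable h set_integral_add(1) const set_integrable_divide sq)+
    also have "\<dots> = (LINT t:{0..T}|lborel. d) + (LINT t:{0..T}|lborel. (norm (h k t))\<^sup>2) / d"
      using const sq by (subst set_integral_add(2)) auto
    also have "(LINT t:{0..T}|lborel. d) = e / 2"
      using T set_integral_const[of "{0..T}" lborel d] by (simp add: d_def)
    finally show ?thesis .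
  qed
  have "e / 2 * d > 0" using e d by simp
  from LIMSEQ_D[OF lim this] obtain N where
    N: "\<And>k. k \<ge> N \<Longrightarrow> norm ((LINT t:{0..T}|lborel. (norm (h k t))\<^sup>2) - 0) < e / 2 * d" by blast
  show "\<exists>N. \<forall>k\<ge>N. norm ((LINT t:{0..T}|lborel. norm (h k t)) - 0) < e"
  proof (intro exI[of _ N] allI impI)
    fix k assume "k \<ge> N"
    then have "(LINT t:{0..T}|lborel. (norm (h k t))\<^sup>2) < e / 2 * d" using N[of k] by simp
    then have "(LINT t:{0..T}|lborel. (norm (h k t))\<^sup>2) / d < e / 2" using d by (simp add: pos_divide_less_eq)
    moreover have "0 \<le> (LINT t:{0..T}|lborel. norm (h k t))"
      unfolding set_lebesgue_integral_def by (intro integral_nonneg_AE) auto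
    moreover have "(LINT t:{0..T}|lborel. norm (h k t)) < e"
      using le[of k] calculation by linarith
    ultimately show "norm ((LINT t:{0..T}|lborel. norm (h k t)) - 0) < e"
      by (simp only: diff_0_right real_norm_def abs_of_nonneg)
  qed
qed

text \<open>The distance of \<open>G\<close> to its mean is at most twice its distance to any
  constant, in the integral norm. Convergence of the constants \<open>c k\<close> need not be known
  in advance, which matters because they arise as values of approximants at time 0, where an
  integral norm gives no control.\<close>

lemma constant_if_L1_limit_of_constants:
  fixes G :: "real \<Rightarrow> real"
  assumes T: "T > 0" and G: "continuous_on {0..T} G"
    and lim: "(\<lambda>k. LINT t:{0..T}|lborel. \<bar>G t - c k\<bar>) \<longlonglongrightarrow> 0" and t: "t \<in> {0..T}"
  shows "G t = G 0"
proof -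
  define m where "m = integral {0..T} G / T"
  have LI: "(LINT t:{0..T}|lborel. \<bar>G t - b\<bar>) = integral {0..T} (\<lambda>t. \<bar>G t - b\<bar>)" for b
    by (intro set_borel_integral_eq_integral borel_integrable_atLeastAtMost' continuous_intros G)
  have le: "integral {0..T} (\<lambda>t. \<bar>G t - m\<bar>) \<le> 2 * integral {0..T} (\<lambda>t. \<bar>G t - c k\<bar>)" for k
  proof -
    have "T * \<bar>m - c k\<bar> = \<bar>integral {0..T} (\<lambda>t. G t - c k)\<bar>"
    proof -
      have "integral {0..T} (\<lambda>t. G t - c k) = T * (m - c k)"
        using T by (subst Henstock_Kurzweil_Integration.integral_diff)
          (auto intro!: integrable_continuous_real G simp: m_def field_simps)
      then show ?thesis using T by (simp add: abs_mult)
    qed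
    also have "\<dots> \<le> integral {0..T} (\<lambda>t. \<bar>G t - c k\<bar>)"
    proof -
      have "norm (integral {0..T} (\<lambda>t. G t - c k)) \<le> integral {0..T} (\<lambda>t. \<bar>G t - c k\<bar>)"
        by (intro integral_norm_bound_integral integrable_continuous_real continuous_intros G) auto
      then show ?thesis by simp
    qed
    finally have *: "T * \<bar>c k - m\<bar> \<le> integral {0..T} (\<lambda>t. \<bar>G t - c k\<bar>)"
      by (simp add: abs_minus_commute)
    have "integral {0..T} (\<lambda>t. \<bar>G t - m\<bar>) \<le> integral {0..T} (\<lambda>t. \<bar>G t - c k\<bar> + \<bar>c k - m\<bar>)"
      by (intro integral_le integrable_continuous_real continuous_intros G) auto
    also have "\<dots> = integral {0..T} (\<lambda>t. \<bar>G t - c k\<bar>) + T * \<bar>c k - m\<bar>"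
      using T by (subst Henstock_Kurzweil_Integration.integral_add)
        (auto intro!: integrable_continuous_real continuous_intros G)
    finally show ?thesis using * by linarith
  qed
  have "(\<lambda>k. 2 * integral {0..T} (\<lambda>t. \<bar>G t - c k\<bar>)) \<longlonglongrightarrow> 2 * 0"
    using lim unfolding LI by (intro tendsto_intros)
  then have "integral {0..T} (\<lambda>t. \<bar>G t - m\<bar>) \<le> 2 * 0"
    by (rule LIMSEQ_le_const) (use le in blast)
  moreover have "0 \<le> integral {0..T} (\<lambda>t. \<bar>G t - m\<bar>)"
    by (intro integral_nonneg integrable_continuous_real continuous_intros G) auto
  ultimately have "integral {0..T} (\<lambda>t. \<bar>G t - m\<bar>) = 0" by linarith
  then have "\<forall>t\<in>{0..T}. \<bar>G t - m\<bar> = 0"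
    using T by (subst (asm) integral_eq_0_iff) (auto intro!: continuous_intros G)
  then show ?thesis using t T by auto
qed

text \<open>Turns the time derivative \<open>v\<close>, given only through approximation, into an
  actual derivative of the coefficients of the continuous representative \<open>z\<close>.\<close>

lemma W12_limit_inner_time:
  assumes W: "W12_limit T z v w1 w2" and T: "T > 0" and t: "t \<in> {0..T}" and i: "i \<ge> 1"
  shows "inner (z t) (sin_basis i) = inner (z 0) (sin_basis i) + (LINT s:{0..t}|lborel. inner (v s) (sin_basis i))"
proof -
  obtain f where f: "\<And>k. smooth_fun2 (f k)"
    and lim: "(\<lambda>k. LINT t:{0..T}|lborel.
          (norm (abs_L2 (f k t) - z t))\<^sup>2
        + (norm (abs_L2 (partial_t (f k) t) - v t))\<^sup>2
        + (norm (abs_L2 (partial_xi (f k) t) - w1 t))\<^sup>2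
        + (norm (abs_L2 (partial_xi (partial_xi (f k)) t) - w2 t))\<^sup>2) \<longlonglongrightarrow> 0"
    and z: "continuous_on {0..T} z" and v: "L2_path T v" and w: "L2_path T w1" "L2_path T w2"
    using W unfolding W12_limit_def by blast
  have path: "L2_path T (\<lambda>t. abs_L2 (g t))" if "smooth_fun2 g" for g
    by (intro L2_path_continuous continuous_abs_L2_slice smooth_fun2_continuous that)
  note pt = smooth_fun2_partials[of _ partial_t, simplified] and px = smooth_fun2_partials[of _ partial_xi, simplified]
  note paths = L2_path_diff[OF path[OF f] L2_path_continuous[OF z]] L2_path_diff[OF path[OF pt[OF f]] v]
    L2_path_diff[OF path[OF px[OF f]] w(1)] L2_path_diff[OF path[OF px[OF px[OF f]]] w(2)]
  note sq = paths[unfolded L2_path_def, THEN conjunct2]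
  have int_total: "set_integrable lborel {0..T} (\<lambda>t. (norm (abs_L2 (f k t) - z t))\<^sup>2
        + (norm (abs_L2 (partial_t (f k) t) - v t))\<^sup>2
        + (norm (abs_L2 (partial_xi (f k) t) - w1 t))\<^sup>2
        + (norm (abs_L2 (partial_xi (partial_xi (f k)) t) - w2 t))\<^sup>2)" for k
    by (intro set_integral_add(1) sq)
  have nonneg: "0 \<le> (LINT t:{0..T}|lborel. (norm (h t))\<^sup>2)" for h :: "real \<Rightarrow> L2"
    unfolding set_lebesgue_integral_def by (intro integral_nonneg_AE) auto
  have "(\<lambda>k. LINT t:{0..T}|lborel. (norm (abs_L2 (f k t) - z t))\<^sup>2) \<longlonglongrightarrow> 0"
  proof (rule tendsto_sandwich[OF _ _ tendsto_const lim])
    show "\<forall>\<^sub>F k in sequentially. 0 \<le> (LINT t:{0..T}|lborel. (norm (abs_L2 (f k t) - z t))\<^sup>2)"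
      by (intro always_eventually allI nonneg)
    show "\<forall>\<^sub>F k in sequentially. (LINT t:{0..T}|lborel. (norm (abs_L2 (f k t) - z t))\<^sup>2) \<le> (LINT t:{0..T}|lborel. (norm (abs_L2 (f k t) - z t))\<^sup>2
        + (norm (abs_L2 (partial_t (f k) t) - v t))\<^sup>2
        + (norm (abs_L2 (partial_xi (f k) t) - w1 t))\<^sup>2
        + (norm (abs_L2 (partial_xi (partial_xi (f k)) t) - w2 t))\<^sup>2)"
      by (intro always_eventually allI set_integral_mono sq(1) int_total) simp
  qed
  from integral_norm_tendsto_0[OF T paths(1) this]
  have lim_z: "(\<lambda>k. LINT t:{0..T}|lborel. norm (abs_L2 (f k t) - z t)) \<longlonglongrightarrow> 0" .
  have "(\<lambda>k. LINT t:{0..T}|lborel. (norm (abs_L2 (partial_t (f k) t) - v t))\<^sup>2) \<longlonglongrightarrow> 0"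
  proof (rule tendsto_sandwich[OF _ _ tendsto_const lim])
    show "\<forall>\<^sub>F k in sequentially. 0 \<le> (LINT t:{0..T}|lborel. (norm (abs_L2 (partial_t (f k) t) - v t))\<^sup>2)"
      by (intro always_eventually allI nonneg)
    show "\<forall>\<^sub>F k in sequentially. (LINT t:{0..T}|lborel. (norm (abs_L2 (partial_t (f k) t) - v t))\<^sup>2) \<le> (LINT t:{0..T}|lborel. (norm (abs_L2 (f k t) - z t))\<^sup>2
        + (norm (abs_L2 (partial_t (f k) t) - v t))\<^sup>2
        + (norm (abs_L2 (partial_xi (f k) t) - w1 t))\<^sup>2
        + (norm (abs_L2 (partial_xi (partial_xi (f k)) t) - w2 t))\<^sup>2)"
      by (intro always_eventually allI set_integral_mono sq(2) int_total) simp
  qed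
  from integral_norm_tendsto_0[OF T paths(2) this]
  have lim_v: "(\<lambda>k. LINT t:{0..T}|lborel. norm (abs_L2 (partial_t (f k) t) - v t)) \<longlonglongrightarrow> 0" .
  \<comment> \<open>For a smooth approximant the corresponding difference is the constant
    \<open>c k\<close>, so \<open>G\<close> is a limit of constants; being continuous, it is
    constant.\<close>
  define G where "G t = inner (z t) (sin_basis i) - (LINT s:{0..t}|lborel. inner (v s) (sin_basis i))" for t
  define c where "c k = inner (abs_L2 (f k 0)) (sin_basis i)" for k
  have vi: "set_integrable lborel {0..T} (\<lambda>s. inner (v s) (sin_basis i))"
    by (rule heat_integrand(2)[OF L2_path_set_integrable[OF v] i])
  have G: "continuous_on {0..T} G"
    unfolding G_def by (intro continuous_intros z continuous_set_integral_initial vi)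
  have bound: "\<bar>G t - c k\<bar> \<le> norm (abs_L2 (f k t) - z t)
      + (LINT t:{0..T}|lborel. norm (abs_L2 (partial_t (f k) t) - v t))" if t: "t \<in> {0..T}" for t k
  proof -
    let ?h = "\<lambda>s. abs_L2 (partial_t (f k) s) - v s"
    have hi: "set_integrable lborel {0..T} ?h"
      by (rule L2_path_set_integrable[OF paths(2)])
    have pi: "set_integrable lborel {0..T} (\<lambda>s. inner (abs_L2 (partial_t (f k) s)) (sin_basis i))"
      by (rule heat_integrand(2)[OF L2_path_set_integrable[OF path[OF pt[OF f]]] i])
    have "inner (abs_L2 (f k t) - z t) (sin_basis i) - (c k - G t)
        = (LINT s:{0..t}|lborel. inner (abs_L2 (partial_t (f k) s)) (sin_basis i)) - (LINT s:{0..t}|lborel. inner (v s) (sin_basis i))"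
      using smooth_fun2_inner_time[OF f, of t k i] t by (simp add: G_def c_def inner_diff_left)
    also have "\<dots> = (LINT s:{0..t}|lborel. inner (?h s) (sin_basis i))"
      using set_integrable_initial[OF pi t] set_integrable_initial[OF vi t]
      by (simp add: inner_diff_left set_integral_diff)
    finally have "G t - c k = (LINT s:{0..t}|lborel. inner (?h s) (sin_basis i)) - inner (abs_L2 (f k t) - z t) (sin_basis i)"
      by simp
    moreover have "\<bar>inner (abs_L2 (f k t) - z t) (sin_basis i)\<bar> \<le> norm (abs_L2 (f k t) - z t)"
      using Cauchy_Schwarz_ineq2[of "abs_L2 (f k t) - z t" "sin_basis i"] by (simp add: norm_sin_basis[OF i])
    moreover have "\<bar>LINT s:{0..t}|lborel. inner (?h s) (sin_basis i)\<bar> \<le> (LINT s:{0..T}|lborel. norm (?h s))"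
    proof -
      have ii: "set_integrable lborel {0..t} (\<lambda>s. inner (?h s) (sin_basis i))"
        by (rule heat_integrand(2)[OF set_integrable_initial[OF hi t] i])
      have "norm (LINT s:{0..t}|lborel. inner (?h s) (sin_basis i)) \<le> (LINT s:{0..t}|lborel. norm (inner (?h s) (sin_basis i)))"
        by (rule set_integral_norm_bound[OF ii])
      also have "\<dots> \<le> (LINT s:{0..t}|lborel. norm (?h s))"
      proof (rule set_integral_mono[OF set_integrable_norm[OF ii] set_integrable_norm[OF set_integrable_initial[OF hi t]]])
        show "norm (inner (?h s) (sin_basis i)) \<le> norm (?h s)" for s
          using Cauchy_Schwarz_ineq2[of "?h s" "sin_basis i"] by (simp add: norm_sin_basis[OF i])
      qed
      also have "\<dots> \<le> (LINT s:{0..T}|lborel. norm (?h s))"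
        unfolding set_lebesgue_integral_def
        using set_integrable_norm[OF set_integrable_initial[OF hi t]] set_integrable_norm[OF hi] t
        by (intro integral_mono) (auto simp: set_integrable_def indicator_def)
      finally show ?thesis by simp
    qed
    ultimately show ?thesis by linarith
  qed
  have "(\<lambda>k. LINT t:{0..T}|lborel. \<bar>G t - c k\<bar>) \<longlonglongrightarrow> 0"
  proof (rule tendsto_sandwich[OF _ _ tendsto_const])
    let ?r = "\<lambda>k. LINT t:{0..T}|lborel. norm (abs_L2 (partial_t (f k) t) - v t)"
    have zi: "set_integrable lborel {0..T} (\<lambda>t. norm (abs_L2 (f k t) - z t))" for k
      by (intro set_integrable_norm L2_path_set_integrable paths)
    have const: "set_integrable lborel {0..T} (\<lambda>t. b)" for b :: real
      by (intro borel_integrable_atLeastAtMost' continuous_intros)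
    have "(LINT t:{0..T}|lborel. \<bar>G t - c k\<bar>) \<le> (LINT t:{0..T}|lborel. norm (abs_L2 (f k t) - z t)) + T * ?r k" for k
    proof -
      have "(LINT t:{0..T}|lborel. \<bar>G t - c k\<bar>) \<le> (LINT t:{0..T}|lborel. norm (abs_L2 (f k t) - z t) + ?r k)"
        by (intro set_integral_mono set_integral_add(1) zi const bound borel_integrable_atLeastAtMost' continuous_intros G)
      also have "\<dots> = (LINT t:{0..T}|lborel. norm (abs_L2 (f k t) - z t)) + T * ?r k"
        using T set_integral_const[of "{0..T}" lborel "?r k"] by (subst set_integral_add(2)[OF zi const]) simp
      finally show ?thesis .
    qed
    then show "\<forall>\<^sub>F k in sequentially. (LINT t:{0..T}|lborel. \<bar>G t - c k\<bar>)
        \<le> (LINT t:{0..T}|lborel. norm (abs_L2 (f k t) - z t)) + T * ?r k"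
      by (intro always_eventually allI)
    show "\<forall>\<^sub>F k in sequentially. 0 \<le> (LINT t:{0..T}|lborel. \<bar>G t - c k\<bar>)"
      unfolding set_lebesgue_integral_def by (intro always_eventually allI integral_nonneg_AE) auto
    show "(\<lambda>k. (LINT t:{0..T}|lborel. norm (abs_L2 (f k t) - z t)) + T * ?r k) \<longlonglongrightarrow> 0"
      using tendsto_add[OF lim_z tendsto_mult_left[OF lim_v, of T]] by simp
  qed
  from constant_if_L1_limit_of_constants[OF T G this t] have "G t = G 0" .
  moreover have "(LINT s:{0..0}|lborel. inner (v s) (sin_basis i)) = integral {0..0} (\<lambda>s. inner (v s) (sin_basis i))"
    using T by (intro set_borel_integral_eq_integral(2) set_integrable_initial[OF vi]) simp
  ultimately show ?thesis
    unfolding G_def integral_refl[of 0, unfolded box_real] by simp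
qed


section \<open>Fixed points in exponentially weighted norms\<close>

text \<open>Banach's fixed point argument for the norm with weight exp(- K t), phrased through
  pointwise bounds. Successive differences of iterates shrink by the factor 1/2, so the limit lies
  within 2 \<delta> of the starting path.\<close>

lemma weighted_picard:
  fixes \<Phi> :: "(real \<Rightarrow> 'a::banach) \<Rightarrow> real \<Rightarrow> 'a"
  assumes K: "K \<ge> 0" and \<delta>: "\<delta> \<ge> 0"
    and cont: "\<And>w. continuous_on {0..T} w \<Longrightarrow> continuous_on {0..T} (\<Phi> w)"
    and contr: "\<And>w1 w2 M t. continuous_on {0..T} w1 \<Longrightarrow> continuous_on {0..T} w2 \<Longrightarrow> M \<ge> 0 \<Longrightarrow>
      (\<And>s. s \<in> {0..T} \<Longrightarrow> norm (w1 s - w2 s) \<le> M * exp (K * s)) \<Longrightarrow> t \<in> {0..T} \<Longrightarrow>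
      norm (\<Phi> w1 t - \<Phi> w2 t) \<le> M / 2 * exp (K * t)"
    and z: "continuous_on {0..T} z"
    and start: "\<And>t. t \<in> {0..T} \<Longrightarrow> norm (\<Phi> z t - z t) \<le> \<delta> * exp (K * t)"
  obtains w where "continuous_on {0..T} w" "\<And>t. t \<in> {0..T} \<Longrightarrow> \<Phi> w t = w t"
    "\<And>t. t \<in> {0..T} \<Longrightarrow> norm (w t - z t) \<le> 2 * \<delta> * exp (K * t)"
proof -
  define W where "W n = (\<Phi> ^^ n) z" for n
  have W_Suc: "W (Suc n) = \<Phi> (W n)" and W_0: "W 0 = z" for n
    by (simp_all add: W_def)
  have Wc: "continuous_on {0..T} (W n)" for n
    by (induction n) (auto simp: W_0 W_Suc z cont)
  have step: "norm (W (Suc n) t - W n t) \<le> \<delta> / 2 ^ n * exp (K * t)" if "t \<in> {0..T}" for n t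
    using that
  proof (induction n arbitrary: t)
    case 0
    then show ?case using start by (simp add: W_0 W_Suc)
  next
    case (Suc n)
    have "norm (\<Phi> (W (Suc n)) t - \<Phi> (W n) t) \<le> \<delta> / 2 ^ n / 2 * exp (K * t)"
      by (rule contr[OF Wc Wc _ Suc.IH Suc.prems]) (use \<delta> in auto)
    then show ?case by (simp add: W_Suc field_simps)
  qed
  have geom: "(\<lambda>n. \<delta> / 2 ^ n * b) sums (2 * \<delta> * b)" for b
  proof -
    have "(\<lambda>n. (1/2::real) ^ n) sums 2"
      using geometric_sums[of "1/2::real"] by simp
    then have "(\<lambda>n. \<delta> * b * (1/2) ^ n) sums (\<delta> * b * 2)"
      by (rule sums_mult)
    also have "(\<lambda>n. \<delta> * b * (1/2) ^ n) = (\<lambda>n. \<delta> / 2 ^ n * b)"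
      by (simp add: power_one_over)
    also have "\<delta> * b * 2 = 2 * \<delta> * b" by simp
    finally show ?thesis .
  qed
  define S where "S t = (\<Sum>n. W (Suc n) t - W n t)" for t
  have tele: "(\<Sum>i<n. W (Suc i) t - W i t) = W n t - z t" for n t
    using sum_lessThan_telescope[of "\<lambda>i. W i t" n] by (simp add: W_0)
  have unif: "uniform_limit {0..T} (\<lambda>n t. \<Sum>i<n. W (Suc i) t - W i t) S sequentially"
    unfolding S_def
  proof (rule Weierstrass_m_test)
    show "summable (\<lambda>n. \<delta> / 2 ^ n * exp (K * T))"
      using geom sums_summable by blast
    show "norm (W (Suc n) t - W n t) \<le> \<delta> / 2 ^ n * exp (K * T)" if t: "t \<in> {0..T}" for n t
    proof -
      have "\<delta> / 2 ^ n * exp (K * t) \<le> \<delta> / 2 ^ n * exp (K * T)"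
        using K \<delta> t by (intro mult_left_mono) (auto intro: mult_left_mono)
      with step[OF t, of n] show ?thesis by linarith
    qed
  qed
  define w where "w t = z t + S t" for t
  have "continuous_on {0..T} S"
    by (rule uniform_limit_theorem[OF always_eventually unif])
      (auto simp: tele intro!: continuous_intros Wc z)
  then have wc: "continuous_on {0..T} w"
    unfolding w_def by (intro continuous_intros z)
  have lim: "(\<lambda>n. W n t) \<longlonglongrightarrow> w t" if "t \<in> {0..T}" for t
    using tendsto_add[OF tendsto_const[of "z t"] tendsto_uniform_limitI[OF unif that]]
    by (simp add: tele w_def)
  have tail: "norm (w t - W n t) \<le> 2 * (\<delta> / 2 ^ n) * exp (K * t)" if t: "t \<in> {0..T}" for t n
  proof (rule LIMSEQ_le_const2)
    show "(\<lambda>m. norm (W (m + n) t - W n t)) \<longlonglongrightarrow> norm (w t - W n t)"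
      by (intro tendsto_intros LIMSEQ_ignore_initial_segment lim t)
    have "norm (W (m + n) t - W n t) \<le> 2 * (\<delta> / 2 ^ n) * exp (K * t)" for m
    proof -
      \<comment> \<open>The partial geometric sum is kept exactly, since the bound without the
        factor \<open>1 - 1 / 2 ^ m\<close> would not reproduce itself in the induction.\<close>
      have "norm (W (m + n) t - W n t) \<le> 2 * (\<delta> / 2 ^ n) * (1 - 1 / 2 ^ m) * exp (K * t)"
      proof (induction m)
        case (Suc m)
        have "norm (W (Suc m + n) t - W n t)
            \<le> norm (W (Suc (m + n)) t - W (m + n) t) + norm (W (m + n) t - W n t)"
          using norm_triangle_ineq[of "W (Suc (m + n)) t - W (m + n) t" "W (m + n) t - W n t"] by simp
        also have "\<dots> \<le> \<delta> / 2 ^ (m + n) * exp (K * t) + 2 * (\<delta> / 2 ^ n) * (1 - 1 / 2 ^ m) * exp (K * t)"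
          using step[OF t, of "m + n"] Suc by linarith
        also have "\<dots> = 2 * (\<delta> / 2 ^ n) * (1 - 1 / 2 ^ Suc m) * exp (K * t)"
          by (simp add: power_add field_simps)
        finally show ?case .
      qed simp
      also have "\<dots> \<le> 2 * (\<delta> / 2 ^ n) * 1 * exp (K * t)"
        using \<delta> by (intro mult_right_mono mult_left_mono) auto
      finally show ?thesis by simp
    qed
    then show "\<exists>N. \<forall>m\<ge>N. norm (W (m + n) t - W n t) \<le> 2 * (\<delta> / 2 ^ n) * exp (K * t)" by blast
  qed
  show thesis
  proof (rule that[OF wc])
    fix t assume t: "t \<in> {0..T}"
    show "norm (w t - z t) \<le> 2 * \<delta> * exp (K * t)"
      using tail[OF t, of 0] by (simp add: W_0)
    have le: "norm (\<Phi> w t - W (Suc n) t) \<le> \<delta> / 2 ^ n * exp (K * t)" for n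
    proof -
      have "norm (\<Phi> w t - \<Phi> (W n) t) \<le> 2 * (\<delta> / 2 ^ n) / 2 * exp (K * t)"
        by (rule contr[OF wc Wc _ tail t]) (use \<delta> in auto)
      then show ?thesis by (simp add: W_Suc)
    qed
    have "(\<lambda>n. norm (\<Phi> w t - W (Suc n) t)) \<longlonglongrightarrow> 0"
      by (rule tendsto_sandwich[OF _ _ tendsto_const summable_LIMSEQ_zero[OF sums_summable[OF geom[of "exp (K * t)"]]]])
        (intro always_eventually allI norm_ge_zero le)+
    moreover have "(\<lambda>n. norm (\<Phi> w t - W (Suc n) t)) \<longlonglongrightarrow> norm (\<Phi> w t - w t)"
      by (intro tendsto_intros LIMSEQ_Suc lim t)
    ultimately have "norm (\<Phi> w t - w t) = 0"
      using LIMSEQ_unique by blast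
    then show "\<Phi> w t = w t" by simp
  qed
qed

section \<open>Uniform convergence of projections and the perturbed path\<close>

text \<open>Pointwise convergence on a finite net suffices because all projections are contractions;
  thirds of \<open>e\<close> pay for the net point and for two displacements.\<close>

lemma galerkin_proj_uniform_on_compact:
  assumes "compact C" "e > 0"
  shows "\<forall>\<^sub>F n in sequentially. \<forall>u\<in>C. norm (galerkin_proj n u - u) < e"
proof -
  have "C \<subseteq> (\<Union>c\<in>C. ball c (e / 3))" using assms(2) by auto
  then obtain D where D: "D \<subseteq> C" "finite D" "C \<subseteq> (\<Union>c\<in>D. ball c (e / 3))"
    by (rule compactE_image[OF assms(1), of C "\<lambda>c. ball c (e / 3)", rotated]) auto
  have "\<forall>\<^sub>F n in sequentially. \<forall>c\<in>D. dist (galerkin_proj n c) c < e / 3"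
    using D(2) assms(2) galerkin_proj_tendsto
    by (intro eventually_ball_finite ballI tendstoD) auto
  then show ?thesis
  proof (rule eventually_mono, intro ballI)
    fix n u assume n: "\<forall>c\<in>D. dist (galerkin_proj n c) c < e / 3" and "u \<in> C"
    then obtain c where c: "c \<in> D" "norm (c - u) < e / 3"
      using D(3) by (auto simp: dist_norm)
    have "galerkin_proj n u - u = (galerkin_proj n c - c) + (c - u) - galerkin_proj n (c - u)"
      by (simp add: galerkin_proj_diff)
    also have "norm \<dots> \<le> norm (galerkin_proj n c - c) + norm (c - u) + norm (galerkin_proj n (c - u))"
      by (intro order_trans[OF norm_triangle_ineq4] add_right_mono norm_triangle_ineq)
    also have "\<dots> < e"
      using n c norm_galerkin_proj_le[of n "c - u"] by (fastforce simp: dist_norm)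
    finally show "norm (galerkin_proj n u - u) < e" .
  qed
qed

lemma lipschitz_continuous_on:
  fixes F :: "L2 \<Rightarrow> L2"
  assumes F: "\<And>u v. norm (F u - F v) \<le> L_F * norm (u - v)" and z: "continuous_on S z"
  shows "continuous_on S (\<lambda>s. F (z s))"
proof -
  have "\<bar>L_F\<bar>-lipschitz_on UNIV F"
  proof (rule lipschitz_onI)
    fix u v :: L2
    have "L_F * norm (u - v) \<le> \<bar>L_F\<bar> * norm (u - v)"
      by (intro mult_right_mono) auto
    then show "dist (F u) (F v) \<le> \<bar>L_F\<bar> * dist u v"
      using F[of u v] by (simp add: dist_norm)
  qed simp
  then have "continuous_on UNIV F" by (rule lipschitz_on_continuous_on)
  then show ?thesis by (rule continuous_on_compose2[OF _ z]) simp
qed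

text \<open>The path \<open>w\<close> solves the Galerkin equation driven by the same control as \<open>z\<close>: subtracting the
  projected mild formulation of \<open>z\<close> removes both the initial value and the control.\<close>

lemma galerkin_perturbation:
  fixes F :: "L2 \<Rightarrow> L2"
  assumes F: "\<And>u v. norm (F u - F v) \<le> L_F * norm (u - v)" and L_F: "L_F > 0"
    and z: "continuous_on {0..T} z"
    and \<delta>: "\<And>t. t \<in> {0..T} \<Longrightarrow> norm (galerkin_proj n (z t) - z t) \<le> \<delta>" and "\<delta> \<ge> 0"
  obtains w where "continuous_on {0..T} w" "\<And>t. t \<in> {0..T} \<Longrightarrow> w t = galerkin_proj n (z t)
      + (LINT s:{0..t}|lborel. heat_semigroup (t - s) (galerkin_proj n (F (w s) - F (z s))))"
    "\<And>t. t \<in> {0..T} \<Longrightarrow> norm (w t - z t) \<le> 2 * \<delta> * exp (2 * L_F * T)"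
proof -
  let ?h = "\<lambda>w s. galerkin_proj n (F (w s) - F (z s))"
  define \<Phi> where "\<Phi> w t = galerkin_proj n (z t) + (LINT s:{0..t}|lborel. heat_semigroup (t - s) (?h w s))"
    for w t
  have hc: "continuous_on {0..T} (?h w)" if "continuous_on {0..T} w" for w
    by (intro bounded_linear.continuous_on[OF bounded_linear_galerkin_proj] continuous_intros
        lipschitz_continuous_on[OF F] that z)
  have hi: "set_integrable lborel {0..T} (?h w)" if "continuous_on {0..T} w" for w
    by (intro borel_integrable_atLeastAtMost' hc that)
  obtain w where w: "continuous_on {0..T} w" "\<And>t. t \<in> {0..T} \<Longrightarrow> \<Phi> w t = w t"
    "\<And>t. t \<in> {0..T} \<Longrightarrow> norm (w t - z t) \<le> 2 * \<delta> * exp (2 * L_F * t)"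
  \<comment> \<open>The rate \<open>2 * L_F\<close> is the one for which integrating L_F M exp(2 L_F
    s) over [0,t] leaves at most M / 2 times the weight at t.\<close>
  proof (rule weighted_picard[of "2 * L_F" \<delta> T \<Phi> z])
    show "continuous_on {0..T} (\<Phi> w)" if "continuous_on {0..T} w" for w
      unfolding \<Phi>_def
      by (intro continuous_intros bounded_linear.continuous_on[OF bounded_linear_galerkin_proj] z
          galerkin_heat_integral(2)[OF hi[OF that] galerkin_proj_in_space])
  next
    fix w1 w2 :: "real \<Rightarrow> L2" and M t :: real
    assume w: "continuous_on {0..T} w1" "continuous_on {0..T} w2" and M: "M \<ge> 0"
      and le: "\<And>s. s \<in> {0..T} \<Longrightarrow> norm (w1 s - w2 s) \<le> M * exp (2 * L_F * s)" and t: "t \<in> {0..T}"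
    let ?d = "\<lambda>s. galerkin_proj n (F (w1 s) - F (w2 s))"
    have di: "set_integrable lborel {0..t} ?d"
    proof (rule set_integrable_initial[OF borel_integrable_atLeastAtMost' t])
      show "continuous_on {0..T} ?d"
        by (intro bounded_linear.continuous_on[OF bounded_linear_galerkin_proj] continuous_intros
            lipschitz_continuous_on[OF F] w)
    qed
    have "\<Phi> w1 t - \<Phi> w2 t = (LINT s:{0..t}|lborel. heat_semigroup (t - s) (?h w1 s) - heat_semigroup (t - s) (?h w2 s))"
      unfolding \<Phi>_def
      by (subst set_integral_diff(2)) (auto intro!: heat_integrand(1)[OF _ le_refl] set_integrable_initial[OF hi t] w)
    also have "\<dots> = (LINT s:{0..t}|lborel. heat_semigroup (t - s) (?d s))"
    proof (intro set_lebesgue_integral_cong allI impI)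
      fix s assume "s \<in> {0..t}"
      then show "heat_semigroup (t - s) (?h w1 s) - heat_semigroup (t - s) (?h w2 s) = heat_semigroup (t - s) (?d s)"
        by (intro L2_eqI) (simp add: inner_diff_left inner_heat_semigroup inner_galerkin_proj algebra_simps)
    qed simp
    finally have "norm (\<Phi> w1 t - \<Phi> w2 t) \<le> (LINT s:{0..t}|lborel. norm (?d s))"
      using norm_heat_integral_le[OF di] by simp
    also have "\<dots> \<le> (LINT s:{0..t}|lborel. L_F * M * exp (2 * L_F * s))"
    proof (rule set_integral_mono)
      fix s assume "s \<in> {0..t}"
      then have "s \<in> {0..T}" using t by auto
      have "norm (?d s) \<le> L_F * norm (w1 s - w2 s)"
        using norm_galerkin_proj_le F order_trans by blast
      also have "\<dots> \<le> L_F * (M * exp (2 * L_F * s))"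
        using L_F le[OF \<open>s \<in> {0..T}\<close>] by (intro mult_left_mono) auto
      finally show "norm (?d s) \<le> L_F * M * exp (2 * L_F * s)" by (simp add: mult.assoc)
    qed (intro set_integrable_norm di borel_integrable_atLeastAtMost' continuous_intros)+
    also have "\<dots> = M / 2 * exp (2 * L_F * t) - M / 2 * exp (2 * L_F * 0)"
      by (rule set_integral_derivative) (use t in \<open>auto intro!: continuous_intros derivative_eq_intros\<close>)
    also have "\<dots> \<le> M / 2 * exp (2 * L_F * t)" using M by simp
    finally show "norm (\<Phi> w1 t - \<Phi> w2 t) \<le> M / 2 * exp (2 * L_F * t)" .
  next
    fix t assume t: "t \<in> {0..T}"
    \<comment> \<open>Started at \<open>z\<close>, the integral term vanishes, so the initial defect
      is the projection error of \<open>z\<close>.\<close>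
    have "heat_semigroup r 0 = 0" for r
      by (simp add: heat_semigroup_def spectral_apply_def)
    then have "\<Phi> z t = galerkin_proj n (z t)"
      by (simp add: \<Phi>_def galerkin_proj_def)
    moreover have "\<delta> * 1 \<le> \<delta> * exp (2 * L_F * t)"
      using \<open>\<delta> \<ge> 0\<close> L_F t by (intro mult_left_mono) auto
    ultimately show "norm (\<Phi> z t - z t) \<le> \<delta> * exp (2 * L_F * t)"
      using \<delta>[OF t] by simp
  qed (use L_F \<open>\<delta> \<ge> 0\<close> z in auto)
  show thesis
  proof (rule that[OF w(1)])
    fix t assume t: "t \<in> {0..T}"
    show "w t = galerkin_proj n (z t) + (LINT s:{0..t}|lborel. heat_semigroup (t - s) (?h w s))"
      using w(2)[OF t] by (simp add: \<Phi>_def)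
    have "2 * \<delta> * exp (2 * L_F * t) \<le> 2 * \<delta> * exp (2 * L_F * T)"
      using \<open>\<delta> \<ge> 0\<close> L_F t by (intro mult_left_mono) auto
    then show "norm (w t - z t) \<le> 2 * \<delta> * exp (2 * L_F * T)"
      using w(3)[OF t] by linarith
  qed
qed


section \<open>The rate functions\<close>

lemma L2_path_bounded_linear:
  assumes B: "bounded_linear B" and f: "L2_path T f"
  shows "L2_path T (\<lambda>t. B (f t))"
proof -
  obtain C where C: "\<And>u. norm (B u) \<le> norm u * C"
    using bounded_linear.bounded[OF B] by blast
  note lin = bounded_linear.linear[OF B]
  have fm: "(\<lambda>t. indicat_real {0..T} t *\<^sub>R f t) \<in> borel_measurable lborel"
    using f unfolding L2_path_def set_borel_measurable_def by (rule conjunct1)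
  have "B \<in> borel_measurable borel"
    by (intro borel_measurable_continuous_onI linear_continuous_on B)
  from measurable_compose[OF fm this]
  have "(\<lambda>t. B (indicat_real {0..T} t *\<^sub>R f t)) \<in> borel_measurable lborel" .
  then have m: "(\<lambda>t. indicat_real {0..T} t *\<^sub>R B (f t)) \<in> borel_measurable lborel"
    by (simp add: linear_scale[OF lin])
  have "(\<lambda>t. (norm (indicat_real {0..T} t *\<^sub>R B (f t)))\<^sup>2) \<in> borel_measurable lborel"
    using m by measurable
  also have "(\<lambda>t. (norm (indicat_real {0..T} t *\<^sub>R B (f t)))\<^sup>2) = (\<lambda>t. indicat_real {0..T} t *\<^sub>R (norm (B (f t)))\<^sup>2)"
    by (auto simp: indicator_def)
  finally have m2: "set_borel_measurable lborel {0..T} (\<lambda>t. (norm (B (f t)))\<^sup>2)"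
    by (simp only: set_borel_measurable_def)
  have "set_integrable lborel {0..T} (\<lambda>t. (norm (B (f t)))\<^sup>2)"
  proof (rule set_integrable_bound[OF _ m2])
    show "set_integrable lborel {0..T} (\<lambda>t. C\<^sup>2 * (norm (f t))\<^sup>2)"
      using f by (intro set_integrable_mult_right) (simp add: L2_path_def)
    have "(norm (B u))\<^sup>2 \<le> C\<^sup>2 * (norm u)\<^sup>2" for u
      using power_mono[OF C[of u], of 2] by (simp add: power_mult_distrib mult.commute)
    then show "AE t in lborel. t \<in> {0..T} \<longrightarrow> norm ((norm (B (f t)))\<^sup>2) \<le> norm (C\<^sup>2 * (norm (f t))\<^sup>2)"
      by simp
  qed
  with m show ?thesis
    unfolding L2_path_def set_borel_measurable_def by (rule conjI)
qed

lemma L2_path_add: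
  assumes "L2_path T f" "L2_path T g"
  shows "L2_path T (\<lambda>t. f t + g t)"
  using L2_path_diff[OF assms(1) L2_path_bounded_linear[OF bounded_linear_minus[OF bounded_linear_ident] assms(2)]]
  by simp

lemma L2_path_norm_power2_measurable:
  "L2_path T f \<Longrightarrow> (\<lambda>t. indicat_real {0..T} t *\<^sub>R (norm (f t))\<^sup>2) \<in> borel_measurable lborel"
  unfolding L2_path_def set_integrable_def by (elim conjE) (rule borel_measurable_integrable)

lemma set_integral_norm_power2_cong_AE:
  assumes "L2_path T f" "L2_path T g" "AE s in lborel. s \<in> {0..T} \<longrightarrow> f s = g s"
  shows "(LINT t:{0..T}|lborel. (norm (f t))\<^sup>2) = (LINT t:{0..T}|lborel. (norm (g t))\<^sup>2)"
  unfolding set_lebesgue_integral_def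
proof (rule integral_cong_AE)
  show "(\<lambda>t. indicator {0..T} t *\<^sub>R (norm (f t))\<^sup>2) \<in> borel_measurable lborel"
    "(\<lambda>t. indicator {0..T} t *\<^sub>R (norm (g t))\<^sup>2) \<in> borel_measurable lborel"
    using assms(1,2) by (intro L2_path_norm_power2_measurable; simp)+
  show "AE t in lborel. indicator {0..T} t *\<^sub>R (norm (f t))\<^sup>2 = indicator {0..T} t *\<^sub>R (norm (g t))\<^sup>2"
    using assms(3) by (rule eventually_mono) (auto simp: indicator_def)
qed

lemma galerkin_proj_heat_semigroup:
  "t \<ge> 0 \<Longrightarrow> galerkin_proj n (heat_semigroup t u) = heat_semigroup t (galerkin_proj n u)"
  by (rule L2_eqI) (simp add: inner_galerkin_proj inner_heat_semigroup)

lemma galerkin_proj_heat_integral: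
  assumes h: "set_integrable lborel {0..t} h"
  shows "galerkin_proj n (LINT s:{0..t}|lborel. heat_semigroup (t - s) (h s))
    = (LINT s:{0..t}|lborel. heat_semigroup (t - s) (galerkin_proj n (h s)))"
proof -
  have lin: "linear (galerkin_proj n)"
    by (rule bounded_linear.linear[OF bounded_linear_galerkin_proj])
  have "galerkin_proj n (LINT s:{0..t}|lborel. heat_semigroup (t - s) (h s))
      = (\<integral>s. galerkin_proj n (indicator {0..t} s *\<^sub>R heat_semigroup (t - s) (h s)) \<partial>lborel)"
    using heat_integrand(1)[OF h le_refl] unfolding set_lebesgue_integral_def set_integrable_def
    by (rule integral_bounded_linear[OF bounded_linear_galerkin_proj, symmetric])
  also have "\<dots> = (LINT s:{0..t}|lborel. heat_semigroup (t - s) (galerkin_proj n (h s)))"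
    unfolding set_lebesgue_integral_def
    by (intro Bochner_Integration.integral_cong refl)
      (auto simp: indicator_def galerkin_proj_heat_semigroup linear_0[OF lin])
  finally show ?thesis .
qed

section \<open>Evaluation of the rates and construction of the controls\<close>

context diagonal_covariance
begin

lemma forcing_set_integrable:
  fixes F :: "L2 \<Rightarrow> L2"
  assumes "\<And>u v. norm (F u - F v) \<le> L_F * norm (u - v)" "continuous_on {0..T} z" "L2_path T \<phi>"
  shows "set_integrable lborel {0..T} (\<lambda>s. F (z s) + op_sqrt Q (\<phi> s))"
  by (intro L2_path_set_integrable L2_path_add L2_path_continuous lipschitz_continuous_on[OF assms(1)]
      assms L2_path_bounded_linear[OF bounded_linear_op_sqrt])

text \<open>Two controls for \<open>z\<close> have equal heat integrals of their forcing terms, so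
  these agree almost everywhere, and injectivity of the square root of \<open>Q\<close> removes it.
  The infimum is thus that of a constant over a set containing \<phi>.\<close>

lemma rate_eq:
  fixes F :: "L2 \<Rightarrow> L2"
  assumes F: "\<And>u v. norm (F u - F v) \<le> L_F * norm (u - v)"
    and \<phi>: "L2_path T \<phi>" "mild_solution T F Q x \<phi> z"
  shows "rate T F Q x z = ereal (1/2 * (LINT t:{0..T}|lborel. (norm (\<phi> t))\<^sup>2))"
proof -
  have z: "continuous_on {0..T} z" using \<phi>(2) by (simp add: mild_solution_def)
  have same: "(LINT t:{0..T}|lborel. (norm (\<psi> t))\<^sup>2) = (LINT t:{0..T}|lborel. (norm (\<phi> t))\<^sup>2)"
    if \<psi>: "L2_path T \<psi>" "mild_solution T F Q x \<psi> z" for \<psi>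
  proof (rule set_integral_norm_power2_cong_AE[OF \<psi>(1) \<phi>(1)])
    have "AE s in lborel. s \<in> {0..T} \<longrightarrow> F (z s) + op_sqrt Q (\<psi> s) = F (z s) + op_sqrt Q (\<phi> s)"
    proof (rule heat_integral_unique)
      fix t assume t: "t \<in> {0..T}"
      have e: "z t = heat_semigroup t x + (LINT s:{0..t}|lborel. heat_semigroup (t - s) (F (z s) + op_sqrt Q (\<psi> s)))"
        "z t = heat_semigroup t x + (LINT s:{0..t}|lborel. heat_semigroup (t - s) (F (z s) + op_sqrt Q (\<phi> s)))"
        using \<psi>(2) \<phi>(2) t unfolding mild_solution_def by blast+
      show "(LINT s:{0..t}|lborel. heat_semigroup (t - s) (F (z s) + op_sqrt Q (\<psi> s)))
        = (LINT s:{0..t}|lborel. heat_semigroup (t - s) (F (z s) + op_sqrt Q (\<phi> s)))"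
        by (rule add_left_imp_eq[OF trans[OF e(1)[symmetric] e(2)]])
    qed (intro forcing_set_integrable[OF F z] \<phi> \<psi>)+
    then show "AE s in lborel. s \<in> {0..T} \<longrightarrow> \<psi> s = \<phi> s"
      by (rule eventually_mono) (auto dest: injD[OF inj_op_sqrt])
  qed
  have "(INF \<psi>\<in>{\<psi>. L2_path T \<psi> \<and> mild_solution T F Q x \<psi> z}. ereal (LINT t:{0..T}|lborel. (norm (\<psi> t))\<^sup>2))
      = (INF \<psi>\<in>{\<psi>. L2_path T \<psi> \<and> mild_solution T F Q x \<psi> z}. ereal (LINT t:{0..T}|lborel. (norm (\<phi> t))\<^sup>2))"
    by (intro INF_cong refl) (use same in auto)
  also have "\<dots> = ereal (LINT t:{0..T}|lborel. (norm (\<phi> t))\<^sup>2)"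
    using \<phi> by (intro cINF_const) auto
  finally show ?thesis by (simp add: rate_def)
qed

text \<open>Every argument of the matrix exponential lies in \<open>galerkin_space n\<close> and
  every time is nonnegative, so the heat semigroup may replace it. Both equations can then be
  treated by the same lemmas.\<close>

lemma galerkin_mild_solution_iff:
  "galerkin_mild_solution T F Q n (galerkin_proj n x) \<psi> z \<longleftrightarrow>
     continuous_on {0..T} z \<and> (\<forall>t\<in>{0..T}. z t \<in> galerkin_space n) \<and>
     (\<forall>t\<in>{0..T}. z t = heat_semigroup t (galerkin_proj n x)
        + (LINT s:{0..t}|lborel. heat_semigroup (t - s) (galerkin_proj n (F (z s) + op_sqrt Q (\<psi> s)))))"
proof -
  have "op_exp (galerkin_laplacian n) t (galerkin_proj n x) + (LINT s:{0..t}|lborel. op_exp (galerkin_laplacian n) (t - s)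
           (galerkin_proj n (F (z s)) + galerkin_proj n (op_sqrt Q (\<psi> s))))
      = heat_semigroup t (galerkin_proj n x)
        + (LINT s:{0..t}|lborel. heat_semigroup (t - s) (galerkin_proj n (F (z s) + op_sqrt Q (\<psi> s))))"
    if "t \<in> {0..T}" for t
    unfolding linear_add[OF bounded_linear.linear[OF bounded_linear_galerkin_proj], symmetric] using that
    by (intro arg_cong2[where f="(+)"] set_lebesgue_integral_cong)
      (auto simp: op_exp_galerkin_laplacian galerkin_proj_in_space)
  then show ?thesis by (simp add: galerkin_mild_solution_def cong: conj_cong)
qed

lemma galerkin_rate_eq:
  fixes F :: "L2 \<Rightarrow> L2"
  assumes F: "\<And>u v. norm (F u - F v) \<le> L_F * norm (u - v)"
    and \<phi>: "galerkin_L2_path n T \<phi>" "galerkin_mild_solution T F Q n (galerkin_proj n x) \<phi> z"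
  shows "galerkin_rate T F Q n (galerkin_proj n x) z = ereal (1/2 * (LINT t:{0..T}|lborel. (norm (\<phi> t))\<^sup>2))"
proof -
  let ?M = "{\<psi>. galerkin_L2_path n T \<psi> \<and> galerkin_mild_solution T F Q n (galerkin_proj n x) \<psi> z}"
  have z: "continuous_on {0..T} z" using \<phi>(2) by (simp add: galerkin_mild_solution_def)
  have int: "set_integrable lborel {0..T} (\<lambda>s. galerkin_proj n (F (z s) + op_sqrt Q (\<psi> s)))"
    if "L2_path T \<psi>" for \<psi>
    by (intro L2_path_set_integrable L2_path_bounded_linear[OF bounded_linear_galerkin_proj] L2_path_add
        L2_path_continuous lipschitz_continuous_on[OF F] z L2_path_bounded_linear[OF bounded_linear_op_sqrt] that)
  have same: "(LINT t:{0..T}|lborel. (norm (\<psi> t))\<^sup>2) = (LINT t:{0..T}|lborel. (norm (\<phi> t))\<^sup>2)"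
    if \<psi>: "galerkin_L2_path n T \<psi>" "galerkin_mild_solution T F Q n (galerkin_proj n x) \<psi> z" for \<psi>
  proof (rule set_integral_norm_power2_cong_AE)
    show paths: "L2_path T \<psi>" "L2_path T \<phi>"
      using \<psi>(1) \<phi>(1) by (simp_all add: galerkin_L2_path_def)
    have "AE s in lborel. s \<in> {0..T} \<longrightarrow>
        galerkin_proj n (F (z s) + op_sqrt Q (\<psi> s)) = galerkin_proj n (F (z s) + op_sqrt Q (\<phi> s))"
    proof (rule heat_integral_unique)
      fix t assume t: "t \<in> {0..T}"
      have e: "z t = heat_semigroup t (galerkin_proj n x)
          + (LINT s:{0..t}|lborel. heat_semigroup (t - s) (galerkin_proj n (F (z s) + op_sqrt Q (\<psi> s))))"
        "z t = heat_semigroup t (galerkin_proj n x)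
          + (LINT s:{0..t}|lborel. heat_semigroup (t - s) (galerkin_proj n (F (z s) + op_sqrt Q (\<phi> s))))"
        using \<psi>(2) \<phi>(2) t unfolding galerkin_mild_solution_iff by blast+
      show "(LINT s:{0..t}|lborel. heat_semigroup (t - s) (galerkin_proj n (F (z s) + op_sqrt Q (\<psi> s))))
        = (LINT s:{0..t}|lborel. heat_semigroup (t - s) (galerkin_proj n (F (z s) + op_sqrt Q (\<phi> s))))"
        by (rule add_left_imp_eq[OF trans[OF e(1)[symmetric] e(2)]])
    qed (intro int paths)+
    then show "AE s in lborel. s \<in> {0..T} \<longrightarrow> \<psi> s = \<phi> s"
    proof (rule eventually_mono, intro impI)
      fix s assume *: "s \<in> {0..T} \<longrightarrow>
        galerkin_proj n (F (z s) + op_sqrt Q (\<psi> s)) = galerkin_proj n (F (z s) + op_sqrt Q (\<phi> s))"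
        and s: "s \<in> {0..T}"
      have space: "\<psi> s \<in> galerkin_space n" "\<phi> s \<in> galerkin_space n"
        using \<psi>(1) \<phi>(1) s by (simp_all add: galerkin_L2_path_def)
      show "\<psi> s = \<phi> s"
      \<comment> \<open>The projected square root is injective only on
        \<open>galerkin_space n\<close>: up to index \<open>n\<close> the factor sqrt(q_i) is
        cancelled, and beyond it both coefficients vanish.\<close>
      proof (rule L2_eqI)
        fix i :: nat assume i: "i \<ge> 1"
        have "inner (galerkin_proj n (F (z s) + op_sqrt Q (\<psi> s))) (sin_basis i)
            = inner (galerkin_proj n (F (z s) + op_sqrt Q (\<phi> s))) (sin_basis i)"
          using * s by simp
        then show "inner (\<psi> s) (sin_basis i) = inner (\<phi> s) (sin_basis i)"
          using i q_pos[OF i] inner_galerkin_space[OF space(1), of i] inner_galerkin_space[OF space(2), of i]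
          by (cases "i \<le> n") (simp_all add: inner_galerkin_proj[OF i] inner_add_left inner_op_sqrt[OF i])
      qed
    qed
  qed
  have "(INF \<psi>\<in>?M. ereal (LINT t:{0..T}|lborel. (norm (\<psi> t))\<^sup>2))
      = (INF \<psi>\<in>?M. ereal (LINT t:{0..T}|lborel. (norm (\<phi> t))\<^sup>2))"
    by (intro INF_cong refl) (use same in auto)
  also have "\<dots> = ereal (LINT t:{0..T}|lborel. (norm (\<phi> t))\<^sup>2)"
    using \<phi> by (intro cINF_const) auto
  finally show ?thesis by (simp add: galerkin_rate_def)
qed

lemma galerkin_mild_solution_in_rate_dom:
  fixes F :: "L2 \<Rightarrow> L2"
  assumes F: "\<And>u v. norm (F u - F v) \<le> L_F * norm (u - v)"
    and \<phi>: "L2_path T \<phi>" and sol: "galerkin_mild_solution T F Q n (galerkin_proj n x) \<phi> z"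
  shows "z \<in> galerkin_rate_dom n (galerkin_proj n x) T"
proof -
  have z: "continuous_on {0..T} z" "\<And>t. t \<in> {0..T} \<Longrightarrow> z t \<in> galerkin_space n"
    using sol by (auto simp: galerkin_mild_solution_iff)
  define h where "h s = galerkin_proj n (F (z s) + op_sqrt Q (\<phi> s))" for s
  \<comment> \<open>Cutting the eigenvalues off at \<open>n\<close> makes the Laplacian a bounded
    operator with the same action on \<open>galerkin_space n\<close>, so the velocity
    \<open>v\<close> is visibly square-integrable.\<close>
  define c where "c i = (if i \<le> n then - eigval i else 0)" for i
  have c: "\<bar>c i\<bar> \<le> eigval n" for i
    by (auto simp: c_def eigval_def intro!: mult_left_mono power_mono)
  define v where "v s = diagonal_op c (z s) + h s" for s
  have h: "L2_path T h"
    unfolding h_def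
    by (intro L2_path_bounded_linear[OF bounded_linear_galerkin_proj] L2_path_add L2_path_continuous
        lipschitz_continuous_on[OF F] z L2_path_bounded_linear[OF bounded_linear_op_sqrt] \<phi>)
  have v: "L2_path T v"
    unfolding v_def
    by (intro L2_path_add h L2_path_bounded_linear[OF bounded_linear_diagonal_op[of c, OF c]] L2_path_continuous z)
  have vc: "inner (v s) (sin_basis i) = - eigval i * inner (z s) (sin_basis i) + inner (h s) (sin_basis i)"
    if "s \<in> {0..T}" "i \<ge> 1" for s i
    using inner_galerkin_space[OF z(2)[OF that(1)], of i]
    by (auto simp: v_def inner_add_left inner_diagonal_op[of c, OF c that(2)] c_def)
  have "\<forall>t\<in>{0..T}. z t = heat_semigroup t (galerkin_proj n x)
      + (LINT s:{0..t}|lborel. heat_semigroup (t - s) (h s))"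
    using sol unfolding galerkin_mild_solution_iff h_def by blast
  then have coord: "inner (z t) (sin_basis i) = inner (galerkin_proj n x) (sin_basis i)
      + (LINT s:{0..t}|lborel. - eigval i * inner (z s) (sin_basis i) + inner (h s) (sin_basis i))"
    if "t \<in> {0..T}" "i \<ge> 1" for t i
    unfolding duhamel_iff[OF z(1) L2_path_set_integrable[OF h]] using that by blast
  have "z t = galerkin_proj n x + (LINT s:{0..t}|lborel. v s)" if t: "t \<in> {0..T}" for t
  proof (rule L2_eqI)
    fix i :: nat assume i: "i \<ge> 1"
    have "inner (LINT s:{0..t}|lborel. v s) (sin_basis i) = (LINT s:{0..t}|lborel. inner (v s) (sin_basis i))"
      using set_integrable_initial[OF L2_path_set_integrable[OF v] t]
      unfolding set_lebesgue_integral_def set_integrable_def by (subst integral_inner_left[symmetric]) auto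
    also have "\<dots> = (LINT s:{0..t}|lborel. - eigval i * inner (z s) (sin_basis i) + inner (h s) (sin_basis i))"
      using t by (intro set_lebesgue_integral_cong allI impI vc i) auto
    finally show "inner (z t) (sin_basis i) = inner (galerkin_proj n x + (LINT s:{0..t}|lborel. v s)) (sin_basis i)"
      using coord[OF t i] by (simp add: inner_add_left)
  qed
  moreover have "v t \<in> galerkin_space n" if "t \<in> {0..T}" for t
  proof (rule galerkin_spaceI)
    fix i assume "i > n"
    then show "inner (v t) (sin_basis i) = 0"
      using inner_galerkin_space[OF z(2)[OF that], of i] vc[OF that, of i]
      by (simp add: h_def inner_galerkin_proj)
  qed
  ultimately show ?thesis
    using z v unfolding galerkin_rate_dom_def galerkin_L2_path_def by blast
qed

text \<open>The control is read off from the equation. Neither \<open>laplacian\<close> nor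
  \<open>op_inv_sqrt Q\<close> is bounded, so its measurability and the integral equation are both
  derived from the coefficient identity \<open>coeff\<close>.\<close>

lemma W12_Q_mild_solution:
  fixes F :: "L2 \<Rightarrow> L2"
  assumes F: "\<And>u v. norm (F u - F v) \<le> L_F * norm (u - v)"
    and T: "T > 0" and z: "z \<in> W12_Q T F Q"
  obtains \<phi> where "L2_path T \<phi>" "mild_solution T F Q (z 0) \<phi> z"
proof -
  obtain v w1 w2 where W: "W12_limit T z v w1 w2"
    and ae: "AE t\<in>{0..T} in lborel. z t \<in> laplacian_dom \<and> v t - laplacian (z t) - F (z t) \<in> range (op_sqrt Q)"
    and int: "set_integrable lborel {0..T} (\<lambda>t. (norm (op_inv_sqrt Q (v t - laplacian (z t) - F (z t))))\<^sup>2)"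
    using z unfolding W12_Q_def by blast
  have zc: "continuous_on {0..T} z" and v: "L2_path T v"
    using W by (simp_all add: W12_limit_def)
  let ?\<phi> = "\<lambda>t. op_inv_sqrt Q (v t - laplacian (z t) - F (z t))"
  \<comment> \<open>A Borel null set containing all exceptional times is fixed, so that setting the
    control to 0 on it keeps the control measurable.\<close>
  obtain N where bad: "{t \<in> space lborel. \<not> (t \<in> {0..T} \<longrightarrow> z t \<in> laplacian_dom \<and>
      v t - laplacian (z t) - F (z t) \<in> range (op_sqrt Q))} \<subseteq> N"
    and N: "emeasure lborel N = 0" "N \<in> sets lborel"
    by (rule AE_E[OF ae])
  have good: "z t \<in> laplacian_dom \<and> v t - laplacian (z t) - F (z t) \<in> range (op_sqrt Q)"
    if "t \<in> {0..T}" "t \<notin> N" for t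
    using subsetD[OF bad, of t] that by (simp only: mem_Collect_eq space_lborel space_borel UNIV_I simp_thms) blast
  have notN: "AE t in lborel. t \<notin> N"
    using N by (intro AE_not_in) (simp add: null_sets_def)
  define \<phi> where "\<phi> t = (if t \<in> {0..T} - N then ?\<phi> t else 0)" for t
  have coeff: "sqrt (q i) * inner (\<phi> t) (sin_basis i)
      = inner (v t) (sin_basis i) + eigval i * inner (z t) (sin_basis i) - inner (F (z t)) (sin_basis i)"
    if "t \<in> {0..T}" "t \<notin> N" "i \<ge> 1" for t i
    using that op_sqrt_op_inv_sqrt[of "v t - laplacian (z t) - F (z t)"] good[OF that(1,2)]
      inner_op_sqrt[OF that(3), of "?\<phi> t"] inner_laplacian[of "z t" i]
    by (simp add: \<phi>_def inner_diff_left)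
  have \<phi>m: "(\<lambda>t. indicat_real {0..T} t *\<^sub>R \<phi> t) \<in> borel_measurable lborel"
  proof (rule borel_measurable_L2I)
    fix i :: nat assume i: "i \<ge> 1"
    have Fz: "L2_path T (\<lambda>t. F (z t))"
      by (intro L2_path_continuous lipschitz_continuous_on[OF F zc])
    have [measurable]: "(\<lambda>t. indicat_real {0..T} t * inner (u t) (sin_basis i)) \<in> borel_measurable lborel"
      if "L2_path T u" for u
      using heat_integrand(2)[OF L2_path_set_integrable[OF that] i] by (simp add: set_integrable_def)
    have eq: "inner (indicat_real {0..T} t *\<^sub>R \<phi> t) (sin_basis i) = indicat_real (- N) t *
        (indicat_real {0..T} t * inner (v t) (sin_basis i) + eigval i * (indicat_real {0..T} t * inner (z t) (sin_basis i))
          - indicat_real {0..T} t * inner (F (z t)) (sin_basis i)) / sqrt (q i)" for t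
      using coeff[of t i] i q_pos[OF i] by (auto simp: indicator_def \<phi>_def field_simps)
    have [measurable]: "- N \<in> sets lborel" using N(2) by auto
    show "(\<lambda>t. inner (indicat_real {0..T} t *\<^sub>R \<phi> t) (sin_basis i)) \<in> borel_measurable lborel"
      unfolding eq using v Fz L2_path_continuous[OF zc] by measurable
  qed
  have "integrable lborel (\<lambda>t. indicat_real {0..T} t *\<^sub>R (norm (\<phi> t))\<^sup>2)"
  proof (rule integrable_cong_AE_imp)
    show "integrable lborel (\<lambda>t. indicat_real {0..T} t *\<^sub>R (norm (?\<phi> t))\<^sup>2)"
      using int by (simp only: set_integrable_def)
    have "(\<lambda>t. (norm (indicat_real {0..T} t *\<^sub>R \<phi> t))\<^sup>2) \<in> borel_measurable lborel"
      using \<phi>m by measurable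
    also have "(\<lambda>t. (norm (indicat_real {0..T} t *\<^sub>R \<phi> t))\<^sup>2) = (\<lambda>t. indicat_real {0..T} t *\<^sub>R (norm (\<phi> t))\<^sup>2)"
      by (auto simp: indicator_def)
    finally show "(\<lambda>t. indicat_real {0..T} t *\<^sub>R (norm (\<phi> t))\<^sup>2) \<in> borel_measurable lborel" .
    show "AE t in lborel. indicat_real {0..T} t *\<^sub>R (norm (?\<phi> t))\<^sup>2 = indicat_real {0..T} t *\<^sub>R (norm (\<phi> t))\<^sup>2"
      using notN
    proof (rule eventually_mono)
      fix t assume "t \<notin> N"
      then have "\<phi> t = ?\<phi> t" if "t \<in> {0..T}"
        unfolding \<phi>_def using that by (simp only: if_True Diff_iff simp_thms)
      then show "indicat_real {0..T} t *\<^sub>R (norm (?\<phi> t))\<^sup>2 = indicat_real {0..T} t *\<^sub>R (norm (\<phi> t))\<^sup>2"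
        by (cases "t \<in> {0..T}") (simp_all only: indicator_simps scaleR_zero_left simp_thms)
    qed
  qed
  with \<phi>m have \<phi>: "L2_path T \<phi>"
    unfolding L2_path_def set_borel_measurable_def set_integrable_def by (rule conjI)
  let ?h = "\<lambda>s. F (z s) + op_sqrt Q (\<phi> s)"
  have hi: "set_integrable lborel {0..T} ?h"
    by (rule forcing_set_integrable[OF F zc \<phi>])
  have "\<forall>i\<ge>1. \<forall>t\<in>{0..T}. inner (z t) (sin_basis i) = inner (z 0) (sin_basis i)
          + (LINT s:{0..t}|lborel. - eigval i * inner (z s) (sin_basis i) + inner (?h s) (sin_basis i))"
  proof (intro allI impI ballI)
    fix i :: nat and t assume i: "i \<ge> 1" and t: "t \<in> {0..T}"
    have "(LINT s:{0..t}|lborel. inner (v s) (sin_basis i))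
        = (LINT s:{0..t}|lborel. - eigval i * inner (z s) (sin_basis i) + inner (?h s) (sin_basis i))"
      unfolding set_lebesgue_integral_def
    proof (rule integral_cong_AE)
      have "set_integrable lborel {0..t} (\<lambda>s. inner (v s) (sin_basis i))"
        by (rule heat_integrand(2)[OF set_integrable_initial[OF L2_path_set_integrable[OF v] t] i])
      then show "(\<lambda>s. indicator {0..t} s *\<^sub>R inner (v s) (sin_basis i)) \<in> borel_measurable lborel"
        by (simp add: set_integrable_def)
      have "set_integrable lborel {0..t} (\<lambda>s. - eigval i * inner (z s) (sin_basis i) + inner (?h s) (sin_basis i))"
        by (intro set_integral_add(1) set_integrable_mult_right heat_integrand(2)[OF set_integrable_initial[OF _ t] i]
            hi borel_integrable_atLeastAtMost' zc)
      then show "(\<lambda>s. indicator {0..t} s *\<^sub>R (- eigval i * inner (z s) (sin_basis i) + inner (?h s) (sin_basis i)))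
          \<in> borel_measurable lborel"
        by (simp only: set_integrable_def borel_measurable_integrable)
      show "AE s in lborel. indicator {0..t} s *\<^sub>R inner (v s) (sin_basis i)
          = indicator {0..t} s *\<^sub>R (- eigval i * inner (z s) (sin_basis i) + inner (?h s) (sin_basis i))"
        using notN
      proof (rule eventually_mono)
        fix s assume "s \<notin> N"
        then show "indicator {0..t} s *\<^sub>R inner (v s) (sin_basis i)
          = indicator {0..t} s *\<^sub>R (- eigval i * inner (z s) (sin_basis i) + inner (?h s) (sin_basis i))"
          using coeff[of s i] i t inner_op_sqrt[OF i, of "\<phi> s"]
          by (cases "s \<in> {0..t}") (auto simp: inner_add_left)
      qed
    qed
    then show "inner (z t) (sin_basis i) = inner (z 0) (sin_basis i)
          + (LINT s:{0..t}|lborel. - eigval i * inner (z s) (sin_basis i) + inner (?h s) (sin_basis i))"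
      using W12_limit_inner_time[OF W T t i] by simp
  qed
  then have "mild_solution T F Q (z 0) \<phi> z"
    unfolding mild_solution_def duhamel_iff[OF zc hi, symmetric] using zc by blast
  with \<phi> show thesis by (rule that)
qed

text \<open>Adding the projected equation of \<open>z\<close> to that of \<open>w\<close> cancels
  F(z). Since the square root of \<open>Q\<close> is diagonal, projecting after it sees only the
  projected control, which may therefore replace \<phi>.\<close>

lemma galerkin_perturbation_mild_solution:
  fixes F :: "L2 \<Rightarrow> L2"
  assumes F: "\<And>u v. norm (F u - F v) \<le> L_F * norm (u - v)"
    and \<phi>: "L2_path T \<phi>" "mild_solution T F Q x \<phi> z"
    and w: "continuous_on {0..T} w"
    and w_eq: "\<And>t. t \<in> {0..T} \<Longrightarrow> w t = galerkin_proj n (z t)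
      + (LINT s:{0..t}|lborel. heat_semigroup (t - s) (galerkin_proj n (F (w s) - F (z s))))"
  shows "galerkin_mild_solution T F Q n (galerkin_proj n x) (\<lambda>t. galerkin_proj n (\<phi> t)) w"
proof -
  note lin = bounded_linear.linear[OF bounded_linear_galerkin_proj]
  have z: "continuous_on {0..T} z" using \<phi>(2) by (simp add: mild_solution_def)
  have di: "set_integrable lborel {0..T} (\<lambda>s. galerkin_proj n (F (w s) - F (z s)))"
    by (intro borel_integrable_atLeastAtMost' bounded_linear.continuous_on[OF bounded_linear_galerkin_proj]
        continuous_intros lipschitz_continuous_on[OF F] w z)
  have hi: "set_integrable lborel {0..T} (\<lambda>s. F (z s) + op_sqrt Q (\<phi> s))"
    by (rule forcing_set_integrable[OF F z \<phi>(1)])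
  have phi: "set_integrable lborel {0..T} (\<lambda>s. galerkin_proj n (F (z s) + op_sqrt Q (\<phi> s)))"
    by (intro L2_path_set_integrable L2_path_bounded_linear[OF bounded_linear_galerkin_proj] L2_path_add
        L2_path_continuous lipschitz_continuous_on[OF F] z L2_path_bounded_linear[OF bounded_linear_op_sqrt] \<phi>)
  have mild: "w t = heat_semigroup t (galerkin_proj n x)
      + (LINT s:{0..t}|lborel. heat_semigroup (t - s) (galerkin_proj n (F (w s) + op_sqrt Q (galerkin_proj n (\<phi> s)))))"
    and space: "w t \<in> galerkin_space n" if t: "t \<in> {0..T}" for t
  proof -
    have "z t = heat_semigroup t x + (LINT s:{0..t}|lborel. heat_semigroup (t - s) (F (z s) + op_sqrt Q (\<phi> s)))"
      using \<phi>(2) t by (simp add: mild_solution_def)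
    then have "galerkin_proj n (z t) = heat_semigroup t (galerkin_proj n x)
        + (LINT s:{0..t}|lborel. heat_semigroup (t - s) (galerkin_proj n (F (z s) + op_sqrt Q (\<phi> s))))"
      using t by (simp add: linear_add[OF lin] galerkin_proj_heat_semigroup
          galerkin_proj_heat_integral[OF set_integrable_initial[OF hi t]])
    then have "w t = heat_semigroup t (galerkin_proj n x)
        + ((LINT s:{0..t}|lborel. heat_semigroup (t - s) (galerkin_proj n (F (z s) + op_sqrt Q (\<phi> s))))
        + (LINT s:{0..t}|lborel. heat_semigroup (t - s) (galerkin_proj n (F (w s) - F (z s)))))"
      using w_eq[OF t] by simp
    also have "(LINT s:{0..t}|lborel. heat_semigroup (t - s) (galerkin_proj n (F (z s) + op_sqrt Q (\<phi> s))))
        + (LINT s:{0..t}|lborel. heat_semigroup (t - s) (galerkin_proj n (F (w s) - F (z s))))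
        = (LINT s:{0..t}|lborel. heat_semigroup (t - s) (galerkin_proj n (F (z s) + op_sqrt Q (\<phi> s)))
            + heat_semigroup (t - s) (galerkin_proj n (F (w s) - F (z s))))"
      by (intro set_integral_add(2)[symmetric] heat_integrand(1)[OF _ le_refl] set_integrable_initial[OF _ t] phi di)
    also have "\<dots> = (LINT s:{0..t}|lborel. heat_semigroup (t - s)
        (galerkin_proj n (F (w s) + op_sqrt Q (galerkin_proj n (\<phi> s)))))"
    proof (intro set_lebesgue_integral_cong allI impI)
      fix s assume "s \<in> {0..t}"
      then show "heat_semigroup (t - s) (galerkin_proj n (F (z s) + op_sqrt Q (\<phi> s)))
            + heat_semigroup (t - s) (galerkin_proj n (F (w s) - F (z s)))
          = heat_semigroup (t - s) (galerkin_proj n (F (w s) + op_sqrt Q (galerkin_proj n (\<phi> s))))"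
        by (intro L2_eqI) (simp add: inner_add_left inner_diff_left inner_heat_semigroup inner_galerkin_proj
            inner_op_sqrt algebra_simps)
    qed simp
    finally show "w t = heat_semigroup t (galerkin_proj n x)
      + (LINT s:{0..t}|lborel. heat_semigroup (t - s) (galerkin_proj n (F (w s) + op_sqrt Q (galerkin_proj n (\<phi> s)))))" .
    have "(LINT s:{0..t}|lborel. heat_semigroup (t - s) (galerkin_proj n (F (w s) - F (z s)))) \<in> galerkin_space n"
      by (rule galerkin_heat_integral(1)[OF di galerkin_proj_in_space t])
    then show "w t \<in> galerkin_space n"
      unfolding w_eq[OF t] galerkin_space_def
      by (intro span_add) (use galerkin_proj_in_space in \<open>auto simp: galerkin_space_def\<close>)
  qed
  show ?thesis
    unfolding galerkin_mild_solution_iff using mild space w by blast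
qed

end

section \<open>Convergence of the control cost and choice of the dimension\<close>

lemma galerkin_proj_control_cost_tendsto:
  assumes "L2_path T \<phi>"
  shows "(\<lambda>n. LINT t:{0..T}|lborel. (norm (galerkin_proj n (\<phi> t)))\<^sup>2) \<longlonglongrightarrow> (LINT t:{0..T}|lborel. (norm (\<phi> t))\<^sup>2)"
  unfolding set_lebesgue_integral_def
proof (rule integral_dominated_convergence)
  show int: "integrable lborel (\<lambda>t. indicator {0..T} t *\<^sub>R (norm (\<phi> t))\<^sup>2)"
    using assms by (simp add: L2_path_def set_integrable_def)
  then show "(\<lambda>t. indicator {0..T} t *\<^sub>R (norm (\<phi> t))\<^sup>2) \<in> borel_measurable lborel"
    by (rule borel_measurable_integrable)
  show "(\<lambda>t. indicator {0..T} t *\<^sub>R (norm (galerkin_proj n (\<phi> t)))\<^sup>2) \<in> borel_measurable lborel" for n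
    by (intro L2_path_norm_power2_measurable L2_path_bounded_linear[OF bounded_linear_galerkin_proj assms])
  show "AE t in lborel. (\<lambda>n. indicator {0..T} t *\<^sub>R (norm (galerkin_proj n (\<phi> t)))\<^sup>2)
      \<longlonglongrightarrow> indicator {0..T} t *\<^sub>R (norm (\<phi> t))\<^sup>2"
    by (intro AE_I2 tendsto_intros galerkin_proj_tendsto)
  show "AE t in lborel. norm (indicator {0..T} t *\<^sub>R (norm (galerkin_proj n (\<phi> t)))\<^sup>2)
      \<le> indicator {0..T} t *\<^sub>R (norm (\<phi> t))\<^sup>2" for n
    by (intro AE_I2) (auto simp: indicator_def norm_galerkin_proj_le)
qed

theorem theorem3p4:
  fixes Q F :: "L2 \<Rightarrow> L2"
    and q :: "nat \<Rightarrow> real"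
    and F' :: "L2 \<Rightarrow> L2 \<Rightarrow> L2"
    and L_F L T :: real
    and x :: L2
  assumes "bounded_linear Q"
    and "self_adjoint Q"
    and "\<And>u. u \<noteq> 0 \<Longrightarrow> 0 < inner (Q u) u"
    and "\<And>i. i \<ge> 1 \<Longrightarrow> Q (sin_basis i) = q i *\<^sub>R sin_basis i"
    and "\<And>i. i \<ge> 1 \<Longrightarrow> q i > 0"
    and "laplacian_dom \<subseteq> range (op_sqrt Q)"
    and "range (op_sqrt Q) \<subseteq> Hdot 1"
    and "hilbert_schmidt (\<lambda>u. neg_laplacian_powr (1/2) (op_sqrt Q u))"
    and "bounded_linear (\<lambda>u. op_inv_sqrt Q (laplacian_inverse u))"
    and "\<And>u. (F has_derivative F' u) (at u)"
    and "L_F > 0" and "L > 0"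
    and "\<And>u v. norm (F u - F v) \<le> L_F * norm (u - v)"
    and "\<And>u. u \<in> Hdot 1 \<Longrightarrow> F u \<in> Hdot 1 \<and> norm_Hdot 1 (F u) \<le> L * (1 + norm_Hdot 1 u)"
    and "\<And>u v. u \<in> Hdot 2 \<Longrightarrow> v \<in> Hdot 2 \<Longrightarrow>
           F' u v \<in> Hdot 2 \<and> norm_Hdot 2 (F' u v) \<le> L * (1 + (norm_Hdot 2 u)\<^sup>2) * norm_Hdot 2 v"
    and "T > 0" and "x \<in> Hdot 2"
  shows "\<forall>\<kappa>>0. \<forall>z\<in>W12_Q T F Q. z 0 = x \<longrightarrow>
    (\<exists>n\<ge>1. \<exists>zn\<in>galerkin_rate_dom n (galerkin_proj n x) T.
       (SUP t\<in>{0..T}. norm (z t - zn t)) < \<kappa> \<and>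
       \<bar>rate T F Q x z - galerkin_rate T F Q n (galerkin_proj n x) zn\<bar> < ereal \<kappa>)"
proof (intro allI impI ballI)
  fix \<kappa> :: real and z
  assume \<kappa>: "\<kappa> > 0" and z: "z \<in> W12_Q T F Q" and z0: "z 0 = x"
  interpret diagonal_covariance Q q
    by (rule diagonal_covariance.intro) (fact assms)+
  note F = \<open>\<And>u v. norm (F u - F v) \<le> L_F * norm (u - v)\<close>
  obtain \<phi> where \<phi>: "L2_path T \<phi>" "mild_solution T F Q x \<phi> z"
    using W12_Q_mild_solution[OF F \<open>T > 0\<close> z] z0 by blast
  have zc: "continuous_on {0..T} z"
    using \<phi>(2) by (simp add: mild_solution_def)
  \<comment> \<open>The perturbation bound then reads \<kappa> / 2. Half of \<kappa> is left because
    a supremum of strict bounds by \<kappa> could equal \<kappa>.\<close>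
  define \<delta> where "\<delta> = \<kappa> / (4 * exp (2 * L_F * T))"
  have \<delta>: "\<delta> > 0" using \<kappa> by (simp add: \<delta>_def)
  let ?I = "\<lambda>\<phi>. LINT t:{0..T}|lborel. (norm (\<phi> t))\<^sup>2"
  have "\<forall>\<^sub>F n in sequentially. \<forall>u\<in>z ` {0..T}. norm (galerkin_proj n u - u) < \<delta>"
    by (rule galerkin_proj_uniform_on_compact[OF compact_continuous_image[OF zc compact_Icc] \<delta>])
  \<comment> \<open>Closeness \<kappa> of the integrals is enough, since the rates carry a factor
    1/2.\<close>
  moreover have "\<forall>\<^sub>F n in sequentially. dist (?I (\<lambda>t. galerkin_proj n (\<phi> t))) (?I \<phi>) < \<kappa>"
    by (rule tendstoD[OF galerkin_proj_control_cost_tendsto[OF \<phi>(1)] \<kappa>])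
  ultimately have "\<forall>\<^sub>F n in sequentially. n \<ge> 1 \<and> (\<forall>u\<in>z ` {0..T}. norm (galerkin_proj n u - u) < \<delta>)
      \<and> dist (?I (\<lambda>t. galerkin_proj n (\<phi> t))) (?I \<phi>) < \<kappa>"
    using eventually_ge_at_top[of "1::nat"] by eventually_elim blast
  then obtain n where n: "n \<ge> 1" "\<And>t. t \<in> {0..T} \<Longrightarrow> norm (galerkin_proj n (z t) - z t) < \<delta>"
    "dist (?I (\<lambda>t. galerkin_proj n (\<phi> t))) (?I \<phi>) < \<kappa>"
    by (auto dest!: eventually_happens'[OF sequentially_bot])
  obtain w where w: "continuous_on {0..T} w" "\<And>t. t \<in> {0..T} \<Longrightarrow> w t = galerkin_proj n (z t)
      + (LINT s:{0..t}|lborel. heat_semigroup (t - s) (galerkin_proj n (F (w s) - F (z s))))"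
    "\<And>t. t \<in> {0..T} \<Longrightarrow> norm (w t - z t) \<le> 2 * \<delta> * exp (2 * L_F * T)"
    using galerkin_perturbation[OF F \<open>L_F > 0\<close> zc less_imp_le[OF n(2)] less_imp_le[OF \<delta>]] by blast
  have sol: "galerkin_mild_solution T F Q n (galerkin_proj n x) (\<lambda>t. galerkin_proj n (\<phi> t)) w"
    by (rule galerkin_perturbation_mild_solution[OF F \<phi> w(1,2)])
  have path: "L2_path T (\<lambda>t. galerkin_proj n (\<phi> t))"
    by (rule L2_path_bounded_linear[OF bounded_linear_galerkin_proj \<phi>(1)])
  have "w \<in> galerkin_rate_dom n (galerkin_proj n x) T"
    by (rule galerkin_mild_solution_in_rate_dom[OF F path sol])
  moreover have "(SUP t\<in>{0..T}. norm (z t - w t)) < \<kappa>"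
  proof -
    have "(SUP t\<in>{0..T}. norm (z t - w t)) \<le> \<kappa> / 2"
    proof (rule cSUP_least)
      show "norm (z t - w t) \<le> \<kappa> / 2" if "t \<in> {0..T}" for t
        using w(3)[OF that] by (simp add: \<delta>_def norm_minus_commute)
    qed (use \<open>T > 0\<close> in auto)
    then show ?thesis using \<kappa> by linarith
  qed
  moreover have "\<bar>rate T F Q x z - galerkin_rate T F Q n (galerkin_proj n x) w\<bar> < ereal \<kappa>"
  proof -
    have "galerkin_L2_path n T (\<lambda>t. galerkin_proj n (\<phi> t))"
      using path by (simp add: galerkin_L2_path_def galerkin_proj_in_space)
    from galerkin_rate_eq[OF F this sol] rate_eq[OF F \<phi>] show ?thesis
      using n(3) \<kappa> by (simp add: dist_real_def abs_if split: if_splits)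
  qed
  ultimately show "\<exists>n\<ge>1. \<exists>zn\<in>galerkin_rate_dom n (galerkin_proj n x) T.
       (SUP t\<in>{0..T}. norm (z t - zn t)) < \<kappa> \<and>
       \<bar>rate T F Q x z - galerkin_rate T F Q n (galerkin_proj n x) zn\<bar> < ereal \<kappa>"
    using n(1) by blast
qed

end
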